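(* For any distinct $\alpha,\beta\in[0,\pi)$, the $2\times 2$ spin model subfactors $\mathscr{R}_{\mathsf{H}_\alpha},\mathscr{R}_{\mathsf{H}_\beta}$ of the hyperfinite $\mathrm{II}_1$-factor $\mathscr{R}$ satisfy $$\mathrm{d}_{\mathrm{MT}}(\mathscr{R}_{\mathsf{H}_\alpha},\mathscr{R}_{\mathsf{H}_\beta})=|\sin(\alpha-\beta)|.$$
   Context: Let $n\ge 2$; $\mathbb{M}_n$ is the algebra of $n\times n$ complex matrices with matrix units $E_{ij}$ and identity $\mathbb{I}_n$, and $\Delta\subset \mathbb{M}_n$ is the algebra of diagonal matrices. A Hadamard unitary in $\mathbb{M}_n$ is a unitary matrix all of whose entries have modulus $n^{-1/2}$. Ambient factor: $\mathscr{R}$ is the hyperfinite $\mathrm{II}_1$-factor obtained as the weak closure, in the GNS representation of the unique normalized trace $\tau$, of $\bigcup_k \mathbb{M}_n^{\otimes k}$, where $\mathbb{M}_n^{\otimes k}\subset\mathbb{M}_n^{\otimes(k+1)}$ via $x\mapsto x\otimes \mathbb{I}_n$. Spin model subfactor: for a Hadamard unitary $u=(u_{ij})\in\mathbb{M}_n$ put $D_u:=\sqrt n\sum_{i,j}\overline{u_{ij}}\,(E_{jj}\otimes E_{ii})$, $u_1:=(u\otimes \mathbb{I}_n)D_u\in\mathbb{M}_n\otimes\Delta$, and for $k\ge1$, $u_{2k-1}:=\prod_{i=0}^{k-1}\big(\mathbb{I}_n^{\otimes i}\otimes u_1\otimes \mathbb{I}_n^{\otimes (k-1-i)}\big)\in\mathbb{M}_n^{\otimes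 (k+1)}$ (factors ordered from left to right with increasing $i$). The algebras $u_{2k-1}(\mathbb{M}_n^{\otimes k}\otimes \mathbb{I}_n)u_{2k-1}^*$ increase with $k$, and $\mathscr{R}_u\subset\mathscr{R}$ is the weak closure of their union. For $\alpha\in\mathbb{R}$, $\mathsf{H}_\alpha:=\frac{1}{\sqrt2}\begin{pmatrix}1&1\\ e^{i\alpha}&-e^{i\alpha}\end{pmatrix}$, a $2\times2$ Hadamard unitary; here $n=2$. Mashood–Taylor distance: for von Neumann subalgebras $P,Q$ of a finite von Neumann algebra $M$ with faithful normal tracial state $\tau$, $\mathrm{d}_{\mathrm{MT}}(P,Q)$ is the Hausdorff distance, with respect to $\|x\|_\tau=\tau(x^*x)^{1/2}$, between the operator-norm closed unit balls of $P$ and $Q$: $\mathrm{d}_{\mathrm{MT}}(P,Q)=\max\{\sup_{x\in (P)_1}\inf_{y\in (Q)_1}\|x-y\|_\tau,\ \sup_{y\in (Q)_1}\inf_{x\in (P)_1}\|x-y\|_\tau\}$. *)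

theory Defs
  imports
    "HOL-Analysis.Bounded_Linear_Function"
    "HOL-Analysis.Convex"
    "Jordan_Normal_Form.Schur_Decomposition"
begin

section \<open>Operators on a complex Hilbert space\<close>

text \<open>
  The inner product is linear in its second argument. The norm is the one of \<^class>\<open>real_inner\<close>,
  so that \<open>(norm x)\<^sup>2 = Re (cinner x x)\<close>.
\<close>

class complex_hilbert_space = real_inner + complete_space +
  fixes scaleC :: "complex \<Rightarrow> 'a \<Rightarrow> 'a"  (infixr \<open>*\<^sub>C\<close> 75)
    and cinner :: "'a \<Rightarrow> 'a \<Rightarrow> complex"
  assumes scaleC_add_right: "c *\<^sub>C (x + y) = c *\<^sub>C x + c *\<^sub>C y"
    and scaleC_add_left: "(c + d) *\<^sub>C x = c *\<^sub>C x + d *\<^sub>C x"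
    and scaleC_scaleC: "c *\<^sub>C d *\<^sub>C x = (c * d) *\<^sub>C x"
    and scaleR_eq_scaleC: "r *\<^sub>R x = complex_of_real r *\<^sub>C x"
    and cinner_add_right: "cinner x (y + z) = cinner x y + cinner x z"
    and cinner_scaleC_right: "cinner x (c *\<^sub>C y) = c * cinner x y"
    and cinner_commute: "cinner x y = cnj (cinner y x)"
    and inner_eq_Re_cinner: "inner x y = Re (cinner x y)"

text \<open>
  The library type \<open>'h \<Rightarrow>\<^sub>L 'h\<close> consists of the bounded real-linear maps; its norm is the
  operator norm. The euclidean topology on a function type is the product topology, so the pullback
  below is the topology of pointwise convergence of all matrix coefficients. The adjoint exists
  uniquely on \<open>bounded_operators\<close>; see \<open>cinner_cadjoint\<close> and \<open>cadjoint_unique\<close>.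
\<close>

definition bounded_operators :: "('h::complex_hilbert_space \<Rightarrow>\<^sub>L 'h) set" where
  "bounded_operators = {T :: 'h \<Rightarrow>\<^sub>L 'h. \<forall>c \<xi>. T (c *\<^sub>C \<xi>) = c *\<^sub>C T \<xi>}"

definition weak_operator_topology :: "('h::complex_hilbert_space \<Rightarrow>\<^sub>L 'h) topology" where
  "weak_operator_topology =
     pullback_topology bounded_operators (\<lambda>T p. cinner (fst p) (T (snd p))) euclidean"

definition cadjoint :: "('h::complex_hilbert_space \<Rightarrow>\<^sub>L 'h) \<Rightarrow> ('h \<Rightarrow>\<^sub>L 'h)" where
  "cadjoint T = (THE S :: 'h \<Rightarrow>\<^sub>L 'h. \<forall>\<xi> \<eta>. cinner (S \<xi>) \<eta> = cinner \<xi> (T \<eta>))"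


section \<open>The Mashood--Taylor distance\<close>

definition tau_norm ::
  "(('h::complex_hilbert_space \<Rightarrow>\<^sub>L 'h) \<Rightarrow> complex) \<Rightarrow> ('h \<Rightarrow>\<^sub>L 'h) \<Rightarrow> real" where
  "tau_norm \<tau> T = sqrt (Re (\<tau> (cadjoint T o\<^sub>L T)))"

definition op_unit_ball ::
  "('h::complex_hilbert_space \<Rightarrow>\<^sub>L 'h) set \<Rightarrow> ('h \<Rightarrow>\<^sub>L 'h) set" where
  "op_unit_ball P = {T \<in> P. norm T \<le> 1}"

text \<open>
  All suprema and infima range over nonempty bounded sets of reals when \<open>P\<close> and \<open>Q\<close> are subalgebras
  and \<open>\<tau>\<close> is a state. The ambient algebra enters only through \<open>\<tau>\<close>.
\<close>

definition MT_dist ::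
  "(('h::complex_hilbert_space \<Rightarrow>\<^sub>L 'h) \<Rightarrow> complex) \<Rightarrow>
    ('h \<Rightarrow>\<^sub>L 'h) set \<Rightarrow> ('h \<Rightarrow>\<^sub>L 'h) set \<Rightarrow> real" where
  "MT_dist \<tau> P Q =
     max (SUP x\<in>op_unit_ball P. INF y\<in>op_unit_ball Q. tau_norm \<tau> (x - y))
         (SUP y\<in>op_unit_ball Q. INF x\<in>op_unit_ball P. tau_norm \<tau> (x - y))"


section \<open>Tensor powers of a matrix algebra and their GNS representation\<close>

definition kron :: "complex mat \<Rightarrow> complex mat \<Rightarrow> complex mat"  (infixl \<open>\<otimes>\<^sub>m\<close> 71) where
  "A \<otimes>\<^sub>m B = mat (dim_row A * dim_row B) (dim_col A * dim_col B)
     (\<lambda>(i, j). A $$ (i div dim_row B, j div dim_col B) * B $$ (i mod dim_row B, j mod dim_col B))"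

definition matrix_unit :: "nat \<Rightarrow> nat \<Rightarrow> nat \<Rightarrow> complex mat" where
  "matrix_unit n i j = mat n n (\<lambda>(r, c). if r = i \<and> c = j then 1 else 0)"

definition normalized_trace :: "complex mat \<Rightarrow> complex" where
  "normalized_trace A = (\<Sum>i<dim_row A. A $$ (i, i)) / of_nat (dim_row A)"

text \<open>
  The \<open>k\<close>-th tensor power of the \<open>n \<times> n\<close> matrices is \<open>carrier_mat (n ^ k) (n ^ k)\<close>, and a tensor
  power sits in the next one by \<open>A \<mapsto> A \<otimes>\<^sub>m 1\<^sub>m n\<close>. For \<open>n \<ge> 2\<close> the size of a matrix determines \<open>k\<close>,
  so a function on the union over \<open>k\<close> of these carriers which is compatible with the inclusions is
  the same thing as a function on the inductive limit.
\<close>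

definition tensor_powers :: "nat \<Rightarrow> complex mat set" where
  "tensor_powers n = (\<Union>k. carrier_mat (n ^ k) (n ^ k))"

text \<open>
  The GNS representation of the normalized trace is characterised, up to unitary equivalence, as a
  *-representation \<open>\<pi>\<close> of the inductive limit with a cyclic vector \<open>\<Omega>\<close> that implements the trace.
  That such representations exist is shown in \<open>gns_representation_exists\<close> below.
\<close>

locale gns_representation =
  fixes n :: nat
    and \<pi> :: "complex mat \<Rightarrow> ('h::complex_hilbert_space \<Rightarrow>\<^sub>L 'h)"
    and \<Omega> :: 'h
  assumes n_ge_2: "n \<ge> 2"
    and rep_bounded: "A \<in> tensor_powers n \<Longrightarrow> \<pi> A \<in> bounded_operators"
    and rep_incl: "A \<in> tensor_powers n \<Longrightarrow> \<pi> (A \<otimes>\<^sub>m 1\<^sub>m n) = \<pi> A"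
    and rep_one: "\<pi> (1\<^sub>m (n ^ k)) = id_blinfun"
    and rep_add: "\<lbrakk>A \<in> carrier_mat (n ^ k) (n ^ k); B \<in> carrier_mat (n ^ k) (n ^ k)\<rbrakk>
      \<Longrightarrow> \<pi> (A + B) = \<pi> A + \<pi> B"
    and rep_smult: "A \<in> tensor_powers n \<Longrightarrow> \<pi> (c \<cdot>\<^sub>m A) \<xi> = c *\<^sub>C \<pi> A \<xi>"
    and rep_mult: "\<lbrakk>A \<in> carrier_mat (n ^ k) (n ^ k); B \<in> carrier_mat (n ^ k) (n ^ k)\<rbrakk>
      \<Longrightarrow> \<pi> (A * B) = \<pi> A o\<^sub>L \<pi> B"
    and rep_adjoint: "A \<in> tensor_powers n \<Longrightarrow> \<pi> (mat_adjoint A) = cadjoint (\<pi> A)"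
    and rep_trace: "A \<in> tensor_powers n \<Longrightarrow> cinner \<Omega> (\<pi> A \<Omega>) = normalized_trace A"
    and rep_cyclic: "closure ((\<lambda>A. \<pi> A \<Omega>) ` tensor_powers n) = UNIV"

text \<open>On the weak closure of the image of \<open>\<pi>\<close>, the vector state of \<open>\<Omega>\<close> is the trace.\<close>

definition vector_state :: "'h::complex_hilbert_space \<Rightarrow> ('h \<Rightarrow>\<^sub>L 'h) \<Rightarrow> complex" where
  "vector_state \<Omega> T = cinner \<Omega> (T \<Omega>)"

definition hyperfinite_factor ::
  "nat \<Rightarrow> (complex mat \<Rightarrow> ('h::complex_hilbert_space \<Rightarrow>\<^sub>L 'h)) \<Rightarrow> ('h \<Rightarrow>\<^sub>L 'h) set" where
  "hyperfinite_factor n \<pi> = Abstract_Topology.closure_of weak_operator_topology (\<pi> ` tensor_powers n)"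


section \<open>Spin model subfactors\<close>

definition hadamard_unitary :: "nat \<Rightarrow> complex mat \<Rightarrow> bool" where
  "hadamard_unitary n u \<longleftrightarrow> u \<in> carrier_mat n n \<and> u * mat_adjoint u = 1\<^sub>m n \<and>
     mat_adjoint u * u = 1\<^sub>m n \<and> (\<forall>i<n. \<forall>j<n. cmod (u $$ (i, j)) = 1 / sqrt (real n))"

definition D_mat :: "nat \<Rightarrow> complex mat \<Rightarrow> complex mat" where
  "D_mat n u = complex_of_real (sqrt (real n)) \<cdot>\<^sub>m mat (n * n) (n * n)
     (\<lambda>rc. \<Sum>i<n. \<Sum>j<n. cnj (u $$ (i, j)) * (matrix_unit n j j \<otimes>\<^sub>m matrix_unit n i i) $$ rc)"

definition u1_mat :: "nat \<Rightarrow> complex mat \<Rightarrow> complex mat" where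
  "u1_mat n u = (u \<otimes>\<^sub>m 1\<^sub>m n) * D_mat n u"

text \<open>\<open>u_odd n u k\<close> is the unitary \<open>u\<^bsub>2k-1\<^esub>\<close> in the tensor power of order \<open>k + 1\<close>.\<close>

definition u_odd :: "nat \<Rightarrow> complex mat \<Rightarrow> nat \<Rightarrow> complex mat" where
  "u_odd n u k =
     foldr (*) (map (\<lambda>i. 1\<^sub>m (n ^ i) \<otimes>\<^sub>m u1_mat n u \<otimes>\<^sub>m 1\<^sub>m (n ^ (k - 1 - i))) [0..<k])
       (1\<^sub>m (n ^ (k + 1)))"

definition spin_model_algebra :: "nat \<Rightarrow> complex mat \<Rightarrow> nat \<Rightarrow> complex mat set" where
  "spin_model_algebra n u k =
     (\<lambda>A. u_odd n u k * (A \<otimes>\<^sub>m 1\<^sub>m n) * mat_adjoint (u_odd n u k)) ` carrier_mat (n ^ k) (n ^ k)"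

definition spin_model_subfactor ::
  "nat \<Rightarrow> (complex mat \<Rightarrow> ('h::complex_hilbert_space \<Rightarrow>\<^sub>L 'h)) \<Rightarrow> complex mat \<Rightarrow> ('h \<Rightarrow>\<^sub>L 'h) set"
  where
  "spin_model_subfactor n \<pi> u =
     Abstract_Topology.closure_of weak_operator_topology (\<pi> ` (\<Union>k\<in>{1..}. spin_model_algebra n u k))"

definition H_mat :: "real \<Rightarrow> complex mat" where
  "H_mat \<alpha> = complex_of_real (1 / sqrt 2) \<cdot>\<^sub>m mat_of_rows_list 2 [[1, 1], [cis \<alpha>, - cis \<alpha>]]"


section \<open>Adjoints, and the spin model subfactors inside the ambient factor\<close>

lemma riesz_representation:
  fixes f :: "'h::{real_inner, complete_space} \<Rightarrow> real"
  assumes f: "bounded_linear f"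
  shows "\<exists>y. \<forall>x. f x = inner y x"
proof -
  interpret f: bounded_linear f by fact
  obtain K where K: "\<And>x. \<bar>f x\<bar> \<le> norm x * K" "K \<ge> 0"
    using f.nonneg_bounded by auto
  define \<phi> where "\<phi> x = (norm x)\<^sup>2 - 2 * f x" for x
  have lower: "- K\<^sup>2 \<le> \<phi> x" for x
  proof -
    have "f x \<le> norm x * K" using K(1)[of x] by simp
    moreover have "0 \<le> (norm x - K)\<^sup>2" by simp
    ultimately show ?thesis by (simp add: \<phi>_def power2_diff)
  qed
  define m where "m = Inf (range \<phi>)"
  have bdd: "bdd_below (range \<phi>)" using lower by (auto intro!: bdd_belowI)
  have m_le: "m \<le> \<phi> x" for x
    unfolding m_def by (rule cInf_lower) (use bdd in auto)
  have "\<exists>x. \<phi> x < m + inverse (real (Suc j))" for j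
  proof -
    have "Inf (range \<phi>) < m + inverse (real (Suc j))" unfolding m_def by simp
    then show ?thesis using cInf_lessD[of "range \<phi>"] by blast
  qed
  then obtain X where X: "\<And>j. \<phi> (X j) < m + inverse (real (Suc j))" by metis
  have par: "(norm (x - y))\<^sup>2 = 2 * \<phi> x + 2 * \<phi> y - 4 * \<phi> ((1/2) *\<^sub>R (x + y))" for x y
    unfolding \<phi>_def
    by (simp add: power2_norm_eq_inner f.add f.scaleR inner_diff inner_add inner_commute
        algebra_simps)
  have dist_le: "(norm (X i - X j))\<^sup>2 \<le> 2 * inverse (real (Suc i)) + 2 * inverse (real (Suc j))" for i j
    using par[of "X i" "X j"] X[of i] X[of j] m_le[of "(1/2) *\<^sub>R (X i + X j)"] by linarith
  have "Cauchy X"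
  proof (rule metric_CauchyI)
    fix e :: real assume e: "e > 0"
    then obtain N where N: "inverse (real (Suc N)) < e\<^sup>2 / 4"
      using reals_Archimedean[of "e\<^sup>2 / 4"] by auto
    have "dist (X i) (X j) < e" if "i \<ge> N" "j \<ge> N" for i j
    proof -
      have "inverse (real (Suc i)) \<le> inverse (real (Suc N))"
        "inverse (real (Suc j)) \<le> inverse (real (Suc N))" using that by auto
      then have "(norm (X i - X j))\<^sup>2 < e\<^sup>2" using dist_le[of i j] N by linarith
      then show ?thesis using e by (simp add: dist_norm power2_less_imp_less)
    qed
    then show "\<exists>M. \<forall>m\<ge>M. \<forall>n\<ge>M. dist (X m) (X n) < e" by blast
  qed
  then obtain y where y: "X \<longlonglongrightarrow> y"
    using Cauchy_convergent_iff convergent_def by blast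
  have "(\<lambda>j. \<phi> (X j)) \<longlonglongrightarrow> \<phi> y"
    unfolding \<phi>_def by (intro tendsto_intros f.tendsto y)
  moreover have "(\<lambda>j. m + inverse (real (Suc j))) \<longlonglongrightarrow> m + 0"
    by (intro tendsto_intros LIMSEQ_inverse_real_of_nat)
  ultimately have "\<phi> y \<le> m + 0"
    by (rule LIMSEQ_le) (use X less_imp_le in blast)
  then have "\<phi> y \<le> m" by simp
  then have min: "\<phi> y \<le> \<phi> x" for x using m_le[of x] by linarith
  have "f x = inner y x" for x
  proof (rule ccontr)
    assume ne: "f x \<noteq> inner y x"
    define a where "a = f x - inner y x"
    define s where "s = (norm x)\<^sup>2 + 1"
    have s: "s > 0" unfolding s_def by (simp add: add_nonneg_pos)
    have "\<phi> (y + t *\<^sub>R x) = \<phi> y - 2 * t * a + t * t * (norm x)\<^sup>2" for t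
      unfolding \<phi>_def a_def
      by (simp add: power2_norm_eq_inner f.add f.scaleR inner_add inner_commute algebra_simps)
    then have "\<phi> (y + (a/s) *\<^sub>R x) = \<phi> y - 2 * (a/s) * a + (a/s)\<^sup>2 * (norm x)\<^sup>2"
      by (simp add: power2_eq_square)
    then have "2 * (a/s) * a \<le> (a/s)\<^sup>2 * (norm x)\<^sup>2" using min[of "y + (a/s) *\<^sub>R x"] by linarith
    also have "\<dots> \<le> (a/s)\<^sup>2 * s" unfolding s_def by (intro mult_left_mono) auto
    also have "\<dots> = (a/s) * a" using s by (simp add: power2_eq_square)
    finally have "a * a / s \<le> 0" by simp
    moreover have "a * a / s > 0" using ne s unfolding a_def by (intro divide_pos_pos) (auto simp: zero_less_mult_iff)
    ultimately show False by simp
  qed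
  then show ?thesis by blast
qed

lemma cadjoint_exists:
  fixes T :: "'h::complex_hilbert_space \<Rightarrow>\<^sub>L 'h"
  assumes T: "T \<in> bounded_operators"
  shows "\<exists>S :: 'h \<Rightarrow>\<^sub>L 'h. \<forall>\<xi> \<eta>. cinner (S \<xi>) \<eta> = cinner \<xi> (T \<eta>)"
proof -
  have "\<exists>y. \<forall>\<eta>. inner \<xi> (T \<eta>) = inner y \<eta>" for \<xi>
    by (rule riesz_representation)
      (intro bounded_linear_inner_right_comp blinfun.bounded_linear_right)
  then obtain S where S: "\<And>\<xi> \<eta>. inner \<xi> (T \<eta>) = inner (S \<xi>) \<eta>" by metis
  have "bounded_linear S"
  proof (rule bounded_linear_intro[where K="norm T"])
    show "S (x + y) = S x + S y" for x y
      by (rule vector_eq_ldot[THEN iffD1]) (metis S inner_add_left inner_commute)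
    show "S (r *\<^sub>R x) = r *\<^sub>R S x" for r x
      by (rule vector_eq_ldot[THEN iffD1]) (metis S inner_scaleR_left inner_commute)
    show "norm (S x) \<le> norm x * norm T" for x
    proof (cases "S x = 0")
      case False
      have "norm (S x) * norm (S x) = inner x (T (S x))"
        by (simp add: S flip: power2_norm_eq_inner power2_eq_square)
      also have "\<dots> \<le> norm x * norm (T (S x))" by (rule norm_cauchy_schwarz)
      also have "\<dots> \<le> norm x * (norm T * norm (S x))"
        by (intro mult_left_mono norm_blinfun) auto
      finally have "norm (S x) * norm (S x) \<le> (norm x * norm T) * norm (S x)" by (simp add: mult.assoc)
      then show ?thesis by (rule mult_right_le_imp_le) (use False in simp)
    qed simp
  qed
  then have app: "blinfun_apply (Blinfun S) = S" by (rule bounded_linear_Blinfun_apply)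
  have Re: "Re (cinner (S \<xi>) \<eta>) = Re (cinner \<xi> (T \<eta>))" for \<xi> \<eta>
    using S[of \<xi> \<eta>] by (simp add: inner_eq_Re_cinner)
  have "cinner (S \<xi>) \<eta> = cinner \<xi> (T \<eta>)" for \<xi> \<eta>
  proof (rule complex_eqI)
    have "T (\<i> *\<^sub>C \<eta>) = \<i> *\<^sub>C T \<eta>" using T by (simp add: bounded_operators_def)
    then show "Im (cinner (S \<xi>) \<eta>) = Im (cinner \<xi> (T \<eta>))"
      using Re[of \<xi> "\<i> *\<^sub>C \<eta>"] by (simp add: cinner_scaleC_right)
  qed (rule Re)
  then show ?thesis using app by metis
qed

lemma cadjoint_unique:
  fixes T S :: "'h::complex_hilbert_space \<Rightarrow>\<^sub>L 'h"
  assumes "\<And>\<xi> \<eta>. cinner (S \<xi>) \<eta> = cinner \<xi> (T \<eta>)"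
  shows "cadjoint T = S"
  unfolding cadjoint_def
proof (rule the_equality)
  fix S' :: "'h \<Rightarrow>\<^sub>L 'h"
  assume S': "\<forall>\<xi> \<eta>. cinner (S' \<xi>) \<eta> = cinner \<xi> (T \<eta>)"
  show "S' = S"
  proof (rule blinfun_eqI)
    fix \<xi>
    have "inner (S' \<xi>) \<eta> = inner (S \<xi>) \<eta>" for \<eta>
      using S' assms by (simp add: inner_eq_Re_cinner)
    then show "S' \<xi> = S \<xi>" using vector_eq_rdot by blast
  qed
qed (use assms in blast)

lemma cinner_cadjoint:
  fixes T :: "'h::complex_hilbert_space \<Rightarrow>\<^sub>L 'h"
  assumes "T \<in> bounded_operators"
  shows "cinner (cadjoint T \<xi>) \<eta> = cinner \<xi> (T \<eta>)"
  using cadjoint_exists[OF assms] cadjoint_unique by metis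

lemma u_odd_carrier:
  assumes u: "u \<in> carrier_mat n n"
  shows "u_odd n u k \<in> carrier_mat (n ^ (k + 1)) (n ^ (k + 1))"
proof -
  have u1: "u1_mat n u \<in> carrier_mat (n * n) (n * n)"
    using u by (auto simp: u1_mat_def kron_def D_mat_def)
  have f: "1\<^sub>m (n ^ i) \<otimes>\<^sub>m u1_mat n u \<otimes>\<^sub>m 1\<^sub>m (n ^ (k - 1 - i)) \<in> carrier_mat (n ^ (k + 1)) (n ^ (k + 1))"
    if "i < k" for i
  proof -
    have "n ^ i * (n * n) * n ^ (k - 1 - i) = n ^ (i + 2 + (k - 1 - i))"
      by (simp add: power_add power2_eq_square)
    also have "i + 2 + (k - 1 - i) = k + 1" using that by simp
    finally show ?thesis using u1 by (auto simp: kron_def)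
  qed
  have "foldr (*) As (1\<^sub>m N) \<in> carrier_mat N N"
    if "set As \<subseteq> carrier_mat N N" for As :: "complex mat list" and N
    using that by (induction As) auto
  then show ?thesis unfolding u_odd_def using f by (auto simp: image_subset_iff)
qed

lemma spin_model_algebra_subset:
  assumes u: "u \<in> carrier_mat n n"
  shows "spin_model_algebra n u k \<subseteq> tensor_powers n"
proof -
  note U = u_odd_carrier[OF u, of k]
  then have "mat_adjoint (u_odd n u k) \<in> carrier_mat (n ^ (k + 1)) (n ^ (k + 1))"
    by (auto simp: mat_adjoint_def)
  moreover have "A \<otimes>\<^sub>m 1\<^sub>m n \<in> carrier_mat (n ^ (k + 1)) (n ^ (k + 1))"
    if "A \<in> carrier_mat (n ^ k) (n ^ k)" for A
    using that by (auto simp: kron_def)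
  ultimately show ?thesis using U
    unfolding spin_model_algebra_def tensor_powers_def by (blast intro: mult_carrier_mat)
qed

lemma spin_model_subfactor_subset:
  assumes "u \<in> carrier_mat n n"
  shows "spin_model_subfactor n \<pi> u \<subseteq> hyperfinite_factor n \<pi>"
  unfolding spin_model_subfactor_def hyperfinite_factor_def
  by (intro closure_of_mono image_mono UN_least spin_model_algebra_subset assms)

lemma H_mat_hadamard: "hadamard_unitary 2 (H_mat \<alpha>)"
proof -
  have sq: "complex_of_real (sqrt 2) * complex_of_real (sqrt 2) = 2"
    by (simp flip: of_real_mult)
  have adj: "mat_adjoint (H_mat \<alpha>) = mat 2 2 (\<lambda>(i, j). cnj (H_mat \<alpha> $$ (j, i)))"
    by (rule eq_matI) (auto simp: mat_adjoint_def H_mat_def mat_of_rows_list_def mat_of_rows_def)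
  have H: "H_mat \<alpha> \<in> carrier_mat 2 2" by (simp add: H_mat_def mat_of_rows_list_def numeral_2_eq_2)
  have ix: "H_mat \<alpha> $$ (i, j) = (if i = 0 then 1 else if j = 0 then cis \<alpha> else - cis \<alpha>) / complex_of_real (sqrt 2)"
    if "i < 2" "j < 2" for i j
    using that by (auto simp: H_mat_def mat_of_rows_list_def less_2_cases_iff)
  have [simp]: "cis \<alpha> * cnj (cis \<alpha>) = 1" "cnj (cis \<alpha>) * cis \<alpha> = 1"
    by (simp_all add: cis_cnj cis_mult)
  show ?thesis
    unfolding hadamard_unitary_def adj
  proof (intro conjI H)
    show "H_mat \<alpha> * mat 2 2 (\<lambda>(i, j). cnj (H_mat \<alpha> $$ (j, i))) = 1\<^sub>m 2"
      using H by (intro eq_matI) (auto simp: scalar_prod_def ix less_2_cases_iff numeral_2_eq_2 sq)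
    show "mat 2 2 (\<lambda>(i, j). cnj (H_mat \<alpha> $$ (j, i))) * H_mat \<alpha> = 1\<^sub>m 2"
      using H by (intro eq_matI) (auto simp: scalar_prod_def ix less_2_cases_iff numeral_2_eq_2 sq)
    show "\<forall>i<2. \<forall>j<2. cmod (H_mat \<alpha> $$ (i, j)) = 1 / sqrt (real 2)"
      by (auto simp: ix norm_divide)
  qed
qed


section \<open>Existence of the GNS representation\<close>

text \<open>
  The Hilbert space is realised as the space of \<open>L\<^sup>2\<close>-bounded sequences \<open>F 0, F 1, ...\<close> of matrices,
  \<open>F k\<close> of size \<open>n ^ k\<close>, with \<open>F k\<close> the image of \<open>F (k + 1)\<close> under the trace-preserving conditional
  expectation \<open>id \<otimes> tr\<close>. Nothing from this section is used in the definitions above.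
\<close>

type_synonym mat_seq = "nat \<Rightarrow> nat \<Rightarrow> nat \<Rightarrow> complex"

definition lev_ip :: "nat \<Rightarrow> nat \<Rightarrow> mat_seq \<Rightarrow> mat_seq \<Rightarrow> complex" where
  "lev_ip n k F G = (\<Sum>i<n ^ k. \<Sum>j<n ^ k. cnj (F k i j) * G k i j) / of_nat (n ^ k)"

definition lev_sq :: "nat \<Rightarrow> nat \<Rightarrow> mat_seq \<Rightarrow> real" where
  "lev_sq n k F = (\<Sum>i<n ^ k. \<Sum>j<n ^ k. (cmod (F k i j))\<^sup>2) / real (n ^ k)"

definition mart :: "nat \<Rightarrow> mat_seq \<Rightarrow> bool" where
  "mart n F \<longleftrightarrow>
     (\<forall>k i j. \<not> (i < n ^ k \<and> j < n ^ k) \<longrightarrow> F k i j = 0) \<and>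
     (\<forall>k i j. i < n ^ k \<longrightarrow> j < n ^ k \<longrightarrow>
        F k i j = (\<Sum>s<n. F (Suc k) (i * n + s) (j * n + s)) / of_nat n) \<and>
     (\<exists>B. \<forall>k. lev_sq n k F \<le> B)"

lemma sum_lessThan_mult:
  fixes f :: "nat \<Rightarrow> 'a::comm_monoid_add"
  shows "(\<Sum>I<m * d. f I) = (\<Sum>i<m. \<Sum>q<d. f (i * d + q))"
proof -
  have "(\<Sum>i<m. \<Sum>q<d. f (i * d + q)) = (\<Sum>i<m. sum f {i * d..<i * d + d})"
    by (rule sum.cong[OF refl], rule sum.reindex_bij_witness[of _ "\<lambda>I. I - i * d" "\<lambda>q. i * d + q" for i])
      auto
  then show ?thesis by (simp add: sum.nat_group)
qed

lemma digit_less: "i < m \<Longrightarrow> q < d \<Longrightarrow> i * d + q < m * (d::nat)"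
  by (metis add.commute add_less_cancel_left mult_Suc less_le_trans mult_le_mono1 Suc_leI)

context
  fixes n :: nat
  assumes n: "n > 0"
begin

lemma martD:
  assumes "mart n F"
  shows "\<not> (i < n ^ k \<and> j < n ^ k) \<Longrightarrow> F k i j = 0"
    and "i < n ^ k \<Longrightarrow> j < n ^ k \<Longrightarrow>
      F k i j = (\<Sum>s<n. F (Suc k) (i * n + s) (j * n + s)) / of_nat n"
    and "\<exists>B. \<forall>k. lev_sq n k F \<le> B"
proof -
  note a = assms[unfolded mart_def]
  show "\<not> (i < n ^ k \<and> j < n ^ k) \<Longrightarrow> F k i j = 0"
    by (rule a[THEN conjunct1, rule_format])
  show "i < n ^ k \<Longrightarrow> j < n ^ k \<Longrightarrow>
      F k i j = (\<Sum>s<n. F (Suc k) (i * n + s) (j * n + s)) / of_nat n"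
    by (rule a[THEN conjunct2, THEN conjunct1, rule_format])
  show "\<exists>B. \<forall>k. lev_sq n k F \<le> B"
    by (rule a[THEN conjunct2, THEN conjunct2])
qed

lemma martI:
  assumes "\<And>k i j. \<not> (i < n ^ k \<and> j < n ^ k) \<Longrightarrow> F k i j = 0"
    and "\<And>k i j. i < n ^ k \<Longrightarrow> j < n ^ k \<Longrightarrow>
      F k i j = (\<Sum>s<n. F (Suc k) (i * n + s) (j * n + s)) / of_nat n"
    and "\<And>k. lev_sq n k F \<le> B"
  shows "mart n F"
  unfolding mart_def by (intro conjI allI impI exI[of _ B] assms)

lemma lev_sq_nonneg: "0 \<le> lev_sq n k F"
  unfolding lev_sq_def by (intro divide_nonneg_nonneg sum_nonneg) auto

lemma lev_ip_self: "lev_ip n k F F = complex_of_real (lev_sq n k F)"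
proof -
  have "(complex_of_real (cmod z))\<^sup>2 = cnj z * z" for z
    by (metis complex_norm_square mult.commute of_real_power)
  then show ?thesis unfolding lev_ip_def lev_sq_def by simp
qed

lemma entry_le: 
  assumes "i < n ^ k" "j < n ^ k" 
  shows "(cmod (F k i j))\<^sup>2 \<le> real (n ^ k) * lev_sq n k F"
proof -
  have "(cmod (F k i j))\<^sup>2 \<le> (\<Sum>j<n ^ k. (cmod (F k i j))\<^sup>2)"
    by (rule member_le_sum) (use assms in auto)
  also have "\<dots> \<le> (\<Sum>i<n ^ k. \<Sum>j<n ^ k. (cmod (F k i j))\<^sup>2)"
    by (rule member_le_sum) (use assms in \<open>auto intro: sum_nonneg\<close>)
  finally show ?thesis unfolding lev_sq_def using n by simp
qed

lemma lev_sq_mono_Suc_aux: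
  assumes step: "\<And>i j. i < n ^ k \<Longrightarrow> j < n ^ k \<Longrightarrow>
    F k i j = (\<Sum>s<n. F (Suc k) (i * n + s) (j * n + s)) / of_nat n"
  shows "lev_sq n k F \<le> lev_sq n (Suc k) F"
proof -
  have "(cmod (F k i j))\<^sup>2 \<le> (\<Sum>s<n. \<Sum>t<n. (cmod (F (Suc k) (i * n + s) (j * n + t)))\<^sup>2) / real n"
    if ij: "i < n ^ k" "j < n ^ k" for i j
  proof -
    let ?G = "\<lambda>s t. F (Suc k) (i * n + s) (j * n + t)"
    have "cmod (F k i j) = cmod (\<Sum>s<n. ?G s s) / real n"
      using step[OF ij] by (simp add: norm_divide)
    also have "\<dots> \<le> (\<Sum>s<n. cmod (?G s s)) / real n"
      by (intro divide_right_mono norm_sum) auto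
    finally have "(cmod (F k i j))\<^sup>2 \<le> ((\<Sum>s<n. cmod (?G s s)) / real n)\<^sup>2"
      by (intro power_mono) auto
    also have "\<dots> = (\<Sum>s<n. cmod (?G s s) * 1)\<^sup>2 / (real n)\<^sup>2" by (simp add: power_divide)
    also have "\<dots> \<le> ((\<Sum>s<n. (cmod (?G s s))\<^sup>2) * (\<Sum>s<n. 1\<^sup>2)) / (real n)\<^sup>2"
      by (intro divide_right_mono Cauchy_Schwarz_ineq_sum) auto
    also have "\<dots> = (\<Sum>s<n. (cmod (?G s s))\<^sup>2) / real n"
      using n by (simp add: power2_eq_square)
    also have "\<dots> \<le> (\<Sum>s<n. \<Sum>t<n. (cmod (?G s t))\<^sup>2) / real n"
      by (intro divide_right_mono sum_mono member_le_sum) auto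
    finally show ?thesis .
  qed
  then have "(\<Sum>i<n ^ k. \<Sum>j<n ^ k. (cmod (F k i j))\<^sup>2) \<le> (\<Sum>i<n ^ k. \<Sum>j<n ^ k.
       (\<Sum>s<n. \<Sum>t<n. (cmod (F (Suc k) (i * n + s) (j * n + t)))\<^sup>2) / real n)"
    by (intro sum_mono) auto
  also have "\<dots> = (\<Sum>i<n ^ k. \<Sum>s<n. \<Sum>j<n ^ k. \<Sum>t<n.
       (cmod (F (Suc k) (i * n + s) (j * n + t)))\<^sup>2) / real n"
    unfolding sum_divide_distrib[symmetric]
    by (rule arg_cong[where f="\<lambda>x. x / real n"], rule sum.cong[OF refl], rule sum.swap)
  also have "\<dots> = (\<Sum>I<n ^ Suc k. \<Sum>J<n ^ Suc k. (cmod (F (Suc k) I J))\<^sup>2) / real n"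
    by (simp add: sum_lessThan_mult mult.commute[of n])
  finally show ?thesis unfolding lev_sq_def using n by (simp add: field_simps)
qed

lemma lev_sq_mono_Suc: "mart n F \<Longrightarrow> lev_sq n k F \<le> lev_sq n (Suc k) F"
  by (rule lev_sq_mono_Suc_aux) (rule martD(2))

lemma lev_sq_mono: "mart n F \<Longrightarrow> k \<le> m \<Longrightarrow> lev_sq n k F \<le> lev_sq n m F"
  by (rule lift_Suc_mono_le[of "\<lambda>k. lev_sq n k F"]) (auto intro: lev_sq_mono_Suc)

lemma lev_sq_convergent: "mart n F \<Longrightarrow> convergent (\<lambda>k. lev_sq n k F)"
proof (rule Bseq_mono_convergent)
  assume F: "mart n F"
  then obtain B where "\<forall>k. lev_sq n k F \<le> B" using martD(3) by blast
  then show "Bseq (\<lambda>k. lev_sq n k F)" by (intro BseqI'[of _ B]) (simp add: lev_sq_nonneg)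
  show "\<forall>m k. m \<le> k \<longrightarrow> lev_sq n m F \<le> lev_sq n k F" using lev_sq_mono[OF F] by blast
qed

lemma lev_sq_add_le: "lev_sq n k (\<lambda>k i j. F k i j + G k i j) \<le> 2 * lev_sq n k F + 2 * lev_sq n k G"
proof -
  have "(cmod (a + b))\<^sup>2 \<le> 2 * (cmod a)\<^sup>2 + 2 * (cmod b)\<^sup>2" for a b
  proof -
    have "(cmod (a + b))\<^sup>2 + (cmod (a - b))\<^sup>2 = 2 * (cmod a)\<^sup>2 + 2 * (cmod b)\<^sup>2"
      unfolding cmod_power2 by (simp add: power2_eq_square algebra_simps)
    then show ?thesis by (metis le_add_same_cancel1 zero_le_power2)
  qed
  then have "(\<Sum>i<n ^ k. \<Sum>j<n ^ k. (cmod (F k i j + G k i j))\<^sup>2)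
     \<le> (\<Sum>i<n ^ k. \<Sum>j<n ^ k. 2 * (cmod (F k i j))\<^sup>2 + 2 * (cmod (G k i j))\<^sup>2)"
    by (intro sum_mono)
  also have "\<dots> = 2 * (\<Sum>i<n ^ k. \<Sum>j<n ^ k. (cmod (F k i j))\<^sup>2)
     + 2 * (\<Sum>i<n ^ k. \<Sum>j<n ^ k. (cmod (G k i j))\<^sup>2)"
    by (simp add: sum.distrib sum_distrib_left)
  finally show ?thesis unfolding lev_sq_def using n by (simp add: field_simps)
qed

lemma lev_sq_scale: "lev_sq n k (\<lambda>k i j. c * F k i j) = (cmod c)\<^sup>2 * lev_sq n k F"
  unfolding lev_sq_def by (simp add: norm_mult power_mult_distrib sum_distrib_left)

lemma mart_add: 
  assumes F: "mart n F" and G: "mart n G"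
  shows "mart n (\<lambda>k i j. F k i j + G k i j)"
proof -
  obtain B C where "\<forall>k. lev_sq n k F \<le> B" "\<forall>k. lev_sq n k G \<le> C" using martD(3)[OF F] martD(3)[OF G] by blast
  then have "lev_sq n k (\<lambda>k i j. F k i j + G k i j) \<le> 2 * B + 2 * C" for k
    using lev_sq_add_le[of k F G] by (smt (verit))
  then show ?thesis
  proof (rule martI[rotated 2])
    fix k i j assume "i < n ^ k" "j < n ^ k"
    then have "F k i j = (\<Sum>s<n. F (Suc k) (i * n + s) (j * n + s)) / of_nat n"
      "G k i j = (\<Sum>s<n. G (Suc k) (i * n + s) (j * n + s)) / of_nat n"
      by (rule martD(2)[OF F], rule martD(2)[OF G])
    then show "F k i j + G k i j =
        (\<Sum>s<n. F (Suc k) (i * n + s) (j * n + s) + G (Suc k) (i * n + s) (j * n + s)) / of_nat n"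
      by (simp only: sum.distrib add_divide_distrib)
  qed (simp add: martD(1)[OF F] martD(1)[OF G])
qed

lemma mart_scale: 
  assumes F: "mart n F" shows "mart n (\<lambda>k i j. c * F k i j)"
proof -
  obtain B where "\<forall>k. lev_sq n k F \<le> B" using martD(3)[OF F] by blast
  then have "lev_sq n k (\<lambda>k i j. c * F k i j) \<le> (cmod c)\<^sup>2 * B" for k
    by (simp add: lev_sq_scale mult_left_mono)
  then show ?thesis
  proof (rule martI[rotated 2])
    fix k i j assume "i < n ^ k" "j < n ^ k"
    then have "F k i j = (\<Sum>s<n. F (Suc k) (i * n + s) (j * n + s)) / of_nat n"
      by (rule martD(2)[OF F])
    then show "c * F k i j = (\<Sum>s<n. c * F (Suc k) (i * n + s) (j * n + s)) / of_nat n"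
      by (simp only: sum_distrib_left[symmetric] times_divide_eq_right)
  qed (simp add: martD(1)[OF F])
qed

lemma mart_diff: 
  assumes F: "mart n F" and G: "mart n G"
  shows "mart n (\<lambda>k i j. F k i j - G k i j)"
  using mart_add[OF F mart_scale[OF G, of "-1"]] by simp

lemma mart_zero: "mart n (\<lambda>k i j. 0)"
  unfolding mart_def lev_sq_def by auto

lemma polarize:
  "lev_ip n k F G = (complex_of_real (lev_sq n k (\<lambda>k i j. F k i j + G k i j))
     - lev_sq n k (\<lambda>k i j. F k i j - G k i j)
     - \<i> * lev_sq n k (\<lambda>k i j. F k i j + \<i> * G k i j)
     + \<i> * lev_sq n k (\<lambda>k i j. F k i j - \<i> * G k i j)) / 4"
proof -
  define q where "q z = complex_of_real ((cmod z)\<^sup>2)" for z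
  have cb: "cnj a * b = (q (a + b) - q (a - b) - \<i> * q (a + \<i> * b) + \<i> * q (a - \<i> * b)) / 4" for a b
    unfolding q_def cmod_power2 by (simp add: complex_eq_iff power2_eq_square algebra_simps)
  have gen: "(a - b - \<i> * c + \<i> * d) / 4 / N = (a / N - b / N - \<i> * (c / N) + \<i> * (d / N)) / 4"
    for a b c d N :: complex
    by (simp add: add_divide_distrib diff_divide_distrib mult.commute)
  have sq: "complex_of_real (lev_sq n k H) = (\<Sum>i<n ^ k. \<Sum>j<n ^ k. q (H k i j)) / of_nat (n ^ k)" for H
    unfolding lev_sq_def q_def by (simp only: of_real_divide of_real_sum of_real_of_nat_eq)
  show ?thesis
    unfolding lev_ip_def sq cb
    by (simp only: sum.distrib sum_subtractf sum_distrib_left[symmetric] sum_divide_distrib[symmetric] gen)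
qed

lemma lev_ip_convergent:
  assumes "mart n F" "mart n G"
  shows "convergent (\<lambda>k. lev_ip n k F G)"
proof -
  have c: "\<exists>a. (\<lambda>k. complex_of_real (lev_sq n k H)) \<longlonglongrightarrow> a" if H: "mart n H" for H
  proof -
    obtain L where "(\<lambda>k. lev_sq n k H) \<longlonglongrightarrow> L"
      using lev_sq_convergent[OF H] unfolding convergent_def by blast
    then show ?thesis by (intro exI[of _ "complex_of_real L"] tendsto_of_real)
  qed
  have *: "\<exists>e. (\<lambda>k. (X k - Y k - \<i> * Z k + \<i> * W k) / 4) \<longlonglongrightarrow> e"
    if lims: "\<exists>a. X \<longlonglongrightarrow> a" "\<exists>a. Y \<longlonglongrightarrow> a" "\<exists>a. Z \<longlonglongrightarrow> a" "\<exists>a. W \<longlonglongrightarrow> a"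
    for X Y Z W :: "nat \<Rightarrow> complex"
  proof -
    obtain a b c d where "X \<longlonglongrightarrow> a" "Y \<longlonglongrightarrow> b" "Z \<longlonglongrightarrow> c" "W \<longlonglongrightarrow> d" using lims by metis
    then have "(\<lambda>k. (X k - Y k - \<i> * Z k + \<i> * W k) / 4) \<longlonglongrightarrow> (a - b - \<i> * c + \<i> * d) / 4"
      by (intro tendsto_intros) auto
    then show ?thesis by blast
  qed
  show ?thesis unfolding polarize convergent_def
    by (rule *; rule c)
      (intro mart_add mart_diff mart_scale assms)+
qed

lemma lev_ip_limit: "mart n F \<Longrightarrow> mart n G \<Longrightarrow> (\<lambda>k. lev_ip n k F G) \<longlonglongrightarrow> lim (\<lambda>k. lev_ip n k F G)"
  using lev_ip_convergent convergent_LIMSEQ_iff by blast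

lemma lev_ip_add: "lev_ip n k F (\<lambda>k i j. G k i j + H k i j) = lev_ip n k F G + lev_ip n k F H"
  unfolding lev_ip_def by (simp add: algebra_simps sum.distrib add_divide_distrib)

lemma lev_ip_scale: "lev_ip n k F (\<lambda>k i j. c * G k i j) = c * lev_ip n k F G"
  unfolding lev_ip_def by (simp add: sum_distrib_left mult_ac)

lemma lev_ip_cnj: "lev_ip n k F G = cnj (lev_ip n k G F)"
  unfolding lev_ip_def by (simp add: mult.commute)

lemma mart_complete:
  fixes f :: "nat \<Rightarrow> mat_seq"
  assumes f: "\<And>j. mart n (f j)"
    and C: "\<And>e. e > 0 \<Longrightarrow> \<exists>N. \<forall>i\<ge>N. \<forall>j\<ge>N. \<forall>k. lev_sq n k (\<lambda>k a b. f i k a b - f j k a b) \<le> e"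
  shows "\<exists>L. mart n L \<and> (\<forall>e>0. \<exists>N. \<forall>j\<ge>N. \<forall>k. lev_sq n k (\<lambda>k a b. f j k a b - L k a b) \<le> e)"
proof -
  have "convergent (\<lambda>j. f j k a b)" for k a b
  proof (cases "a < n ^ k \<and> b < n ^ k")
    case True
    have "Cauchy (\<lambda>j. f j k a b)"
    proof (rule metric_CauchyI)
      fix e :: real assume e: "e > 0"
      define e' where "e' = e\<^sup>2 / 2 / real (n ^ k)"
      have "e' > 0" using e n by (simp add: e'_def)
      from C[OF this] obtain N where
        N: "\<forall>i\<ge>N. \<forall>j\<ge>N. \<forall>k. lev_sq n k (\<lambda>k a b. f i k a b - f j k a b) \<le> e'" by blast
      have "dist (f i k a b) (f j k a b) < e" if "i \<ge> N" "j \<ge> N" for i j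
      proof -
        have "(cmod (f i k a b - f j k a b))\<^sup>2 \<le> real (n ^ k) * lev_sq n k (\<lambda>k a b. f i k a b - f j k a b)"
          using entry_le[of a k b "\<lambda>k a b. f i k a b - f j k a b"] True by blast
        also have "\<dots> \<le> real (n ^ k) * e'" using N that by (intro mult_left_mono) auto
        also have "\<dots> < e\<^sup>2" using e n by (simp add: e'_def)
        finally show ?thesis using e by (simp add: dist_norm power2_less_imp_less)
      qed
      then show "\<exists>M. \<forall>i\<ge>M. \<forall>j\<ge>M. dist (f i k a b) (f j k a b) < e" by blast
    qed
    then show ?thesis by (simp add: Cauchy_convergent_iff)
  next
    case False
    then have "f j k a b = 0" for j by (rule martD(1)[OF f[of j]])
    then show ?thesis by (simp add: convergent_const)
  qed
  then obtain L where L: "\<And>k a b. (\<lambda>j. f j k a b) \<longlonglongrightarrow> L k a b"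
    unfolding convergent_def by metis
  have le: "lev_sq n k (\<lambda>k a b. f j k a b - L k a b) \<le> e"
    if "\<And>i. i \<ge> N \<Longrightarrow> lev_sq n k (\<lambda>k a b. f j k a b - f i k a b) \<le> e" for j k e N
  proof (rule LIMSEQ_le_const2)
    show "(\<lambda>i. lev_sq n k (\<lambda>k a b. f j k a b - f i k a b)) \<longlonglongrightarrow> lev_sq n k (\<lambda>k a b. f j k a b - L k a b)"
      unfolding lev_sq_def by (intro tendsto_intros L) (use n in auto)
  qed (use that in blast)
  have conv: "\<exists>N. \<forall>j\<ge>N. \<forall>k. lev_sq n k (\<lambda>k a b. f j k a b - L k a b) \<le> e" if "e > 0" for e
    using C[OF that] le by meson
  have "mart n L" unfolding mart_def
  proof (intro conjI allI impI)
    fix k a b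
    show "L k a b = 0" if "\<not> (a < n ^ k \<and> b < n ^ k)"
    proof -
      have "f j k a b = 0" for j by (rule martD(1)[OF f[of j] that])
      then show ?thesis using LIMSEQ_unique[OF L[of k a b]] by simp
    qed
    show "L k a b = (\<Sum>s<n. L (Suc k) (a * n + s) (b * n + s)) / of_nat n" if "a < n ^ k" "b < n ^ k"
    proof (rule LIMSEQ_unique[OF L[of k a b]])
      have "(\<lambda>j. (\<Sum>s<n. f j (Suc k) (a * n + s) (b * n + s)) / of_nat n)
        \<longlonglongrightarrow> (\<Sum>s<n. L (Suc k) (a * n + s) (b * n + s)) / of_nat n"
        by (intro tendsto_intros L) (use n in auto)
      moreover have "f j k a b = (\<Sum>s<n. f j (Suc k) (a * n + s) (b * n + s)) / of_nat n" for j
        by (rule martD(2)[OF f[of j] that])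
      ultimately show "(\<lambda>j. f j k a b) \<longlonglongrightarrow> (\<Sum>s<n. L (Suc k) (a * n + s) (b * n + s)) / of_nat n"
        by simp
    qed
  next
    obtain N where N: "\<And>k. lev_sq n k (\<lambda>k a b. f N k a b - L k a b) \<le> 1"
      using conv[of 1] by auto
    obtain B where B: "\<And>k. lev_sq n k (f N) \<le> B" using martD(3)[OF f[of N]] by blast
    have "lev_sq n k L \<le> 2 * B + 2 * 1" for k
      using lev_sq_add_le[of k "f N" "\<lambda>k a b. (-1) * (f N k a b - L k a b)"]
        lev_sq_scale[of k "-1" "\<lambda>k a b. f N k a b - L k a b"] N[of k] B[of k] by simp
    then show "\<exists>B. \<forall>k. lev_sq n k L \<le> B" by blast
  qed
  then show ?thesis using conv by blast
qed

end

typedef (overloaded) 'n::finite trace_L2 = "{F. mart CARD('n) F}"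
  using mart_zero[of "CARD('n)"] by auto

setup_lifting type_definition_trace_L2

instantiation trace_L2 :: (finite) real_vector
begin
lift_definition zero_trace_L2 :: "'a trace_L2" is "\<lambda>k i j. 0"
  by (rule mart_zero) simp
lift_definition plus_trace_L2 :: "'a trace_L2 \<Rightarrow> 'a trace_L2 \<Rightarrow> 'a trace_L2"
  is "\<lambda>F G k i j. F k i j + G k i j" by (rule mart_add) simp
lift_definition minus_trace_L2 :: "'a trace_L2 \<Rightarrow> 'a trace_L2 \<Rightarrow> 'a trace_L2"
  is "\<lambda>F G k i j. F k i j - G k i j" by (rule mart_diff) simp
lift_definition uminus_trace_L2 :: "'a trace_L2 \<Rightarrow> 'a trace_L2"
  is "\<lambda>F k i j. - 1 * F k i j" by (rule mart_scale) simp
lift_definition scaleR_trace_L2 :: "real \<Rightarrow> 'a trace_L2 \<Rightarrow> 'a trace_L2"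
  is "\<lambda>r F k i j. complex_of_real r * F k i j" by (rule mart_scale) simp
instance
  by standard (transfer, force simp: fun_eq_iff algebra_simps)+
end

lift_definition scl :: "complex \<Rightarrow> 'n::finite trace_L2 \<Rightarrow> 'n trace_L2"
  is "\<lambda>c F k i j. c * F k i j" by (rule mart_scale) simp

definition cip :: "'n::finite trace_L2 \<Rightarrow> 'n trace_L2 \<Rightarrow> complex" where
  "cip F G = lim (\<lambda>k. lev_ip CARD('n) k (Rep_trace_L2 F) (Rep_trace_L2 G))"

lemma mart_Rep: "mart CARD('n) (Rep_trace_L2 (F :: 'n::finite trace_L2))"
  using Rep_trace_L2[of F] by simp

lemma cip_limit:
  fixes F G :: "'n::finite trace_L2"
  shows "(\<lambda>k. lev_ip CARD('n) k (Rep_trace_L2 F) (Rep_trace_L2 G)) \<longlonglongrightarrow> cip F G"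
  unfolding cip_def by (rule lev_ip_limit) (simp_all add: mart_Rep)

lemma cip_eqI:
  fixes F G :: "'n::finite trace_L2"
  assumes "(\<lambda>k. lev_ip CARD('n) k (Rep_trace_L2 F) (Rep_trace_L2 G)) \<longlonglongrightarrow> c"
  shows "cip F G = c"
  using LIMSEQ_unique[OF cip_limit assms] .

lemma cip_add: "cip F (G + H) = cip F G + cip F H"
  by (rule cip_eqI) (simp add: plus_trace_L2.rep_eq lev_ip_add tendsto_add cip_limit)

lemma cip_scl: "cip F (scl c G) = c * cip F G"
  by (rule cip_eqI) (simp add: scl.rep_eq lev_ip_scale tendsto_mult_left cip_limit)

lemma cip_cnj: "cip F G = cnj (cip G F)"
proof (rule cip_eqI)
  have "(\<lambda>k. cnj (lev_ip CARD('a) k (Rep_trace_L2 G) (Rep_trace_L2 F))) \<longlonglongrightarrow> cnj (cip G F)"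
    by (intro tendsto_cnj cip_limit)
  then show "(\<lambda>k. lev_ip CARD('a) k (Rep_trace_L2 F) (Rep_trace_L2 G)) \<longlonglongrightarrow> cnj (cip G F)"
    by (simp flip: lev_ip_cnj)
qed

lemma scaleR_scl: "r *\<^sub>R F = scl (complex_of_real r) F"
  by transfer simp

lemma lev_sq_limit:
  fixes F :: "'n::finite trace_L2"
  shows "(\<lambda>k. lev_sq CARD('n) k (Rep_trace_L2 F)) \<longlonglongrightarrow> Re (cip F F)"
  using tendsto_Re[OF cip_limit[of F F]] by (simp add: lev_ip_self)

lemma lev_sq_le_cip: 
  fixes F :: "'n::finite trace_L2"
  shows "lev_sq CARD('n) k (Rep_trace_L2 F) \<le> Re (cip F F)"
  by (rule LIMSEQ_le_const[OF lev_sq_limit])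
    (auto intro!: exI[of _ k] lev_sq_mono simp: mart_Rep)

lemma cip_pos: "0 \<le> Re (cip F F)"
  using lev_sq_le_cip[of 0 F] lev_sq_nonneg[of "CARD('a)" 0 "Rep_trace_L2 F"] by simp

lemma cip_zero_iff: "Re (cip F F) = 0 \<longleftrightarrow> F = 0"
proof
  assume 0: "Re (cip F F) = 0"
  have "Rep_trace_L2 F k i j = 0" for k i j
  proof (cases "i < CARD('a) ^ k \<and> j < CARD('a) ^ k")
    case True
    have "lev_sq CARD('a) k (Rep_trace_L2 F) = 0"
      using lev_sq_le_cip[of k F] lev_sq_nonneg[of "CARD('a)" k "Rep_trace_L2 F"] 0 by simp
    then have "(cmod (Rep_trace_L2 F k i j))\<^sup>2 \<le> 0"
      using entry_le[of "CARD('a)" i k j "Rep_trace_L2 F"] True by simp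
    then show ?thesis by simp
  qed (use martD(1)[OF _ mart_Rep] in auto)
  then show "F = 0" by (simp add: Rep_trace_L2_inject[symmetric] zero_trace_L2.rep_eq fun_eq_iff)
next
  assume "F = 0"
  then have "cip F F = 0" using cip_scl[of F 0 F] 
    by (metis mult_zero_left of_real_0 scaleR_scl scaleR_zero_right)
  then show "Re (cip F F) = 0" by simp
qed

instantiation trace_L2 :: (finite) real_inner
begin
definition inner_trace_L2 :: "'a trace_L2 \<Rightarrow> 'a trace_L2 \<Rightarrow> real" where
  "inner_trace_L2 F G = Re (cip F G)"
definition norm_trace_L2 :: "'a trace_L2 \<Rightarrow> real" where
  "norm_trace_L2 F = sqrt (inner F F)"
definition dist_trace_L2 :: "'a trace_L2 \<Rightarrow> 'a trace_L2 \<Rightarrow> real" where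
  "dist_trace_L2 F G = norm (F - G)"
definition sgn_trace_L2 :: "'a trace_L2 \<Rightarrow> 'a trace_L2" where
  "sgn_trace_L2 F = F /\<^sub>R norm F"
definition uniformity_trace_L2 :: "('a trace_L2 \<times> 'a trace_L2) filter" where
  "uniformity_trace_L2 = (INF e\<in>{0<..}. principal {(x, y). dist x y < e})"
definition open_trace_L2 :: "'a trace_L2 set \<Rightarrow> bool" where
  "open_trace_L2 S \<longleftrightarrow> (\<forall>x\<in>S. \<forall>\<^sub>F (x', y) in uniformity. x' = x \<longrightarrow> y \<in> S)"
instance
proof
  fix x y z :: "'a trace_L2" and r :: real
  show "inner x y = inner y x"
    unfolding inner_trace_L2_def by (subst cip_cnj) simp
  have add: "inner z (x + y) = inner z x + inner z y" for x y z :: "'a trace_L2"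
    unfolding inner_trace_L2_def by (simp add: cip_add)
  have comm: "inner x y = inner y x" for x y :: "'a trace_L2"
    unfolding inner_trace_L2_def by (subst cip_cnj) simp
  show "inner (x + y) z = inner x z + inner y z" using add comm by metis
  have scale: "inner y (r *\<^sub>R x) = r * inner y x" for x y :: "'a trace_L2"
    unfolding inner_trace_L2_def by (simp add: scaleR_scl cip_scl)
  show "inner (r *\<^sub>R x) y = r * inner x y" using scale comm by metis
  show "0 \<le> inner x x" unfolding inner_trace_L2_def by (rule cip_pos)
  show "inner x x = 0 \<longleftrightarrow> x = 0" unfolding inner_trace_L2_def by (rule cip_zero_iff)
qed (simp_all only: norm_trace_L2_def dist_trace_L2_def sgn_trace_L2_def uniformity_trace_L2_def
    open_trace_L2_def)
end

lemma norm_sq_cip: "(norm F)\<^sup>2 = Re (cip F F)" for F :: "'n::finite trace_L2"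
  unfolding power2_norm_eq_inner inner_trace_L2_def ..

lemma norm_le_lev:
  fixes F :: "'n::finite trace_L2"
  assumes "\<And>k. lev_sq CARD('n) k (Rep_trace_L2 F) \<le> e\<^sup>2" "e \<ge> 0"
  shows "norm F \<le> e"
proof -
  have "(norm F)\<^sup>2 \<le> e\<^sup>2"
    unfolding norm_sq_cip by (rule LIMSEQ_le_const2[OF lev_sq_limit]) (use assms in blast)
  then show ?thesis using assms(2) by (rule power2_le_imp_le)
qed

instance trace_L2 :: (finite) complete_space
proof
  fix X :: "nat \<Rightarrow> 'a trace_L2"
  assume X: "Cauchy X"
  have "\<exists>L. mart CARD('a) L \<and>
    (\<forall>e>0. \<exists>N. \<forall>j\<ge>N. \<forall>k. lev_sq CARD('a) k (\<lambda>k a b. Rep_trace_L2 (X j) k a b - L k a b) \<le> e)"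
  proof (rule mart_complete)
    fix e :: real assume e: "e > 0"
    then obtain N where N: "\<And>i j. i \<ge> N \<Longrightarrow> j \<ge> N \<Longrightarrow> norm (X i - X j) < sqrt e"
      using CauchyD[OF X, of "sqrt e"] by auto
    have "lev_sq CARD('a) k (\<lambda>k a b. Rep_trace_L2 (X i) k a b - Rep_trace_L2 (X j) k a b) \<le> e"
      if "i \<ge> N" "j \<ge> N" for i j k
    proof -
      have "lev_sq CARD('a) k (Rep_trace_L2 (X i - X j)) \<le> (norm (X i - X j))\<^sup>2"
        unfolding norm_sq_cip by (rule lev_sq_le_cip)
      also have "\<dots> \<le> (sqrt e)\<^sup>2" using N[OF that] by (intro power_mono) auto
      finally show ?thesis using e by (simp add: minus_trace_L2.rep_eq)
    qed
    then show "\<exists>N. \<forall>i\<ge>N. \<forall>j\<ge>N. \<forall>k.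
        lev_sq CARD('a) k (\<lambda>k a b. Rep_trace_L2 (X i) k a b - Rep_trace_L2 (X j) k a b) \<le> e" by blast
  qed (simp_all add: mart_Rep)
  then obtain L where L: "mart CARD('a) L"
    and conv: "\<And>e. e > 0 \<Longrightarrow> \<exists>N. \<forall>j\<ge>N. \<forall>k.
      lev_sq CARD('a) k (\<lambda>k a b. Rep_trace_L2 (X j) k a b - L k a b) \<le> e" by blast
  have rep: "Rep_trace_L2 (Abs_trace_L2 L :: 'a trace_L2) = L"
    by (rule Abs_trace_L2_inverse) (simp add: L)
  have "X \<longlonglongrightarrow> Abs_trace_L2 L"
  proof (rule metric_LIMSEQ_I)
    fix e :: real assume e: "e > 0"
    then have "(e/2)\<^sup>2 > 0" by simp
    from conv[OF this] obtain N where N: "\<And>j k. j \<ge> N \<Longrightarrow>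
      lev_sq CARD('a) k (\<lambda>k a b. Rep_trace_L2 (X j) k a b - L k a b) \<le> (e/2)\<^sup>2" by blast
    have "dist (X j) (Abs_trace_L2 L) < e" if "j \<ge> N" for j
    proof -
      have "norm (X j - Abs_trace_L2 L) \<le> e/2"
        by (rule norm_le_lev) (use N[OF that] e in \<open>simp_all add: minus_trace_L2.rep_eq rep\<close>)
      then show ?thesis using e by (simp add: dist_norm)
    qed
    then show "\<exists>no. \<forall>n\<ge>no. dist (X n) (Abs_trace_L2 L) < e" by blast
  qed
  then show "convergent X" by (rule convergentI)
qed

instantiation trace_L2 :: (finite) complex_hilbert_space
begin
definition scaleC_trace_L2 :: "complex \<Rightarrow> 'a trace_L2 \<Rightarrow> 'a trace_L2" where "scaleC_trace_L2 = scl"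
definition cinner_trace_L2 :: "'a trace_L2 \<Rightarrow> 'a trace_L2 \<Rightarrow> complex" where "cinner_trace_L2 = cip"
instance
proof
  fix x y z :: "'a trace_L2" and c d :: complex and r :: real
  show "c *\<^sub>C (x + y) = c *\<^sub>C x + c *\<^sub>C y" "(c + d) *\<^sub>C x = c *\<^sub>C x + d *\<^sub>C x"
    "c *\<^sub>C d *\<^sub>C x = (c * d) *\<^sub>C x"
    unfolding scaleC_trace_L2_def by (transfer; simp add: fun_eq_iff algebra_simps)+
  show "r *\<^sub>R x = complex_of_real r *\<^sub>C x"
    unfolding scaleC_trace_L2_def by (rule scaleR_scl)
  show "cinner x (y + z) = cinner x y + cinner x z"
    unfolding cinner_trace_L2_def by (rule cip_add)
  show "cinner x (c *\<^sub>C y) = c * cinner x y"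
    unfolding cinner_trace_L2_def scaleC_trace_L2_def by (rule cip_scl)
  show "cinner x y = cnj (cinner y x)"
    unfolding cinner_trace_L2_def by (rule cip_cnj)
  show "inner x y = Re (cinner x y)"
    unfolding cinner_trace_L2_def inner_trace_L2_def ..
qed
end

definition act0 :: "nat \<Rightarrow> nat \<Rightarrow> complex mat \<Rightarrow> mat_seq \<Rightarrow> mat_seq" where
  "act0 n k a F m i j =
     (\<Sum>p<n ^ k. a $$ (i div n ^ (m - k), p) * F m (p * n ^ (m - k) + i mod n ^ (m - k)) j)"

definition act :: "nat \<Rightarrow> nat \<Rightarrow> complex mat \<Rightarrow> mat_seq \<Rightarrow> mat_seq" where
  "act n k a F m i j = (if i < n ^ m \<and> j < n ^ m
     then (\<Sum>s<n ^ (k - m). act0 n k a F (m + (k - m)) (i * n ^ (k - m) + s) (j * n ^ (k - m) + s))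
       / of_nat (n ^ (k - m))
     else 0)"

context
  fixes n :: nat
  assumes n: "n > 0"
begin

lemma act_eq_act0: "k \<le> m \<Longrightarrow> i < n ^ m \<Longrightarrow> j < n ^ m \<Longrightarrow> act n k a F m i j = act0 n k a F m i j"
  unfolding act_def by simp

lemma pow_split: "k \<le> m \<Longrightarrow> n ^ m = n ^ k * n ^ (m - k)" for m k
  by (simp flip: power_add)

lemma act0_step:
  assumes F: "mart n F" and km: "k \<le> m" and I: "i < n ^ m" and J: "j < n ^ m"
  shows "act0 n k a F m i j = (\<Sum>s<n. act0 n k a F (Suc m) (i * n + s) (j * n + s)) / of_nat n"
proof -
  define d where "d = n ^ (m - k)"
  have d: "d > 0" using n by (simp add: d_def)
  have d': "n ^ (Suc m - k) = d * n" using km by (simp add: d_def Suc_diff_le)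
  have ix: "(i * n + s) div (d * n) = i div d" "(i * n + s) mod (d * n) = (i mod d) * n + s"
    if "s < n" for s
  proof -
    have "(i * n + s) div (n * d) = i div d" unfolding div_mult2_eq using that by simp
    then show "(i * n + s) div (d * n) = i div d" by (simp add: mult.commute)
    have "(i * n + s) mod (n * d) = n * (i mod d) + s" unfolding mod_mult2_eq using that by simp
    then show "(i * n + s) mod (d * n) = (i mod d) * n + s" by (simp add: mult.commute)
  qed
  have "act0 n k a F (Suc m) (i * n + s) (j * n + s) =
    (\<Sum>p<n ^ k. a $$ (i div d, p) * F (Suc m) ((p * d + i mod d) * n + s) (j * n + s))"
    if "s < n" for s
    unfolding act0_def d' by (simp only: ix[OF that] distrib_right mult.assoc add.assoc)
  then have "(\<Sum>s<n. act0 n k a F (Suc m) (i * n + s) (j * n + s)) / of_nat n =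
    (\<Sum>s<n. \<Sum>p<n ^ k. a $$ (i div d, p) * F (Suc m) ((p * d + i mod d) * n + s) (j * n + s)) / of_nat n"
    by simp
  also have "\<dots> = (\<Sum>p<n ^ k. a $$ (i div d, p) *
      ((\<Sum>s<n. F (Suc m) ((p * d + i mod d) * n + s) (j * n + s)) / of_nat n))"
    by (subst sum.swap) (simp only: sum_distrib_left[symmetric] sum_divide_distrib[symmetric] times_divide_eq_right)
  also have "\<dots> = (\<Sum>p<n ^ k. a $$ (i div d, p) * F m (p * d + i mod d) j)"
  proof (rule sum.cong[OF refl])
    fix p assume "p \<in> {..<n ^ k}"
    then have "p * d + i mod d < n ^ k * d" using d by (intro digit_less) auto
    also have "n ^ k * d = n ^ m" using pow_split[OF km] by (simp add: d_def)
    finally show "a $$ (i div d, p) *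
      ((\<Sum>s<n. F (Suc m) ((p * d + i mod d) * n + s) (j * n + s)) / of_nat n)
      = a $$ (i div d, p) * F m (p * d + i mod d) j"
      using martD(2)[OF n F _ J] by simp
  qed
  finally show ?thesis unfolding act0_def d_def by simp
qed

lemma act_step:
  assumes F: "mart n F" and I: "i < n ^ m" and J: "j < n ^ m"
  shows "act n k a F m i j = (\<Sum>s<n. act n k a F (Suc m) (i * n + s) (j * n + s)) / of_nat n"
proof (cases "k \<le> m")
  case True
  have "i * n + s < n ^ Suc m" "j * n + s < n ^ Suc m" if "s < n" for s
    using digit_less[OF I that] digit_less[OF J that] by (simp_all add: mult.commute)
  then show ?thesis using act0_step[OF F True I J] True I J by (simp add: act_eq_act0)
next
  case False
  define r where "r = k - Suc m"
  have r: "k - m = Suc r" "m + (k - m) = k" "Suc m + r = k" using False by (simp_all add: r_def)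
  have less: "i * n + s < n ^ Suc m" "j * n + s < n ^ Suc m" if "s < n" for s
    using digit_less[OF I that] digit_less[OF J that] by (simp_all add: mult.commute)
  have "act n k a F m i j = (\<Sum>s<n * n ^ r. act0 n k a F k (i * n ^ Suc r + s) (j * n ^ Suc r + s))
      / of_nat (n ^ Suc r)"
    unfolding act_def r(2) unfolding r(1) using I J by simp
  also have "(\<Sum>s<n * n ^ r. act0 n k a F k (i * n ^ Suc r + s) (j * n ^ Suc r + s)) =
     (\<Sum>s<n. \<Sum>t<n ^ r. act0 n k a F k ((i * n + s) * n ^ r + t) ((j * n + s) * n ^ r + t))"
    unfolding sum_lessThan_mult by (simp add: algebra_simps)
  also have "\<dots> / of_nat (n ^ Suc r) = (\<Sum>s<n. act n k a F (Suc m) (i * n + s) (j * n + s)) / of_nat n"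
  proof -
    have "(\<Sum>s<n. act n k a F (Suc m) (i * n + s) (j * n + s)) =
      (\<Sum>s<n. (\<Sum>t<n ^ r. act0 n k a F k ((i * n + s) * n ^ r + t) ((j * n + s) * n ^ r + t)) / of_nat (n ^ r))"
    proof (rule sum.cong[OF refl])
      fix s assume "s \<in> {..<n}"
      then show "act n k a F (Suc m) (i * n + s) (j * n + s) =
          (\<Sum>t<n ^ r. act0 n k a F k ((i * n + s) * n ^ r + t) ((j * n + s) * n ^ r + t)) / of_nat (n ^ r)"
        unfolding act_def r_def[symmetric] r(3) using less by (simp only: lessThan_iff simp_thms if_True)
    qed
    then show ?thesis by (simp add: sum_divide_distrib[symmetric] mult.commute)
  qed
  finally show ?thesis .
qed

definition act_bound :: "nat \<Rightarrow> complex mat \<Rightarrow> real" where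
  "act_bound k a = (\<Sum>i<n ^ k. \<Sum>p<n ^ k. (cmod (a $$ (i, p)))\<^sup>2)"

lemma act_bound_nonneg: "0 \<le> act_bound k a"
  unfolding act_bound_def by (intro sum_nonneg) auto

lemma lev_sq_act:
  assumes km: "k \<le> m"
  shows "lev_sq n m (act n k a F) \<le> act_bound k a * lev_sq n m F"
proof -
  define d where "d = n ^ (m - k)"
  have d: "d > 0" using n by (simp add: d_def)
  have nm: "n ^ m = n ^ k * d" unfolding d_def by (rule pow_split[OF km])
  have e: "(cmod (act n k a F m (i * d + q) J))\<^sup>2 \<le>
      (\<Sum>p<n ^ k. (cmod (a $$ (i, p)))\<^sup>2) * (\<Sum>p<n ^ k. (cmod (F m (p * d + q) J))\<^sup>2)"
    if "i < n ^ k" "q < d" "J < n ^ m" for i q J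
  proof -
    have "i * d + q < n ^ m" unfolding nm using that by (intro digit_less)
    then have "act n k a F m (i * d + q) J = (\<Sum>p<n ^ k. a $$ (i, p) * F m (p * d + q) J)"
      using that km d by (simp add: act_eq_act0 act0_def flip: d_def)
    then have "cmod (act n k a F m (i * d + q) J) \<le> (\<Sum>p<n ^ k. cmod (a $$ (i, p)) * cmod (F m (p * d + q) J))"
      using norm_sum[of "\<lambda>p. a $$ (i, p) * F m (p * d + q) J" "{..<n ^ k}"] by (simp add: norm_mult)
    then have "(cmod (act n k a F m (i * d + q) J))\<^sup>2 \<le> (\<Sum>p<n ^ k. cmod (a $$ (i, p)) * cmod (F m (p * d + q) J))\<^sup>2"
      by (intro power_mono) auto
    also have "\<dots> \<le> (\<Sum>p<n ^ k. (cmod (a $$ (i, p)))\<^sup>2) * (\<Sum>p<n ^ k. (cmod (F m (p * d + q) J))\<^sup>2)"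
      by (rule Cauchy_Schwarz_ineq_sum)
    finally show ?thesis .
  qed
  have "(\<Sum>I<n ^ m. \<Sum>J<n ^ m. (cmod (act n k a F m I J))\<^sup>2) =
     (\<Sum>i<n ^ k. \<Sum>q<d. \<Sum>J<n ^ m. (cmod (act n k a F m (i * d + q) J))\<^sup>2)"
    by (simp only: nm sum_lessThan_mult)
  also have "\<dots> \<le> (\<Sum>i<n ^ k. \<Sum>q<d. \<Sum>J<n ^ m.
      (\<Sum>p<n ^ k. (cmod (a $$ (i, p)))\<^sup>2) * (\<Sum>p<n ^ k. (cmod (F m (p * d + q) J))\<^sup>2))"
    by (intro sum_mono e) auto
  also have "\<dots> = act_bound k a * (\<Sum>q<d. \<Sum>J<n ^ m. \<Sum>p<n ^ k. (cmod (F m (p * d + q) J))\<^sup>2)"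
  proof -
    have "(\<Sum>i<n ^ k. \<Sum>q<d. \<Sum>J<n ^ m. A i * B q J) = (\<Sum>i<n ^ k. A i) * (\<Sum>q<d. \<Sum>J<n ^ m. B q J)"
      for A :: "nat \<Rightarrow> real" and B
      by (simp only: sum_distrib_left[symmetric] sum_distrib_right[symmetric])
    then show ?thesis unfolding act_bound_def .
  qed
  also have "(\<Sum>q<d. \<Sum>J<n ^ m. \<Sum>p<n ^ k. (cmod (F m (p * d + q) J))\<^sup>2) =
     (\<Sum>q<d. \<Sum>p<n ^ k. \<Sum>J<n ^ m. (cmod (F m (p * d + q) J))\<^sup>2)"
    by (rule sum.cong[OF refl], rule sum.swap)
  also have "\<dots> = (\<Sum>p<n ^ k. \<Sum>q<d. \<Sum>J<n ^ m. (cmod (F m (p * d + q) J))\<^sup>2)"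
    by (rule sum.swap)
  also have "\<dots> = (\<Sum>I<n ^ m. \<Sum>J<n ^ m. (cmod (F m I J))\<^sup>2)"
    by (simp only: nm sum_lessThan_mult)
  finally show ?thesis unfolding lev_sq_def
    by (simp add: divide_right_mono)
qed

lemma mart_act:
  assumes F: "mart n F"
  shows "mart n (act n k a F)"
proof -
  have step: "lev_sq n m (act n k a F) \<le> lev_sq n (Suc m) (act n k a F)" for m
    by (rule lev_sq_mono_Suc_aux[OF n]) (rule act_step[OF F])
  obtain B where B: "\<And>m. lev_sq n m F \<le> B" using martD(3)[OF n F] by blast
  have "lev_sq n m (act n k a F) \<le> act_bound k a * B" for m
  proof -
    have "lev_sq n m (act n k a F) \<le> lev_sq n (m + k) (act n k a F)"
      by (rule lift_Suc_mono_le[of "\<lambda>m. lev_sq n m (act n k a F)"]) (use step in auto)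
    also have "\<dots> \<le> act_bound k a * lev_sq n (m + k) F" by (rule lev_sq_act) simp
    also have "\<dots> \<le> act_bound k a * B" by (intro mult_left_mono B act_bound_nonneg)
    finally show ?thesis .
  qed
  then show ?thesis
  proof (rule martI[OF n, rotated 2])
    show "act n k a F m i j = 0" if "\<not> (i < n ^ m \<and> j < n ^ m)" for m i j
      using that unfolding act_def by (rule if_not_P)
  qed (rule act_step[OF F])
qed

lemma mart_iterate:
  assumes F: "mart n F" and I: "i < n ^ k" and J: "j < n ^ k"
  shows "(\<Sum>q<n ^ r. F (k + r) (i * n ^ r + q) (j * n ^ r + q)) = of_nat (n ^ r) * F k i j"
proof (induction r)
  case (Suc r)
  have kr: "i * n ^ r + q < n ^ (k + r)" if "i < n ^ k" "q < n ^ r" for i q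
    using digit_less[OF that] by (simp add: power_add)
  have "(\<Sum>q<n ^ Suc r. F (k + Suc r) (i * n ^ Suc r + q) (j * n ^ Suc r + q))
    = (\<Sum>q<n ^ r. \<Sum>s<n. F (Suc (k + r)) ((i * n ^ r + q) * n + s) ((j * n ^ r + q) * n + s))"
    unfolding power_Suc2 sum_lessThan_mult by (simp add: algebra_simps)
  also have "\<dots> = (\<Sum>q<n ^ r. of_nat n * F (k + r) (i * n ^ r + q) (j * n ^ r + q))"
  proof (rule sum.cong[OF refl])
    fix q assume "q \<in> {..<n ^ r}"
    then have "F (k + r) (i * n ^ r + q) (j * n ^ r + q) = 
      (\<Sum>s<n. F (Suc (k + r)) ((i * n ^ r + q) * n + s) ((j * n ^ r + q) * n + s)) / of_nat n"
      by (intro martD(2)[OF n F] kr I J) auto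
    then show "(\<Sum>s<n. F (Suc (k + r)) ((i * n ^ r + q) * n + s) ((j * n ^ r + q) * n + s))
      = of_nat n * F (k + r) (i * n ^ r + q) (j * n ^ r + q)" using n by (simp add: field_simps)
  qed
  also have "\<dots> = of_nat (n ^ Suc r) * F k i j"
    unfolding sum_distrib_left[symmetric] Suc.IH by simp
  finally show ?case .
qed simp

lemma mart_eqI:
  assumes F: "mart n F" and G: "mart n G"
    and eq: "\<And>m i j. k \<le> m \<Longrightarrow> i < n ^ m \<Longrightarrow> j < n ^ m \<Longrightarrow> F m i j = G m i j"
  shows "F = G"
proof (intro ext)
  fix m i j
  show "F m i j = G m i j"
  proof (cases "i < n ^ m \<and> j < n ^ m")
    case True
    have kr: "i * n ^ k + q < n ^ (m + k)" if "i < n ^ m" "q < n ^ k" for i q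
      using digit_less[OF that] by (simp add: power_add)
    have "of_nat (n ^ k) * F m i j = of_nat (n ^ k) * G m i j"
      using True unfolding mart_iterate[OF F, of i m j k, symmetric, OF True[THEN conjunct1] True[THEN conjunct2]]
        mart_iterate[OF G, of i m j k, symmetric, OF True[THEN conjunct1] True[THEN conjunct2]]
      by (intro sum.cong[OF refl] eq kr) auto
    then show ?thesis using n by simp
  qed (use martD(1)[OF n F] martD(1)[OF n G] in auto)
qed

end

lift_definition acts :: "nat \<Rightarrow> complex mat \<Rightarrow> 'n::finite trace_L2 \<Rightarrow> 'n trace_L2"
  is "act CARD('n)" by (rule mart_act) simp_all

lift_definition omega :: "'n::finite trace_L2"
  is "\<lambda>k i j. if i = j \<and> i < CARD('n) ^ k then 1 else 0"
proof (rule martI[where B = 1])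
  fix k i j :: nat
  assume ij: "i < CARD('n) ^ k" "j < CARD('n) ^ k"
  have "i * CARD('n) + s < CARD('n) ^ Suc k" if "s < CARD('n)" for s
    using digit_less[OF ij(1) that] by (simp add: mult.commute)
  then have "(\<Sum>s<CARD('n). if i * CARD('n) + s = j * CARD('n) + s \<and> i * CARD('n) + s < CARD('n) ^ Suc k
      then 1 else 0 :: complex) = (\<Sum>s<CARD('n). if i = j then 1 else 0)"
    by (intro sum.cong[OF refl]) auto
  then show "(if i = j \<and> i < CARD('n) ^ k then 1 else 0 :: complex) =
    (\<Sum>s<CARD('n). if i * CARD('n) + s = j * CARD('n) + s \<and> i * CARD('n) + s < CARD('n) ^ Suc k
      then 1 else 0) / of_nat CARD('n)" using ij by simp
next
  fix k :: nat
  have "(\<Sum>j<CARD('n) ^ k. (cmod (if i = j \<and> i < CARD('n) ^ k then 1 else 0))\<^sup>2) = 1"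
    if "i < CARD('n) ^ k" for i
  proof -
    have "(\<Sum>j<CARD('n) ^ k. (cmod (if i = j \<and> i < CARD('n) ^ k then 1 else 0))\<^sup>2)
      = (\<Sum>j<CARD('n) ^ k. if i = j then 1 else 0)"
      by (intro sum.cong[OF refl]) (use that in auto)
    then show ?thesis using that by simp
  qed
  then show "lev_sq CARD('n) k (\<lambda>k i j. if i = j \<and> i < CARD('n) ^ k then 1 else 0) \<le> 1"
    unfolding lev_sq_def by simp
qed auto

lemma trace_L2_eqI:
  fixes F G :: "'n::finite trace_L2"
  assumes "\<And>m i j. k \<le> m \<Longrightarrow> i < CARD('n) ^ m \<Longrightarrow> j < CARD('n) ^ m \<Longrightarrow>
    Rep_trace_L2 F m i j = Rep_trace_L2 G m i j"
  shows "F = G"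
proof -
  have "Rep_trace_L2 F = Rep_trace_L2 G"
    by (rule mart_eqI[OF _ mart_Rep mart_Rep, where k = k]) (use assms in auto)
  then show ?thesis by (simp add: Rep_trace_L2_inject)
qed

lemma Rep_acts:
  fixes F :: "'n::finite trace_L2"
  assumes "k \<le> m" "i < CARD('n) ^ m" "j < CARD('n) ^ m"
  shows "Rep_trace_L2 (acts k a F) m i j = (\<Sum>p<CARD('n) ^ k. a $$ (i div CARD('n) ^ (m - k), p) *
    Rep_trace_L2 F m (p * CARD('n) ^ (m - k) + i mod CARD('n) ^ (m - k)) j)"
  unfolding acts.rep_eq using assms by (simp add: act_eq_act0 act0_def)

lemma index_facts:
  fixes n :: nat
  assumes "n > 0" "k \<le> m" "i < n ^ m"
  shows "i div n ^ (m - k) < n ^ k"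
    and "p < n ^ k \<Longrightarrow> p * n ^ (m - k) + i mod n ^ (m - k) < n ^ m"
    and "(p * n ^ (m - k) + i mod n ^ (m - k)) div n ^ (m - k) = p"
    and "(p * n ^ (m - k) + i mod n ^ (m - k)) mod n ^ (m - k) = i mod n ^ (m - k)"
proof -
  have nm: "n ^ m = n ^ k * n ^ (m - k)" using assms by (simp flip: power_add)
  show "i div n ^ (m - k) < n ^ k"
    using assms nm by (simp add: less_mult_imp_div_less)
  show "p * n ^ (m - k) + i mod n ^ (m - k) < n ^ m" if "p < n ^ k"
    unfolding nm by (rule digit_less[OF that]) (use assms in simp)
  show "(p * n ^ (m - k) + i mod n ^ (m - k)) div n ^ (m - k) = p"
    "(p * n ^ (m - k) + i mod n ^ (m - k)) mod n ^ (m - k) = i mod n ^ (m - k)"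
    using assms by simp_all
qed

lemmas idx = index_facts[OF zero_less_card_finite]

lemma acts_add: "acts k a (F + G) = acts k a F + acts k a G"
  by (rule trace_L2_eqI[where k = k])
    (simp add: Rep_acts plus_trace_L2.rep_eq algebra_simps sum.distrib)

lemma acts_scl: "acts k a (scl c F) = scl c (acts k a F)"
  by (rule trace_L2_eqI[where k = k])
    (simp add: Rep_acts scl.rep_eq algebra_simps sum_distrib_left)

lemma norm_acts_le:
  fixes F :: "'n::finite trace_L2"
  shows "norm (acts k a F) \<le> norm F * sqrt (act_bound CARD('n) k a)"
proof -
  let ?C = "act_bound CARD('n) k a"
  have C: "?C \<ge> 0" by (rule act_bound_nonneg) simp
  have "(norm (acts k a F))\<^sup>2 \<le> ?C * (norm F)\<^sup>2"
    unfolding norm_sq_cip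
  proof (rule LIMSEQ_le[OF lev_sq_limit])
    show "(\<lambda>m. ?C * lev_sq CARD('n) m (Rep_trace_L2 F)) \<longlonglongrightarrow> ?C * Re (cip F F)"
      by (intro tendsto_mult_left lev_sq_limit)
    show "\<exists>N. \<forall>m\<ge>N. lev_sq CARD('n) m (Rep_trace_L2 (acts k a F))
        \<le> ?C * lev_sq CARD('n) m (Rep_trace_L2 F)"
      unfolding acts.rep_eq by (intro exI[of _ k] allI impI lev_sq_act) simp_all
  qed
  also have "\<dots> = (norm F * sqrt ?C)\<^sup>2" using C by (simp add: power_mult_distrib)
  finally show ?thesis by (rule power2_le_imp_le) (use C in simp)
qed

lemma bounded_linear_acts: "bounded_linear (acts k a)"
  by (rule bounded_linear_intro[OF acts_add _ norm_acts_le]) (simp add: scaleR_scl acts_scl)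

definition trace_rep :: "complex mat \<Rightarrow> 'n::finite trace_L2 \<Rightarrow>\<^sub>L 'n trace_L2" where
  "trace_rep a = Blinfun (acts (THE k. dim_row a = CARD('n) ^ k) a)"

lemma trace_rep_apply:
  fixes F :: "'n::finite trace_L2"
  assumes n2: "CARD('n) \<ge> 2" and a: "a \<in> carrier_mat (CARD('n) ^ k) (CARD('n) ^ k)"
  shows "trace_rep a F = acts k a F"
proof -
  have "(THE j. dim_row a = CARD('n) ^ j) = k"
    using a n2 by (intro the_equality) auto
  then show ?thesis
    unfolding trace_rep_def by (simp add: bounded_linear_Blinfun_apply[OF bounded_linear_acts])
qed

lemma cip_eventuallyI:
  fixes F G :: "'n::finite trace_L2" and H K :: "'n trace_L2"
  assumes "\<And>m. k \<le> m \<Longrightarrow> lev_ip CARD('n) m (Rep_trace_L2 F) (Rep_trace_L2 G)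
     = lev_ip CARD('n) m (Rep_trace_L2 H) (Rep_trace_L2 K)"
  shows "cip F G = cip H K"
proof (rule cip_eqI)
  have "\<forall>\<^sub>F m in sequentially. lev_ip CARD('n) m (Rep_trace_L2 H) (Rep_trace_L2 K) =
      lev_ip CARD('n) m (Rep_trace_L2 F) (Rep_trace_L2 G)"
    using assms by (auto simp: eventually_sequentially intro!: exI[of _ k])
  then show "(\<lambda>m. lev_ip CARD('n) m (Rep_trace_L2 F) (Rep_trace_L2 G)) \<longlonglongrightarrow> cip H K"
    by (rule Lim_transform_eventually[OF cip_limit])
qed

lemma mat_adjoint_index:
  "a \<in> carrier_mat r r \<Longrightarrow> i < r \<Longrightarrow> j < r \<Longrightarrow> mat_adjoint a $$ (i, j) = cnj (a $$ (j, i))"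
  for a :: "complex mat"
  unfolding mat_adjoint_def by (auto simp: mat_of_rows_def)

lemma cip_acts_adjoint:
  fixes F G :: "'n::finite trace_L2"
  assumes a: "a \<in> carrier_mat (CARD('n) ^ k) (CARD('n) ^ k)"
  shows "cip (acts k (mat_adjoint a) F) G = cip F (acts k a G)"
proof (rule cip_eventuallyI[where k = k])
  fix m assume km: "k \<le> m"
  define n where "n = CARD('n)"
  define d where "d = n ^ (m - k)"
  define f where "f = Rep_trace_L2 F m"
  define g where "g = Rep_trace_L2 G m"
  have d: "d > 0" and nm: "n ^ m = n ^ k * d"
    using km by (simp_all add: d_def n_def flip: power_add)
  have act: "Rep_trace_L2 (acts k b H) m (i * d + q) J = (\<Sum>p<n ^ k. b $$ (i, p) * Rep_trace_L2 H m (p * d + q) J)"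
    if "i < n ^ k" "q < d" "J < n ^ m" for i q J b and H :: "'n trace_L2"
  proof -
    have "i * d + q < n ^ m" unfolding nm using that by (intro digit_less)
    then show ?thesis using Rep_acts[OF km, of "i * d + q" J b H] that d
      by (simp flip: n_def d_def)
  qed
  have "(\<Sum>I<n ^ m. \<Sum>J<n ^ m. cnj (Rep_trace_L2 (acts k (mat_adjoint a) F) m I J) * g I J) =
     (\<Sum>i<n ^ k. \<Sum>q<d. \<Sum>J<n ^ m. cnj (Rep_trace_L2 (acts k (mat_adjoint a) F) m (i * d + q) J) * g (i * d + q) J)"
    by (simp only: nm sum_lessThan_mult)
  also have "\<dots> = (\<Sum>i<n ^ k. \<Sum>q<d. \<Sum>J<n ^ m. \<Sum>p<n ^ k. a $$ (p, i) * cnj (f (p * d + q) J) * g (i * d + q) J)"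
    using a by (intro sum.cong[OF refl])
      (simp add: act mat_adjoint_index sum_distrib_right n_def f_def cong: sum.cong_simp)
  also have "\<dots> = (\<Sum>i<n ^ k. \<Sum>p<n ^ k. \<Sum>q<d. \<Sum>J<n ^ m. a $$ (p, i) * cnj (f (p * d + q) J) * g (i * d + q) J)"
    (is "_ = (\<Sum>i<n ^ k. \<Sum>p<n ^ k. \<Sum>q<d. \<Sum>J<n ^ m. ?h i p q J)")
  proof (rule sum.cong[OF refl])
    fix i
    have "(\<Sum>q<d. \<Sum>J<n ^ m. \<Sum>p<n ^ k. ?h i p q J) = (\<Sum>q<d. \<Sum>p<n ^ k. \<Sum>J<n ^ m. ?h i p q J)"
      by (rule sum.cong[OF refl], rule sum.swap)
    also have "\<dots> = (\<Sum>p<n ^ k. \<Sum>q<d. \<Sum>J<n ^ m. ?h i p q J)" by (rule sum.swap)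
    finally show "(\<Sum>q<d. \<Sum>J<n ^ m. \<Sum>p<n ^ k. ?h i p q J) = (\<Sum>p<n ^ k. \<Sum>q<d. \<Sum>J<n ^ m. ?h i p q J)" .
  qed
  also have "\<dots> = (\<Sum>p<n ^ k. \<Sum>i<n ^ k. \<Sum>q<d. \<Sum>J<n ^ m. ?h i p q J)" by (rule sum.swap)
  also have "\<dots> = (\<Sum>p<n ^ k. \<Sum>q<d. \<Sum>J<n ^ m. \<Sum>i<n ^ k. ?h i p q J)"
  proof (rule sum.cong[OF refl])
    fix p
    have "(\<Sum>i<n ^ k. \<Sum>q<d. \<Sum>J<n ^ m. ?h i p q J) = (\<Sum>q<d. \<Sum>i<n ^ k. \<Sum>J<n ^ m. ?h i p q J)"
      by (rule sum.swap)
    also have "\<dots> = (\<Sum>q<d. \<Sum>J<n ^ m. \<Sum>i<n ^ k. ?h i p q J)"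
      by (rule sum.cong[OF refl], rule sum.swap)
    finally show "(\<Sum>i<n ^ k. \<Sum>q<d. \<Sum>J<n ^ m. ?h i p q J) = (\<Sum>q<d. \<Sum>J<n ^ m. \<Sum>i<n ^ k. ?h i p q J)" .
  qed
  also have "\<dots> = (\<Sum>p<n ^ k. \<Sum>q<d. \<Sum>J<n ^ m. cnj (f (p * d + q) J) * Rep_trace_L2 (acts k a G) m (p * d + q) J)"
    by (intro sum.cong[OF refl]) (simp add: act sum_distrib_left g_def mult_ac cong: sum.cong_simp)
  also have "\<dots> = (\<Sum>I<n ^ m. \<Sum>J<n ^ m. cnj (f I J) * Rep_trace_L2 (acts k a G) m I J)"
    by (simp only: nm sum_lessThan_mult)
  finally show "lev_ip CARD('n) m (Rep_trace_L2 (acts k (mat_adjoint a) F)) (Rep_trace_L2 G)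
    = lev_ip CARD('n) m (Rep_trace_L2 F) (Rep_trace_L2 (acts k a G))"
    unfolding lev_ip_def f_def g_def n_def by simp
qed

lemma Rep_acts_omega:
  assumes km: "k \<le> m" and I: "i < CARD('n) ^ m" and J: "j < CARD('n) ^ m"
  shows "Rep_trace_L2 (acts k a (omega :: 'n::finite trace_L2)) m i j =
    (if i mod CARD('n) ^ (m - k) = j mod CARD('n) ^ (m - k)
     then a $$ (i div CARD('n) ^ (m - k), j div CARD('n) ^ (m - k)) else 0)"
proof -
  define d where "d = CARD('n) ^ (m - k)"
  have d: "d > 0" by (simp add: d_def)
  have eq: "p * d + i mod d = j \<longleftrightarrow> p = j div d \<and> i mod d = j mod d" for p
    using d by (metis div_mult_mod_eq div_mult_self3 mod_div_trivial mod_mod_trivial mod_mult_self3 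
        add.right_neutral less_numeral_extra(3))
  have "Rep_trace_L2 (acts k a (omega :: 'n trace_L2)) m i j =
    (\<Sum>p<CARD('n) ^ k. if p = j div d then (if i mod d = j mod d then a $$ (i div d, p) else 0) else 0)"
    unfolding Rep_acts[OF assms] d_def[symmetric] omega.rep_eq
    by (rule sum.cong[OF refl]) (use J eq in auto)
  also have "\<dots> = (if i mod d = j mod d then a $$ (i div d, j div d) else 0)"
    using idx(1)[OF km J] by (simp add: d_def)
  finally show ?thesis by (simp add: d_def)
qed

lemma lev_ip_acts_omega:
  fixes X :: "'n::finite trace_L2"
  shows "lev_ip CARD('n) (k + r) (Rep_trace_L2 X) (Rep_trace_L2 (acts k (mat (CARD('n) ^ k) (CARD('n) ^ k)
     (\<lambda>(i, j). F k i j)) (omega :: 'n trace_L2))) = lev_ip CARD('n) k (Rep_trace_L2 X) F"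
proof -
  define n where "n = CARD('n)"
  have n: "n > 0" by (simp add: n_def)
  define d where "d = n ^ r"
  have d: "d > 0" using n by (simp add: d_def)
  have nm: "n ^ (k + r) = n ^ k * d" by (simp add: d_def power_add)
  define A where "A = mat (n ^ k) (n ^ k) (\<lambda>(i, j). F k i j)"
  define x where "x = Rep_trace_L2 X (k + r)"
  have E: "Rep_trace_L2 (acts k A (omega :: 'n trace_L2)) (k + r) (i * d + q) (j * d + t) =
      (if q = t then F k i j else 0)" if "i < n ^ k" "j < n ^ k" "q < d" "t < d" for i j q t
  proof -
    have "i * d + q < n ^ (k + r)" "j * d + t < n ^ (k + r)"
      unfolding nm using that by (auto intro!: digit_less)
    then show ?thesis
      using Rep_acts_omega[where 'n = 'n, of k "k + r" "i * d + q" "j * d + t" A] that d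
      by (simp add: A_def flip: n_def d_def)
  qed
  have "(\<Sum>I<n ^ (k + r). \<Sum>J<n ^ (k + r). cnj (x I J) * Rep_trace_L2 (acts k A (omega :: 'n trace_L2)) (k + r) I J)
    = (\<Sum>i<n ^ k. \<Sum>q<d. \<Sum>j<n ^ k. \<Sum>t<d. cnj (x (i * d + q) (j * d + t)) *
        Rep_trace_L2 (acts k A (omega :: 'n trace_L2)) (k + r) (i * d + q) (j * d + t))"
    by (simp only: nm sum_lessThan_mult)
  also have "\<dots> = (\<Sum>i<n ^ k. \<Sum>q<d. \<Sum>j<n ^ k. \<Sum>t<d. if q = t then cnj (x (i * d + q) (j * d + t)) * F k i j else 0)"
    by (intro sum.cong[OF refl]) (simp add: E)
  also have "\<dots> = (\<Sum>i<n ^ k. \<Sum>q<d. \<Sum>j<n ^ k. cnj (x (i * d + q) (j * d + q)) * F k i j)"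
    by (intro sum.cong[OF refl]) simp
  also have "\<dots> = (\<Sum>i<n ^ k. \<Sum>j<n ^ k. \<Sum>q<d. cnj (x (i * d + q) (j * d + q)) * F k i j)"
    by (rule sum.cong[OF refl], rule sum.swap)
  also have "\<dots> = (\<Sum>i<n ^ k. \<Sum>j<n ^ k. of_nat d * (cnj (Rep_trace_L2 X k i j) * F k i j))"
  proof (intro sum.cong[OF refl])
    fix i j assume "i \<in> {..<n ^ k}" "j \<in> {..<n ^ k}"
    then have "(\<Sum>q<d. x (i * d + q) (j * d + q)) = of_nat d * Rep_trace_L2 X k i j"
      unfolding x_def d_def n_def by (intro mart_iterate mart_Rep) auto
    then have "(\<Sum>q<d. cnj (x (i * d + q) (j * d + q))) = of_nat d * cnj (Rep_trace_L2 X k i j)"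
      by (simp flip: cnj_sum)
    then show "(\<Sum>q<d. cnj (x (i * d + q) (j * d + q)) * F k i j) =
        of_nat d * (cnj (Rep_trace_L2 X k i j) * F k i j)"
      by (simp flip: sum_distrib_right)
  qed
  also have "\<dots> = of_nat d * (\<Sum>i<n ^ k. \<Sum>j<n ^ k. cnj (Rep_trace_L2 X k i j) * F k i j)"
    by (simp only: sum_distrib_left)
  finally show ?thesis
    unfolding lev_ip_def x_def A_def n_def[symmetric] nm of_nat_mult using d n by simp
qed

lemma trace_L2_dense:
  fixes X :: "'n::finite trace_L2"
  defines "P \<equiv> \<lambda>k. acts k (mat (CARD('n) ^ k) (CARD('n) ^ k) (\<lambda>(i, j). Rep_trace_L2 X k i j))
    (omega :: 'n trace_L2)"
  shows "P \<longlonglongrightarrow> X"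
proof -
  have ip: "cip Y (P k) = lev_ip CARD('n) k (Rep_trace_L2 Y) (Rep_trace_L2 X)" for Y k
  proof (rule cip_eqI)
    have "(\<lambda>r. lev_ip CARD('n) (r + k) (Rep_trace_L2 Y) (Rep_trace_L2 (P k)))
        \<longlonglongrightarrow> lev_ip CARD('n) k (Rep_trace_L2 Y) (Rep_trace_L2 X)"
      unfolding P_def add.commute[of _ k] lev_ip_acts_omega by (rule tendsto_const)
    then show "(\<lambda>m. lev_ip CARD('n) m (Rep_trace_L2 Y) (Rep_trace_L2 (P k)))
        \<longlonglongrightarrow> lev_ip CARD('n) k (Rep_trace_L2 Y) (Rep_trace_L2 X)"
      by (rule LIMSEQ_offset)
  qed
  have Pk: "lev_ip CARD('n) k (Rep_trace_L2 (P k)) (Rep_trace_L2 X) = lev_ip CARD('n) k (Rep_trace_L2 X) (Rep_trace_L2 X)" for k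
    unfolding lev_ip_def by (simp add: P_def Rep_acts_omega)
  have "(norm (X - P k))\<^sup>2 = Re (cip X X) - lev_sq CARD('n) k (Rep_trace_L2 X)" for k
  proof -
    have "(norm (X - P k))\<^sup>2 = (norm X)\<^sup>2 + (norm (P k))\<^sup>2 - 2 * inner X (P k)"
      by (simp add: power2_norm_eq_inner inner_diff inner_commute del: dot_square_norm)
    then show ?thesis
      unfolding norm_sq_cip inner_trace_L2_def ip Pk by (simp add: lev_ip_self)
  qed
  moreover have "(\<lambda>k. Re (cip X X) - lev_sq CARD('n) k (Rep_trace_L2 X)) \<longlonglongrightarrow> Re (cip X X) - Re (cip X X)"
    by (intro tendsto_diff tendsto_const lev_sq_limit)
  ultimately have "(\<lambda>k. (norm (X - P k))\<^sup>2) \<longlonglongrightarrow> 0" by simp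
  then have "(\<lambda>k. sqrt ((norm (X - P k))\<^sup>2)) \<longlonglongrightarrow> sqrt 0" by (rule tendsto_real_sqrt)
  then have "(\<lambda>k. norm (P k - X)) \<longlonglongrightarrow> 0" by (simp add: norm_minus_commute)
  then show ?thesis using LIM_zero_cancel tendsto_norm_zero_iff by blast
qed

lemma gns_representation_trace_rep:
  assumes n2: "CARD('n::finite) \<ge> 2"
  shows "gns_representation CARD('n) trace_rep (omega :: 'n trace_L2)"
proof
  define n where "n = CARD('n)"
  note app = trace_rep_apply[OF n2]
  have kron_carrier: "A \<otimes>\<^sub>m 1\<^sub>m (CARD('n)) \<in> carrier_mat (CARD('n) ^ Suc k) (CARD('n) ^ Suc k)"
    if "A \<in> carrier_mat (CARD('n) ^ k) (CARD('n) ^ k)" for A k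
    using that by (auto simp: kron_def)
  have adj_carrier: "mat_adjoint A \<in> carrier_mat r r" if "A \<in> carrier_mat r r" for A :: "complex mat" and r
    using that by (auto simp: mat_adjoint_def)
  show "2 \<le> CARD('n)" by (rule n2)
  {
    fix A assume "A \<in> tensor_powers CARD('n)"
    then obtain k where A: "A \<in> carrier_mat (CARD('n) ^ k) (CARD('n) ^ k)"
      by (auto simp: tensor_powers_def)
    show b: "(trace_rep A :: 'n trace_L2 \<Rightarrow>\<^sub>L 'n trace_L2) \<in> bounded_operators"
      unfolding bounded_operators_def by (simp add: app[OF A] scaleC_trace_L2_def acts_scl)
    show "trace_rep (A \<otimes>\<^sub>m 1\<^sub>m CARD('n)) = (trace_rep A :: 'n trace_L2 \<Rightarrow>\<^sub>L 'n trace_L2)"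
    proof (rule blinfun_eqI)
      fix F :: "'n trace_L2"
      have "acts (Suc k) (A \<otimes>\<^sub>m 1\<^sub>m CARD('n)) F = acts k A F"
      proof (rule trace_L2_eqI[where k = "Suc k"])
        fix m i j assume m: "Suc k \<le> m" and i: "i < CARD('n) ^ m" and j: "j < CARD('n) ^ m"
        define d where "d = n ^ (m - Suc k)"
        have n: "n > 0" by (simp add: n_def)
        have dn: "n ^ (m - k) = d * n" using m unfolding d_def by (metis Suc_diff_le diff_Suc_Suc power_Suc2)
        have ik: "i div d < n ^ Suc k"
          using idx(1)[OF m i] by (simp add: d_def n_def)
        have dd: "i div d div n = i div (d * n)" by (simp add: div_mult2_eq)
        have mm: "i mod (d * n) = (i div d mod n) * d + i mod d" by (simp add: mod_mult2_eq mult.commute)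
        have kr: "(A \<otimes>\<^sub>m 1\<^sub>m n) $$ (i div d, p * n + t) = (if i div d mod n = t then A $$ (i div (d * n), p) else 0)"
          if "p < n ^ k" "t < n" for p t
        proof -
          have "p * n + t < n ^ k * n" using that by (rule digit_less)
          then show ?thesis using A ik that n unfolding kron_def
            by (auto simp: dd n_def[symmetric] mult.commute)
        qed
        have "Rep_trace_L2 (acts (Suc k) (A \<otimes>\<^sub>m 1\<^sub>m CARD('n)) F) m i j =
          (\<Sum>P<n ^ k * n. (A \<otimes>\<^sub>m 1\<^sub>m n) $$ (i div d, P) * Rep_trace_L2 F m (P * d + i mod d) j)"
          unfolding Rep_acts[OF m i j] d_def n_def by (simp add: mult.commute)
        also have "\<dots> = (\<Sum>p<n ^ k. \<Sum>t<n. (A \<otimes>\<^sub>m 1\<^sub>m n) $$ (i div d, p * n + t) *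
             Rep_trace_L2 F m ((p * n + t) * d + i mod d) j)"
          by (rule sum_lessThan_mult)
        also have "\<dots> = (\<Sum>p<n ^ k. \<Sum>t<n. if i div d mod n = t then A $$ (i div (d * n), p) *
             Rep_trace_L2 F m ((p * n + t) * d + i mod d) j else 0)"
          by (intro sum.cong[OF refl]) (simp add: kr)
        also have "\<dots> = (\<Sum>p<n ^ k. A $$ (i div (d * n), p) *
             Rep_trace_L2 F m ((p * n + i div d mod n) * d + i mod d) j)"
          using n by simp
        also have "\<dots> = (\<Sum>p<n ^ k. A $$ (i div (d * n), p) * Rep_trace_L2 F m (p * (d * n) + i mod (d * n)) j)"
          unfolding mm by (simp add: algebra_simps)
        also have "\<dots> = Rep_trace_L2 (acts k A F) m i j"
          unfolding Rep_acts[OF Suc_leD[OF m] i j] n_def[symmetric] dn ..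
        finally show "Rep_trace_L2 (acts (Suc k) (A \<otimes>\<^sub>m 1\<^sub>m CARD('n)) F) m i j = Rep_trace_L2 (acts k A F) m i j" .
      qed
      then show "trace_rep (A \<otimes>\<^sub>m 1\<^sub>m CARD('n)) F = trace_rep A F"
        by (simp add: app[OF A] app[OF kron_carrier[OF A]])
    qed
    show "trace_rep (c \<cdot>\<^sub>m A) \<xi> = c *\<^sub>C trace_rep A \<xi>" for c and \<xi> :: "'n trace_L2"
    proof -
      have cA: "c \<cdot>\<^sub>m A \<in> carrier_mat (CARD('n) ^ k) (CARD('n) ^ k)" using A by simp
      have "acts k (c \<cdot>\<^sub>m A) \<xi> = scl c (acts k A \<xi>)"
        by (rule trace_L2_eqI[where k = k])
          (use A in \<open>simp add: Rep_acts scl.rep_eq idx(1) sum_distrib_left mult.assoc\<close>)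
      then show ?thesis by (simp add: app[OF A] app[OF cA] scaleC_trace_L2_def)
    qed
    show "trace_rep (mat_adjoint A) = cadjoint (trace_rep A :: 'n trace_L2 \<Rightarrow>\<^sub>L 'n trace_L2)"
      by (rule cadjoint_unique[symmetric])
        (simp add: app[OF A] app[OF adj_carrier[OF A]] cinner_trace_L2_def cip_acts_adjoint[OF A])
    show "cinner omega (trace_rep A (omega :: 'n trace_L2)) = normalized_trace A"
      unfolding cinner_trace_L2_def app[OF A]
    proof (rule cip_eqI)
      have "lev_ip CARD('n) (r + k) (Rep_trace_L2 (omega :: 'n trace_L2))
          (Rep_trace_L2 (acts k A (omega :: 'n trace_L2))) = normalized_trace A" for r
      proof -
        have mA: "A = mat (CARD('n) ^ k) (CARD('n) ^ k) (\<lambda>(i, j). A $$ (i, j))"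
          using A by (intro eq_matI) auto
        have "lev_ip CARD('n) (k + r) (Rep_trace_L2 (omega :: 'n trace_L2))
          (Rep_trace_L2 (acts k A (omega :: 'n trace_L2))) =
          lev_ip CARD('n) k (Rep_trace_L2 (omega :: 'n trace_L2)) (\<lambda>k i j. A $$ (i, j))"
          using lev_ip_acts_omega[of k r "omega :: 'n trace_L2" "\<lambda>k i j. A $$ (i, j)"]
          unfolding mA[symmetric] .
        also have "\<dots> = (\<Sum>i<CARD('n) ^ k. \<Sum>j<CARD('n) ^ k. if i = j then A $$ (i, j) else 0) / of_nat (CARD('n) ^ k)"
          unfolding lev_ip_def
          by (intro arg_cong2[where f = "(/)"] sum.cong refl) (simp add: omega.rep_eq)
        also have "\<dots> = normalized_trace A" unfolding normalized_trace_def using A by simp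
        finally show ?thesis by (simp add: add.commute)
      qed
      then have "(\<lambda>r. lev_ip CARD('n) (r + k) (Rep_trace_L2 (omega :: 'n trace_L2))
          (Rep_trace_L2 (acts k A (omega :: 'n trace_L2)))) \<longlonglongrightarrow> normalized_trace A" by simp
      then show "(\<lambda>m. lev_ip CARD('n) m (Rep_trace_L2 (omega :: 'n trace_L2))
          (Rep_trace_L2 (acts k A (omega :: 'n trace_L2)))) \<longlonglongrightarrow> normalized_trace A"
        by (rule LIMSEQ_offset)
    qed
  }
  {
    fix A B :: "complex mat" and k assume A: "A \<in> carrier_mat (CARD('n) ^ k) (CARD('n) ^ k)"
      and B: "B \<in> carrier_mat (CARD('n) ^ k) (CARD('n) ^ k)"
    have AB: "A + B \<in> carrier_mat (CARD('n) ^ k) (CARD('n) ^ k)"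
      "A * B \<in> carrier_mat (CARD('n) ^ k) (CARD('n) ^ k)" using A B by auto
    show "trace_rep (A + B) = trace_rep A + (trace_rep B :: 'n trace_L2 \<Rightarrow>\<^sub>L 'n trace_L2)"
    proof (rule blinfun_eqI)
      fix F :: "'n trace_L2"
      have "acts k (A + B) F = acts k A F + acts k B F"
        by (rule trace_L2_eqI[where k = k])
          (use A B in \<open>simp add: Rep_acts plus_trace_L2.rep_eq idx(1) sum.distrib distrib_right\<close>)
      then show "trace_rep (A + B) F = (trace_rep A + trace_rep B) F"
        by (simp add: app[OF A] app[OF B] app[OF AB(1)] blinfun.add_left)
    qed
    show "trace_rep (A * B) = trace_rep A o\<^sub>L (trace_rep B :: 'n trace_L2 \<Rightarrow>\<^sub>L 'n trace_L2)"
    proof (rule blinfun_eqI)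
      fix F :: "'n trace_L2"
      have "acts k (A * B) F = acts k A (acts k B F)"
      proof (rule trace_L2_eqI[where k = k])
        fix m i j assume m: "k \<le> m" and i: "i < CARD('n) ^ m" and j: "j < CARD('n) ^ m"
        define d where "d = n ^ (m - k)"
        note ix = idx[OF m i, folded n_def, folded d_def]
        have "Rep_trace_L2 (acts k (A * B) F) m i j =
          (\<Sum>p<n ^ k. (\<Sum>l<n ^ k. A $$ (i div d, l) * B $$ (l, p)) * Rep_trace_L2 F m (p * d + i mod d) j)"
          unfolding Rep_acts[OF m i j] n_def[symmetric] d_def[symmetric]
          by (rule sum.cong[OF refl])
            (use A B ix(1) in \<open>auto simp: scalar_prod_def n_def lessThan_atLeast0\<close>)
        also have "\<dots> = (\<Sum>p<n ^ k. \<Sum>l<n ^ k. A $$ (i div d, l) * (B $$ (l, p) * Rep_trace_L2 F m (p * d + i mod d) j))"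
          by (simp add: sum_distrib_right mult.assoc)
        also have "\<dots> = (\<Sum>l<n ^ k. \<Sum>p<n ^ k. A $$ (i div d, l) * (B $$ (l, p) * Rep_trace_L2 F m (p * d + i mod d) j))"
          by (rule sum.swap)
        also have "\<dots> = (\<Sum>l<n ^ k. A $$ (i div d, l) * Rep_trace_L2 (acts k B F) m (l * d + i mod d) j)"
        proof (rule sum.cong[OF refl])
          fix l assume "l \<in> {..<n ^ k}"
          then have "l * d + i mod d < CARD('n) ^ m" using ix(2)[of l] by (simp add: n_def)
          from Rep_acts[OF m this j, of B F]
          have "Rep_trace_L2 (acts k B F) m (l * d + i mod d) j =
            (\<Sum>p<n ^ k. B $$ (l, p) * Rep_trace_L2 F m (p * d + i mod d) j)"
            using ix(3,4) by (simp flip: n_def d_def)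
          then show "(\<Sum>p<n ^ k. A $$ (i div d, l) * (B $$ (l, p) * Rep_trace_L2 F m (p * d + i mod d) j)) =
            A $$ (i div d, l) * Rep_trace_L2 (acts k B F) m (l * d + i mod d) j"
            by (simp add: sum_distrib_left)
        qed
        also have "\<dots> = Rep_trace_L2 (acts k A (acts k B F)) m i j"
          unfolding Rep_acts[OF m i j, of A] n_def d_def ..
        finally show "Rep_trace_L2 (acts k (A * B) F) m i j = Rep_trace_L2 (acts k A (acts k B F)) m i j" .
      qed
      then show "trace_rep (A * B) F = (trace_rep A o\<^sub>L trace_rep B) F"
        by (simp add: app[OF A] app[OF B] app[OF AB(2)])
    qed
  }
  show "trace_rep (1\<^sub>m (CARD('n) ^ k)) = (id_blinfun :: 'n trace_L2 \<Rightarrow>\<^sub>L 'n trace_L2)" for k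
  proof (rule blinfun_eqI)
    fix F :: "'n trace_L2"
    have "acts k (1\<^sub>m (CARD('n) ^ k)) F = F"
    proof (rule trace_L2_eqI[where k = k])
      fix m i j assume m: "k \<le> m" and i: "i < CARD('n) ^ m" and j: "j < CARD('n) ^ m"
      define d where "d = CARD('n) ^ (m - k)"
      have "Rep_trace_L2 (acts k (1\<^sub>m (CARD('n) ^ k)) F) m i j =
        (\<Sum>p<CARD('n) ^ k. if i div d = p then Rep_trace_L2 F m (p * d + i mod d) j else 0)"
        unfolding Rep_acts[OF m i j] d_def[symmetric]
        by (rule sum.cong[OF refl]) (use idx(1)[OF m i] in \<open>auto simp: d_def\<close>)
      also have "\<dots> = Rep_trace_L2 F m i j" using idx(1)[OF m i] by (simp add: div_mult_mod_eq flip: d_def)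
      finally show "Rep_trace_L2 (acts k (1\<^sub>m (CARD('n) ^ k)) F) m i j = Rep_trace_L2 F m i j" .
    qed
    then show "trace_rep (1\<^sub>m (CARD('n) ^ k)) F = id_blinfun F" by (simp add: app[of _ k])
  qed
  have "X \<in> closure ((\<lambda>A. trace_rep A omega) ` tensor_powers CARD('n))" for X :: "'n trace_L2"
    unfolding closure_sequential
  proof (intro exI conjI allI)
    let ?P = "\<lambda>k. mat (CARD('n) ^ k) (CARD('n) ^ k) (\<lambda>(i, j). Rep_trace_L2 X k i j)"
    have P: "?P k \<in> carrier_mat (CARD('n) ^ k) (CARD('n) ^ k)" for k by simp
    show "acts k (?P k) (omega :: 'n trace_L2) \<in> (\<lambda>A. trace_rep A omega) ` tensor_powers CARD('n)" for k
      unfolding app[OF P, symmetric] tensor_powers_def using P[of k] by (intro imageI) blast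
    show "(\<lambda>k. acts k (?P k) (omega :: 'n trace_L2)) \<longlonglongrightarrow> X" by (rule trace_L2_dense)
  qed
  then show "closure ((\<lambda>A. trace_rep A (omega :: 'n trace_L2)) ` tensor_powers CARD('n)) = UNIV" by blast
qed

theorem gns_representation_exists:
  "\<exists>\<pi> (\<Omega> :: bool trace_L2). gns_representation 2 \<pi> \<Omega>"
  using gns_representation_trace_rep[where 'n = bool] by auto

hide_const (open) act0 act acts act_bound scl cip omega mart lev_ip lev_sq
hide_fact (open) idx

end

theory Submission
  imports Defs
begin

text \<open>
  For an angle \<open>\<alpha>\<close> let \<open>X\<^sub>\<alpha>\<close> be the self-adjoint unitary with entries \<open>e\<^bsup>-i\<alpha>\<^esup>\<close> and \<open>e\<^bsup>i\<alpha>\<^esup>\<close> off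
  the diagonal, so that \<open>X\<^sub>0\<close> is the Pauli matrix \<open>X\<close>. The product
  \<open>X\<^sub>\<alpha> \<otimes> X \<otimes> X \<otimes> ...\<close> does not converge, but conjugation by it is an automorphism \<open>\<sigma>\<^sub>\<alpha>\<close> of
  period two of the ambient factor, and the spin model subfactor of \<open>H\<^sub>\<alpha>\<close> is its fixed point
  algebra. At a finite level this rests on two identities for the unitary \<open>u\<^sub>1\<close>: it satisfies
  \<open>(X\<^sub>\<alpha> \<otimes> X) u\<^sub>1 = u\<^sub>1 (1 \<otimes> X\<^sub>\<alpha>)\<close>, and it commutes with \<open>1 \<otimes> D\<close> for diagonal \<open>D\<close>. Iterating
  them along the product that defines \<open>u\<^bsub>2k-1\<^esub>\<close> shows that the \<open>k\<close>-th algebra consists of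
  matrices commuting with \<open>X\<^sub>\<alpha> \<otimes> X\<^bsup>\<otimes>k\<^esup>\<close> (\<open>spin_model_algebra_subset_flip_commutant\<close>); conversely,
  a matrix with this property lies in the next algebra (\<open>flip_commutant_kron_one\<close>), because a
  matrix commuting with \<open>1 \<otimes> X\<^sub>\<alpha>\<close> and with \<open>1 \<otimes> D\<close> has the form \<open>A \<otimes> 1\<close>.

  Write \<open>\<gamma> = \<alpha> - \<beta>\<close>. Since \<open>\<sigma>\<^sub>\<alpha>\<close> and \<open>\<sigma>\<^sub>\<beta>\<close> differ only in the first tensor factor,
  \<open>\<sigma>\<^sub>\<beta> \<sigma>\<^sub>\<alpha>\<close> is conjugation by the matrix \<open>t = X\<^sub>\<beta> X\<^sub>\<alpha> = diag(e\<^bsup>i\<gamma>\<^esup>, e\<^bsup>-i\<gamma>\<^esup>)\<close> in that factor. Hence for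
  \<open>x\<close> fixed by \<open>\<sigma>\<^sub>\<alpha>\<close> the projection to the fixed points of \<open>\<sigma>\<^sub>\<beta>\<close> is \<open>y = (x + t x t\<^sup>*) / 2\<close>, a
  formula that makes sense for every operator and is weakly continuous, so it is compatible with
  the passage to weak closures. The difference \<open>x - y\<close> only sees the off-diagonal blocks of \<open>x\<close>
  with respect to the first tensor factor, each multiplied by a number of modulus
  \<open>\<bar>sin \<gamma>\<bar>\<close>, which gives the upper bound (\<open>spin_model_subfactor_close\<close>). It is
  attained at \<open>x = X\<^sub>\<alpha>\<close>: the unit vector obtained from \<open>X\<close> at the angle \<open>\<beta> + \<pi>/2\<close> is orthogonal to the
  subfactor of \<open>H\<^sub>\<beta>\<close>, because that matrix is mapped to its negative by \<open>\<sigma>\<^sub>\<beta>\<close>, and its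
  inner product with \<open>X\<^sub>\<alpha>\<close> is \<open>sin \<gamma>\<close> (\<open>spin_model_subfactor_far\<close>).
\<close>

section \<open>Kronecker products, adjoints and the normalized trace\<close>

lemma kron_carrier [intro, simp]:
  "A \<in> carrier_mat a b \<Longrightarrow> B \<in> carrier_mat c d \<Longrightarrow> A \<otimes>\<^sub>m B \<in> carrier_mat (a * c) (b * d)"
  by (auto simp: kron_def)

lemma dim_kron [simp]:
  "dim_row (A \<otimes>\<^sub>m B) = dim_row A * dim_row B" "dim_col (A \<otimes>\<^sub>m B) = dim_col A * dim_col B"
  by (auto simp: kron_def)

lemma kron_index:
  assumes "i < dim_row A * dim_row B" "j < dim_col A * dim_col B"
  shows "(A \<otimes>\<^sub>m B) $$ (i, j) = A $$ (i div dim_row B, j div dim_col B) * B $$ (i mod dim_row B, j mod dim_col B)"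
  using assms by (simp add: kron_def)

lemma div_mod_less:
  assumes "i < a * (b::nat)"
  shows "i div b < a" "i mod b < b"
  using assms by (auto simp: less_mult_imp_div_less) (metis mod_less_divisor mult_0_right not_gr_zero not_less0)

lemma kron_mult:
  assumes A: "A \<in> carrier_mat a b" and B: "B \<in> carrier_mat c d"
    and C: "C \<in> carrier_mat b e" and D: "D \<in> carrier_mat d f"
  shows "(A \<otimes>\<^sub>m B) * (C \<otimes>\<^sub>m D) = (A * C) \<otimes>\<^sub>m (B * D)"
proof (rule eq_matI)
  fix i j assume "i < dim_row ((A * C) \<otimes>\<^sub>m (B * D))" "j < dim_col ((A * C) \<otimes>\<^sub>m (B * D))"
  then have ij: "i < a * c" "j < e * f" using assms by auto
  note l = div_mod_less[OF ij(1)] div_mod_less[OF ij(2)]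
  have "((A \<otimes>\<^sub>m B) * (C \<otimes>\<^sub>m D)) $$ (i, j) = (\<Sum>p<b * d. (A \<otimes>\<^sub>m B) $$ (i, p) * (C \<otimes>\<^sub>m D) $$ (p, j))"
    using assms ij by (simp add: scalar_prod_def lessThan_atLeast0)
  also have "\<dots> = (\<Sum>p<b. \<Sum>q<d. (A \<otimes>\<^sub>m B) $$ (i, p * d + q) * (C \<otimes>\<^sub>m D) $$ (p * d + q, j))"
    by (rule sum_lessThan_mult)
  also have "\<dots> = (\<Sum>p<b. \<Sum>q<d. (A $$ (i div c, p) * C $$ (p, j div f)) * (B $$ (i mod c, q) * D $$ (q, j mod f)))"
    using assms ij by (intro sum.cong refl) (simp add: kron_index digit_less)
  also have "\<dots> = (\<Sum>p<b. A $$ (i div c, p) * C $$ (p, j div f)) * (\<Sum>q<d. B $$ (i mod c, q) * D $$ (q, j mod f))"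
    by (simp add: sum_product)
  also have "\<dots> = ((A * C) \<otimes>\<^sub>m (B * D)) $$ (i, j)"
    using assms ij l by (simp add: kron_index scalar_prod_def lessThan_atLeast0)
  finally show "((A \<otimes>\<^sub>m B) * (C \<otimes>\<^sub>m D)) $$ (i, j) = ((A * C) \<otimes>\<^sub>m (B * D)) $$ (i, j)" .
qed (use assms in auto)

lemma kron_assoc: "A \<otimes>\<^sub>m B \<otimes>\<^sub>m C = A \<otimes>\<^sub>m (B \<otimes>\<^sub>m C)"
proof (rule eq_matI)
  fix i j assume "i < dim_row (A \<otimes>\<^sub>m (B \<otimes>\<^sub>m C))" "j < dim_col (A \<otimes>\<^sub>m (B \<otimes>\<^sub>m C))"
  then have ij: "i < dim_row A * dim_row B * dim_row C" "j < dim_col A * dim_col B * dim_col C"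
    by (auto simp: mult.assoc)
  note l = div_mod_less[OF ij(1)] div_mod_less[OF ij(2)]
  note l2 = div_mod_less[OF ij(1)[unfolded mult.assoc]] div_mod_less[OF ij(2)[unfolded mult.assoc]]
  have split: "i div c div b = i div (b * c)" "i div c mod b = i mod (b * c) div c"
    "i mod (b * c) mod c = i mod c" for i b c :: nat
    by (cases "c = 0"; simp add: div_mult2_eq[symmetric] mod_mult2_eq mult.commute[of b])+
  show "(A \<otimes>\<^sub>m B \<otimes>\<^sub>m C) $$ (i, j) = (A \<otimes>\<^sub>m (B \<otimes>\<^sub>m C)) $$ (i, j)"
    using ij l l2 by (simp add: kron_index split mult.assoc)
qed (auto simp: mult.assoc)

lemma kron_one_one: "1\<^sub>m a \<otimes>\<^sub>m 1\<^sub>m b = 1\<^sub>m (a * b)"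
proof (rule eq_matI)
  fix i j assume ij: "i < dim_row (1\<^sub>m (a * b) :: complex mat)" "j < dim_col (1\<^sub>m (a * b) :: complex mat)"
  then have "i div b < a" "i mod b < b" "j div b < a" "j mod b < b" using div_mod_less[of _ a b] by auto
  moreover have "i = j \<longleftrightarrow> i div b = j div b \<and> i mod b = j mod b" by (metis div_mult_mod_eq)
  ultimately show "(1\<^sub>m a \<otimes>\<^sub>m 1\<^sub>m b) $$ (i, j) = 1\<^sub>m (a * b) $$ (i, j)"
    using ij by (auto simp: kron_index)
qed auto

lemma kron_one_right [simp]: "A \<otimes>\<^sub>m 1\<^sub>m (Suc 0) = A"
  by (rule eq_matI) (auto simp: kron_index)

lemma mat_adjoint_carrier [intro, simp]:
  "A \<in> carrier_mat a b \<Longrightarrow> mat_adjoint A \<in> carrier_mat b a" for A :: "complex mat"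
  by (auto simp: mat_adjoint_def)

lemma dim_mat_adjoint [simp]:
  "dim_row (mat_adjoint A) = dim_col A" "dim_col (mat_adjoint A) = dim_row A" for A :: "complex mat"
  by (auto simp: mat_adjoint_def)

lemma mat_adjoint_entry:
  "i < dim_col A \<Longrightarrow> j < dim_row A \<Longrightarrow> mat_adjoint A $$ (i, j) = cnj (A $$ (j, i))"
  for A :: "complex mat"
  unfolding mat_adjoint_def by (auto simp: mat_of_rows_def)

lemma mat_adjoint_mult:
  fixes A B :: "complex mat"
  assumes "A \<in> carrier_mat a b" "B \<in> carrier_mat b c"
  shows "mat_adjoint (A * B) = mat_adjoint B * mat_adjoint A"
  using assms by (intro eq_matI) (auto simp: mat_adjoint_entry scalar_prod_def mult.commute)

lemma mat_adjoint_kron: "mat_adjoint (A \<otimes>\<^sub>m B) = mat_adjoint A \<otimes>\<^sub>m mat_adjoint B"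
  by (intro eq_matI) (auto simp: kron_index mat_adjoint_entry div_mod_less)

lemma mat_adjoint_one [simp]: "mat_adjoint (1\<^sub>m a) = (1\<^sub>m a :: complex mat)"
  by (rule eq_matI) (auto simp: mat_adjoint_entry)

lemma normalized_trace_commute:
  assumes "A \<in> carrier_mat m m" "B \<in> carrier_mat m m"
  shows "normalized_trace (A * B) = normalized_trace (B * A)"
proof -
  have "(\<Sum>i<m. \<Sum>j<m. A $$ (i, j) * B $$ (j, i)) = (\<Sum>j<m. \<Sum>i<m. B $$ (j, i) * A $$ (i, j))"
    by (subst sum.swap) (simp add: mult.commute)
  then show ?thesis using assms
    by (simp add: normalized_trace_def scalar_prod_def lessThan_atLeast0)
qed

section \<open>The unitaries of the spin model\<close>

lemma D_mat_index:
  assumes rc: "r < n * n" "c < n * n"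
  shows "D_mat n u $$ (r, c) = (if r = c then complex_of_real (sqrt (real n)) * cnj (u $$ (c mod n, c div n)) else 0)"
proof -
  note l = div_mod_less[OF rc(1)] div_mod_less[OF rc(2)]
  have eq: "r = c \<longleftrightarrow> r div n = c div n \<and> r mod n = c mod n" by (metis div_mult_mod_eq)
  have "(\<Sum>i<n. \<Sum>j<n. cnj (u $$ (i, j)) * (matrix_unit n j j \<otimes>\<^sub>m matrix_unit n i i) $$ (r, c))
      = (\<Sum>i<n. \<Sum>j<n. if j = c div n then (if i = c mod n then (if r = c then cnj (u $$ (i, j)) else 0) else 0) else 0)"
    using rc l by (intro sum.cong refl) (auto simp: kron_index matrix_unit_def eq)
  also have "\<dots> = (if r = c then cnj (u $$ (c mod n, c div n)) else 0)"
    using l by simp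
  finally show ?thesis using rc by (simp add: D_mat_def)
qed

lemma u1_mat_carrier [simp]: "u \<in> carrier_mat n n \<Longrightarrow> u1_mat n u \<in> carrier_mat (n * n) (n * n)"
  by (auto simp: u1_mat_def D_mat_def)

lemma u1_mat_index:
  assumes u: "u \<in> carrier_mat n n" and rc: "r < n * n" "c < n * n"
  shows "u1_mat n u $$ (r, c) = (if r mod n = c mod n
    then complex_of_real (sqrt (real n)) * u $$ (r div n, c div n) * cnj (u $$ (r mod n, c div n)) else 0)"
proof -
  note l = div_mod_less[OF rc(1)] div_mod_less[OF rc(2)]
  have D: "D_mat n u \<in> carrier_mat (n * n) (n * n)" by (simp add: D_mat_def)
  have "u1_mat n u $$ (r, c) = (\<Sum>p<n * n. (u \<otimes>\<^sub>m 1\<^sub>m n) $$ (r, p) * D_mat n u $$ (p, c))"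
    using u D rc by (simp add: u1_mat_def scalar_prod_def lessThan_atLeast0)
  also have "\<dots> = (\<Sum>p<n * n. if p = c then (u \<otimes>\<^sub>m 1\<^sub>m n) $$ (r, c) *
      (complex_of_real (sqrt (real n)) * cnj (u $$ (c mod n, c div n))) else 0)"
    using rc by (intro sum.cong refl) (auto simp: D_mat_index)
  also have "\<dots> = (u \<otimes>\<^sub>m 1\<^sub>m n) $$ (r, c) * (complex_of_real (sqrt (real n)) * cnj (u $$ (c mod n, c div n)))"
    using rc by simp
  finally show ?thesis using u rc l by (auto simp: kron_index)
qed

lemma foldr_mult_carrier:
  "set As \<subseteq> carrier_mat N N \<Longrightarrow> M \<in> carrier_mat N N \<Longrightarrow> foldr (*) As M \<in> carrier_mat N N"
  for M :: "complex mat"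
  by (induction As) auto

lemma foldr_mult_right:
  fixes M :: "complex mat"
  assumes "set As \<subseteq> carrier_mat N N" "M \<in> carrier_mat N N"
  shows "foldr (*) As M = foldr (*) As (1\<^sub>m N) * M"
  using assms
proof (induction As)
  case (Cons A As)
  then show ?case
    by (simp add: assoc_mult_mat[of A N N _ N M N] foldr_mult_carrier)
qed simp

lemma foldr_mult_kron_one:
  assumes "set As \<subseteq> carrier_mat N N"
  shows "foldr (*) (map (\<lambda>A. A \<otimes>\<^sub>m 1\<^sub>m n) As) (1\<^sub>m (N * n)) = foldr (*) As (1\<^sub>m N) \<otimes>\<^sub>m 1\<^sub>m n"
  using assms
proof (induction As)
  case Nil
  then show ?case by (simp add: kron_one_one)
next
  case (Cons A As)
  then show ?case
    by (simp add: kron_mult[of A N N "1\<^sub>m n" n n _ N "1\<^sub>m n" n] foldr_mult_carrier)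
qed

text \<open>
  The factors of \<open>u\<^bsub>2k+1\<^esub>\<close> are those of \<open>u\<^bsub>2k-1\<^esub>\<close>, each tensored with an identity on the
  right, followed by one new factor on the last two sites. This recursion carries all inductions
  over \<open>k\<close> below.
\<close>

lemma u_odd_Suc:
  assumes u: "u \<in> carrier_mat n n"
  shows "u_odd n u (Suc k) = (u_odd n u k \<otimes>\<^sub>m 1\<^sub>m n) * (1\<^sub>m (n ^ k) \<otimes>\<^sub>m u1_mat n u)"
proof -
  let ?f = "\<lambda>k i. 1\<^sub>m (n ^ i) \<otimes>\<^sub>m u1_mat n u \<otimes>\<^sub>m 1\<^sub>m (n ^ (k - 1 - i))"
  have pow: "n ^ i * (n * n) * n ^ (k - 1 - i) = n ^ (k + 1)" if "i < k" for i k :: nat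
  proof -
    have "n ^ i * (n * n) * n ^ (k - 1 - i) = n ^ (i + 2 + (k - 1 - i))"
      by (simp add: power_add power2_eq_square)
    also have "i + 2 + (k - 1 - i) = k + 1" using that by simp
    finally show ?thesis .
  qed
  have f: "?f k i \<in> carrier_mat (n ^ (k + 1)) (n ^ (k + 1))" if "i < k" for i k
    using kron_carrier[OF kron_carrier[OF one_carrier_mat u1_mat_carrier[OF u]] one_carrier_mat,
        of "n ^ i" "n ^ (k - 1 - i)"] unfolding pow[OF that] .
  have step: "?f (Suc k) i = ?f k i \<otimes>\<^sub>m 1\<^sub>m n" if "i < k" for i
  proof -
    have "Suc k - 1 - i = Suc (k - 1 - i)" using that by simp
    then have "1\<^sub>m (n ^ (Suc k - 1 - i)) = 1\<^sub>m (n ^ (k - 1 - i)) \<otimes>\<^sub>m 1\<^sub>m n"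
      by (simp add: kron_one_one mult.commute)
    then show ?thesis by (simp only: kron_assoc)
  qed
  have last: "?f (Suc k) k = 1\<^sub>m (n ^ k) \<otimes>\<^sub>m u1_mat n u" by simp
  have N: "n ^ (Suc k + 1) = n ^ (k + 1) * n" by (simp add: mult.commute)
  have car: "1\<^sub>m (n ^ k) \<otimes>\<^sub>m u1_mat n u \<in> carrier_mat (n ^ (k + 1) * n) (n ^ (k + 1) * n)"
    using f[of k "Suc k"] unfolding last N by simp
  have "u_odd n u (Suc k) = foldr (*) (map (?f (Suc k)) [0..<k]) ((1\<^sub>m (n ^ k) \<otimes>\<^sub>m u1_mat n u) * 1\<^sub>m (n ^ (k + 1) * n))"
    unfolding u_odd_def N by simp
  also have "\<dots> = foldr (*) (map (\<lambda>A. A \<otimes>\<^sub>m 1\<^sub>m n) (map (?f k) [0..<k])) (1\<^sub>m (n ^ k) \<otimes>\<^sub>m u1_mat n u)"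
    unfolding right_mult_one_mat[OF car] map_map
    by (intro arg_cong2[where f = "\<lambda>xs. foldr (*) xs"] map_cong refl) (use step in auto)
  also have "\<dots> = foldr (*) (map (\<lambda>A. A \<otimes>\<^sub>m 1\<^sub>m n) (map (?f k) [0..<k])) (1\<^sub>m (n ^ (k + 1) * n)) *
      (1\<^sub>m (n ^ k) \<otimes>\<^sub>m u1_mat n u)"
    by (rule foldr_mult_right[OF _ car]) (use f[of _ k] in auto)
  also have "\<dots> = (u_odd n u k \<otimes>\<^sub>m 1\<^sub>m n) * (1\<^sub>m (n ^ k) \<otimes>\<^sub>m u1_mat n u)"
    unfolding u_odd_def
    by (subst foldr_mult_kron_one) (use f[of _ k] in auto)
  finally show ?thesis .
qed

text \<open>
  The combination \<open>cos \<alpha> X + sin \<alpha> Y\<close> of two Pauli matrices: a reflection that exchanges the two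
  basis vectors up to a phase.
\<close>

definition xy_pauli :: "real \<Rightarrow> complex mat" where
  "xy_pauli \<alpha> = mat 2 2 (\<lambda>(i, j). if i = j then 0 else if i = 0 then cis (- \<alpha>) else cis \<alpha>)"

lemma xy_pauli_carrier [simp]: "xy_pauli \<alpha> \<in> carrier_mat 2 2"
  by (simp add: xy_pauli_def)

lemma xy_pauli_dim [simp]: "dim_row (xy_pauli \<alpha>) = 2" "dim_col (xy_pauli \<alpha>) = 2"
  by (simp_all add: xy_pauli_def)

lemma xy_pauli_index:
  "i < 2 \<Longrightarrow> j < 2 \<Longrightarrow> xy_pauli \<alpha> $$ (i, j) = (if i = j then 0 else if i = 0 then cis (- \<alpha>) else cis \<alpha>)"
  by (simp add: xy_pauli_def)

lemma matrix_unit_dim [simp]: "dim_row (matrix_unit n i j) = n" "dim_col (matrix_unit n i j) = n"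
  by (simp_all add: matrix_unit_def)

lemma matrix_unit_carrier [simp]: "matrix_unit n i j \<in> carrier_mat n n"
  by (simp add: matrix_unit_def)

lemma matrix_unit_index:
  "r < n \<Longrightarrow> c < n \<Longrightarrow> matrix_unit n i j $$ (r, c) = (if r = i \<and> c = j then 1 else 0)"
  by (simp add: matrix_unit_def)

lemma H_mat_carrier [simp]: "H_mat \<alpha> \<in> carrier_mat 2 2"
  using H_mat_hadamard by (simp add: hadamard_unitary_def)

lemma sum_lessThan_2: "(\<Sum>i<2. f i) = f 0 + f (Suc 0)" for f :: "nat \<Rightarrow> complex"
  by (simp add: numeral_2_eq_2)

lemma sum_lessThan_4: "(\<Sum>i<4. f i) = f 0 + f 1 + f 2 + f 3" for f :: "nat \<Rightarrow> complex"
  by (simp add: eval_nat_numeral)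

lemma eq_mat_4I:
  assumes "A \<in> carrier_mat 4 4" "B \<in> carrier_mat 4 4"
    and "\<forall>i\<in>{0, 1, 2, 3}. \<forall>j\<in>{0, 1, 2, 3}. A $$ (i, j) = B $$ (i, j)"
  shows "A = B"
proof (rule eq_matI)
  fix i j assume "i < dim_row B" "j < dim_col B"
  then have "i \<in> {0, 1, 2, 3}" "j \<in> {0, 1, 2, 3}" using assms(2) by auto
  then show "A $$ (i, j) = B $$ (i, j)" using assms(3) by blast
qed (use assms in auto)

lemma H_mat_index:
  "i < 2 \<Longrightarrow> j < 2 \<Longrightarrow> H_mat \<alpha> $$ (i, j) =
    (if i = 0 then 1 else if j = 0 then cis \<alpha> else - cis \<alpha>) / complex_of_real (sqrt 2)"
  by (auto simp: H_mat_def mat_of_rows_list_def less_2_cases_iff)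

lemma u1_H_index:
  assumes "r < 4" "c < 4"
  shows "u1_mat 2 (H_mat \<alpha>) $$ (r, c) = (if r mod 2 = c mod 2
    then (if r < 2 then 1 else if c < 2 then cis \<alpha> else - cis \<alpha>) *
      (if even r then 1 else if c < 2 then cis (- \<alpha>) else - cis (- \<alpha>)) / complex_of_real (sqrt 2) else 0)"
proof -
  have sq: "complex_of_real (sqrt 2) * complex_of_real (sqrt 2) = 2"
    by (simp flip: of_real_mult)
  have "r div 2 < 2" "c div 2 < 2" "r mod 2 < 2" "c mod 2 < 2" using assms by auto
  moreover have "r div 2 = 0 \<longleftrightarrow> r < 2" "c div 2 = 0 \<longleftrightarrow> c < 2" "r mod 2 = 0 \<longleftrightarrow> even r" by auto
  ultimately show ?thesis
    using assms by (auto simp: u1_mat_index H_mat_index sq cis_cnj)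
qed

lemma mult_mat_4_index:
  assumes "A \<in> carrier_mat 4 4" "B \<in> carrier_mat 4 4" "i < 4" "j < 4"
  shows "(A * B) $$ (i, j) = A $$ (i, 0) * B $$ (0, j) + A $$ (i, 1) * B $$ (1, j)
    + A $$ (i, 2) * B $$ (2, j) + A $$ (i, 3) * (B $$ (3, j) :: complex)"
  using assms by (simp add: scalar_prod_def sum_lessThan_4 flip: lessThan_atLeast0)

lemma u1_H_carrier: "u1_mat 2 (H_mat \<alpha>) \<in> carrier_mat 4 4"
  using u1_mat_carrier[OF H_mat_carrier] by simp

lemma kron_carrier_4: "A \<in> carrier_mat 2 2 \<Longrightarrow> B \<in> carrier_mat 2 2 \<Longrightarrow> A \<otimes>\<^sub>m B \<in> carrier_mat 4 4"
  using kron_carrier[of A 2 2 B 2 2] by simp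

text \<open>
  Here \<open>u\<^sub>1 = (d H \<otimes> d\<^sup>*) C\<close> with \<open>d = diag(1, e\<^bsup>i\<alpha>\<^esup>)\<close>, \<open>H\<close> the matrix of angle \<open>0\<close> and \<open>C\<close> the
  controlled \<open>Z\<close>. Conjugation by \<open>C\<close> takes \<open>1 \<otimes> X\<close> to \<open>Z \<otimes> X\<close>, and \<open>H\<close> turns this \<open>Z\<close> into
  \<open>X\<close>; the phases \<open>d\<close> account for the angles. This and the next identity are what makes
  the subfactor a fixed point algebra.
\<close>

lemma u1_H_intertwines_xy_pauli:
  "(xy_pauli \<alpha> \<otimes>\<^sub>m xy_pauli 0) * u1_mat 2 (H_mat \<alpha>) = u1_mat 2 (H_mat \<alpha>) * (1\<^sub>m 2 \<otimes>\<^sub>m xy_pauli \<alpha>)"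
  (is "?S * ?u = ?u * ?T")
proof (rule eq_mat_4I)
  have c: "?u \<in> carrier_mat 4 4" "?S \<in> carrier_mat 4 4" "?T \<in> carrier_mat 4 4"
    by (auto intro!: u1_H_carrier kron_carrier_4)
  then show "?S * ?u \<in> carrier_mat 4 4" "?u * ?T \<in> carrier_mat 4 4" by auto
  show "\<forall>i\<in>{0,1,2,3}. \<forall>j\<in>{0,1,2,3}. (?S * ?u) $$ (i, j) = (?u * ?T) $$ (i, j)"
    by (simp add: mult_mat_4_index[OF c(2,1)] mult_mat_4_index[OF c(1,3)] u1_H_index kron_index xy_pauli_index cis_mult)
qed

lemma u1_H_commutes_diagonal:
  "(1\<^sub>m 2 \<otimes>\<^sub>m matrix_unit 2 0 0) * u1_mat 2 (H_mat \<alpha>) = u1_mat 2 (H_mat \<alpha>) * (1\<^sub>m 2 \<otimes>\<^sub>m matrix_unit 2 0 0)"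
  (is "?S * ?u = ?u * ?S")
proof (rule eq_mat_4I)
  have c: "?u \<in> carrier_mat 4 4" "?S \<in> carrier_mat 4 4"
    by (auto intro!: u1_H_carrier kron_carrier_4)
  then show "?S * ?u \<in> carrier_mat 4 4" "?u * ?S \<in> carrier_mat 4 4" by auto
  show "\<forall>i\<in>{0,1,2,3}. \<forall>j\<in>{0,1,2,3}. (?S * ?u) $$ (i, j) = (?u * ?S) $$ (i, j)"
    by (simp add: mult_mat_4_index[OF c(2,1)] mult_mat_4_index[OF c(1,2)] u1_H_index kron_index matrix_unit_index)
qed

lemma u1_H_unitary: "u1_mat 2 (H_mat \<alpha>) * mat_adjoint (u1_mat 2 (H_mat \<alpha>)) = 1\<^sub>m 4"
  (is "?u * ?v = _")
proof (rule eq_mat_4I)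
  have sq: "complex_of_real (sqrt 2) * complex_of_real (sqrt 2) = 2"
    by (simp flip: of_real_mult)
  have c: "?u \<in> carrier_mat 4 4" "?v \<in> carrier_mat 4 4"
    by (auto intro!: u1_H_carrier mat_adjoint_carrier)
  then show "?u * ?v \<in> carrier_mat 4 4" by auto
  show "\<forall>i\<in>{0,1,2,3}. \<forall>j\<in>{0,1,2,3}. (?u * ?v) $$ (i, j) = 1\<^sub>m 4 $$ (i, j)"
    using c by (simp del: index_mult_mat(1) add: mult_mat_4_index[OF c] mat_adjoint_entry u1_H_index cis_cnj cis_mult sq)
qed simp

section \<open>Spin model algebras as commutants of a flip\<close>

text \<open>
  The matrix \<open>X\<^sub>\<alpha> \<otimes> X \<otimes> ... \<otimes> X\<close> with \<open>k + 1\<close> factors. It lives at the tensor level of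
  \<open>u\<^bsub>2k-1\<^esub>\<close>.
\<close>

primrec flip :: "real \<Rightarrow> nat \<Rightarrow> complex mat" where
  "flip \<alpha> 0 = xy_pauli \<alpha>"
| "flip \<alpha> (Suc k) = flip \<alpha> k \<otimes>\<^sub>m xy_pauli 0"

lemma flip_carrier [simp]: "flip \<alpha> k \<in> carrier_mat (2 ^ Suc k) (2 ^ Suc k)"
proof (induction k)
  case (Suc k)
  from kron_carrier[OF Suc xy_pauli_carrier] show ?case by (simp add: mult.commute)
qed simp

lemma xy_pauli_adjoint: "mat_adjoint (xy_pauli \<alpha>) = xy_pauli \<alpha>"
  by (rule eq_matI) (auto simp: mat_adjoint_entry xy_pauli_index cis_cnj)

lemma xy_pauli_square: "xy_pauli \<alpha> * xy_pauli \<alpha> = 1\<^sub>m 2"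
  by (rule eq_matI) (auto simp: scalar_prod_def xy_pauli_index cis_mult less_2_cases_iff numeral_2_eq_2)

lemma flip_adjoint: "mat_adjoint (flip \<alpha> k) = flip \<alpha> k"
  by (induction k) (simp_all add: xy_pauli_adjoint mat_adjoint_kron)

lemma pow2_Suc: "(2::nat) ^ Suc k = 2 ^ k * 2" by simp

lemma flip_square: "flip \<alpha> k * flip \<alpha> k = 1\<^sub>m (2 ^ Suc k)"
proof (induction k)
  case (Suc k)
  have "flip \<alpha> (Suc k) * flip \<alpha> (Suc k) = (flip \<alpha> k * flip \<alpha> k) \<otimes>\<^sub>m (xy_pauli 0 * xy_pauli 0)"
    unfolding flip.simps by (rule kron_mult) (rule flip_carrier xy_pauli_carrier)+
  also have "\<dots> = 1\<^sub>m (2 ^ Suc (Suc k))"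
    unfolding Suc xy_pauli_square kron_one_one by (simp add: mult.commute)
  finally show ?case .
qed (simp add: xy_pauli_square)

lemma u_odd_H_carrier: "u_odd 2 (H_mat \<alpha>) k \<in> carrier_mat (2 ^ Suc k) (2 ^ Suc k)"
  using u_odd_carrier[OF H_mat_carrier, of \<alpha> k] by simp

lemma site_carrier:
  "M \<in> carrier_mat 2 2 \<Longrightarrow> 1\<^sub>m (2 ^ k) \<otimes>\<^sub>m M \<in> carrier_mat (2 ^ Suc k) (2 ^ Suc k)"
  unfolding pow2_Suc by (intro kron_carrier one_carrier_mat)

lemma site_Suc: "1\<^sub>m (2 ^ Suc k) \<otimes>\<^sub>m M = 1\<^sub>m (2 ^ k) \<otimes>\<^sub>m (1\<^sub>m 2 \<otimes>\<^sub>m M)"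
  unfolding kron_assoc[symmetric] kron_one_one by (simp add: mult.commute)

text \<open>
  An operator on the first \<open>k + 1\<close> sites which the \<open>k\<close>-th unitary moves to the last of these sites
  is moved on to the next site by the new factor \<open>u\<^sub>1\<close>. For the flip this is the induction step; with the
  identity in place of that operator it shows that a diagonal matrix on the new site stays there.
\<close>

lemma u_odd_intertwines:
  assumes S: "S \<in> carrier_mat (2 ^ Suc k) (2 ^ Suc k)" and M: "M \<in> carrier_mat 2 2"
    and N: "N \<in> carrier_mat 2 2" and L: "L \<in> carrier_mat 2 2"
    and U: "S * u_odd 2 (H_mat \<alpha>) k = u_odd 2 (H_mat \<alpha>) k * (1\<^sub>m (2 ^ k) \<otimes>\<^sub>m M)"
    and u1: "(M \<otimes>\<^sub>m N) * u1_mat 2 (H_mat \<alpha>) = u1_mat 2 (H_mat \<alpha>) * (1\<^sub>m 2 \<otimes>\<^sub>m L)"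
  shows "(S \<otimes>\<^sub>m N) * u_odd 2 (H_mat \<alpha>) (Suc k)
    = u_odd 2 (H_mat \<alpha>) (Suc k) * (1\<^sub>m (2 ^ Suc k) \<otimes>\<^sub>m L)"
proof -
  let ?U = "u_odd 2 (H_mat \<alpha>) k" and ?u = "u1_mat 2 (H_mat \<alpha>)" and ?I = "1\<^sub>m (2 ^ k) :: complex mat"
  let ?d = "2 ^ Suc k * 2 :: nat"
  note cU = u_odd_H_carrier[of \<alpha> k] and cu = u1_H_carrier[of \<alpha>]
  note c4 = kron_carrier_4[OF M N] kron_carrier_4[OF one_carrier_mat L]
  have k4: "?I \<otimes>\<^sub>m A \<in> carrier_mat ?d ?d" if "A \<in> carrier_mat 4 4" for A
    using kron_carrier[OF one_carrier_mat that, of "2 ^ k"] by (simp add: mult.commute)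
  have k2: "A \<otimes>\<^sub>m B \<in> carrier_mat ?d ?d" if "A \<in> carrier_mat (2 ^ Suc k) (2 ^ Suc k)" "B \<in> carrier_mat 2 2" for A B
    using that by (rule kron_carrier)
  have M_mult: "(?I \<otimes>\<^sub>m A) * (?I \<otimes>\<^sub>m B) = ?I \<otimes>\<^sub>m (A * B)" if "A \<in> carrier_mat 4 4" "B \<in> carrier_mat 4 4" for A B
    using kron_mult[OF one_carrier_mat that(1) one_carrier_mat that(2), of "2 ^ k"] by simp
  have "(S \<otimes>\<^sub>m N) * u_odd 2 (H_mat \<alpha>) (Suc k) = ((S \<otimes>\<^sub>m N) * (?U \<otimes>\<^sub>m 1\<^sub>m 2)) * (?I \<otimes>\<^sub>m ?u)"
    unfolding u_odd_Suc[OF H_mat_carrier]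
    by (rule assoc_mult_mat[symmetric]) (rule k2 k4 S N cU cu one_carrier_mat)+
  also have "(S \<otimes>\<^sub>m N) * (?U \<otimes>\<^sub>m 1\<^sub>m 2) = (?U * (?I \<otimes>\<^sub>m M)) \<otimes>\<^sub>m N"
    by (subst kron_mult[OF S N cU one_carrier_mat]) (simp add: U right_mult_one_mat[OF N])
  also have "\<dots> = (?U * (?I \<otimes>\<^sub>m M)) \<otimes>\<^sub>m (1\<^sub>m 2 * N)"
    by (simp add: left_mult_one_mat[OF N])
  also have "\<dots> = (?U \<otimes>\<^sub>m 1\<^sub>m 2) * (?I \<otimes>\<^sub>m (M \<otimes>\<^sub>m N))"
    unfolding kron_assoc[symmetric]
    by (rule kron_mult[OF cU one_carrier_mat site_carrier[OF M] N, symmetric])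
  also have "\<dots> * (?I \<otimes>\<^sub>m ?u) = (?U \<otimes>\<^sub>m 1\<^sub>m 2) * ((?I \<otimes>\<^sub>m (M \<otimes>\<^sub>m N)) * (?I \<otimes>\<^sub>m ?u))"
    by (rule assoc_mult_mat) (rule k2 k4 c4 S N cU cu one_carrier_mat)+
  also have "(?I \<otimes>\<^sub>m (M \<otimes>\<^sub>m N)) * (?I \<otimes>\<^sub>m ?u) = (?I \<otimes>\<^sub>m ?u) * (?I \<otimes>\<^sub>m (1\<^sub>m 2 \<otimes>\<^sub>m L))"
    unfolding M_mult[OF c4(1) cu] u1 M_mult[OF cu c4(2)] ..
  also have "(?U \<otimes>\<^sub>m 1\<^sub>m 2) * \<dots> = ((?U \<otimes>\<^sub>m 1\<^sub>m 2) * (?I \<otimes>\<^sub>m ?u)) * (?I \<otimes>\<^sub>m (1\<^sub>m 2 \<otimes>\<^sub>m L))"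
    by (rule assoc_mult_mat[symmetric]) (rule k2 k4 c4 S N cU cu one_carrier_mat)+
  also have "\<dots> = u_odd 2 (H_mat \<alpha>) (Suc k) * (1\<^sub>m (2 ^ Suc k) \<otimes>\<^sub>m L)"
    unfolding u_odd_Suc[OF H_mat_carrier] site_Suc ..
  finally show ?thesis .
qed

lemma u_odd_0: "u \<in> carrier_mat n n \<Longrightarrow> u_odd n u 0 = 1\<^sub>m n"
  by (simp add: u_odd_def)

lemma one_kron_left: "1\<^sub>m (Suc 0) \<otimes>\<^sub>m A = A"
  by (rule eq_matI) (auto simp: kron_index)

lemma flip_u_odd:
  "flip \<alpha> k * u_odd 2 (H_mat \<alpha>) k = u_odd 2 (H_mat \<alpha>) k * (1\<^sub>m (2 ^ k) \<otimes>\<^sub>m xy_pauli \<alpha>)"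
proof (induction k)
  case 0
  show ?case
    by (simp add: u_odd_0[of _ 2] one_kron_left
        left_mult_one_mat[OF xy_pauli_carrier] right_mult_one_mat[OF xy_pauli_carrier])
next
  case (Suc k)
  show ?case unfolding flip.simps
    by (rule u_odd_intertwines[OF flip_carrier _ _ _ Suc u1_H_intertwines_xy_pauli]) simp_all
qed

lemma diagonal_u_odd:
  "(1\<^sub>m (2 ^ k) \<otimes>\<^sub>m matrix_unit 2 0 0) * u_odd 2 (H_mat \<alpha>) k
    = u_odd 2 (H_mat \<alpha>) k * (1\<^sub>m (2 ^ k) \<otimes>\<^sub>m matrix_unit 2 0 0)"
proof (cases k)
  case 0
  then show ?thesis
    by (simp add: u_odd_0[of _ 2] one_kron_left
        left_mult_one_mat[OF matrix_unit_carrier] right_mult_one_mat[OF matrix_unit_carrier])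
next
  case (Suc m)
  have "(1\<^sub>m (2 ^ Suc m) \<otimes>\<^sub>m matrix_unit 2 0 0) * u_odd 2 (H_mat \<alpha>) (Suc m)
      = u_odd 2 (H_mat \<alpha>) (Suc m) * (1\<^sub>m (2 ^ Suc m) \<otimes>\<^sub>m matrix_unit 2 0 0)"
  proof (rule u_odd_intertwines)
    show "1\<^sub>m (2 ^ Suc m) * u_odd 2 (H_mat \<alpha>) m = u_odd 2 (H_mat \<alpha>) m * (1\<^sub>m (2 ^ m) \<otimes>\<^sub>m 1\<^sub>m 2)"
      unfolding kron_one_one pow2_Suc[symmetric]
      by (simp only: left_mult_one_mat[OF u_odd_H_carrier] right_mult_one_mat[OF u_odd_H_carrier])
    show "(1\<^sub>m 2 \<otimes>\<^sub>m matrix_unit 2 0 0) * u1_mat 2 (H_mat \<alpha>)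
      = u1_mat 2 (H_mat \<alpha>) * (1\<^sub>m 2 \<otimes>\<^sub>m matrix_unit 2 0 0)"
      by (rule u1_H_commutes_diagonal)
  qed simp_all
  then show ?thesis using Suc by simp
qed

lemma u_odd_unitary: "u_odd 2 (H_mat \<alpha>) k * mat_adjoint (u_odd 2 (H_mat \<alpha>) k) = 1\<^sub>m (2 ^ Suc k)"
proof (induction k)
  case 0
  show ?case by (simp add: u_odd_0[of _ 2])
next
  case (Suc k)
  let ?U = "u_odd 2 (H_mat \<alpha>) k" and ?u = "u1_mat 2 (H_mat \<alpha>)" and ?I = "1\<^sub>m (2 ^ k) :: complex mat"
  let ?d = "2 ^ Suc k * 2 :: nat"
  note cU = u_odd_H_carrier[of \<alpha> k] and cu = u1_H_carrier[of \<alpha>]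
  note cU' = mat_adjoint_carrier[OF cU] and cu' = mat_adjoint_carrier[OF cu]
  have k4: "?I \<otimes>\<^sub>m A \<in> carrier_mat ?d ?d" if "A \<in> carrier_mat 4 4" for A
    using kron_carrier[OF one_carrier_mat that, of "2 ^ k"] by (simp add: mult.commute)
  have k2: "A \<otimes>\<^sub>m 1\<^sub>m 2 \<in> carrier_mat ?d ?d" if "A \<in> carrier_mat (2 ^ Suc k) (2 ^ Suc k)" for A
    using that one_carrier_mat by (rule kron_carrier)
  have "(?I \<otimes>\<^sub>m ?u) * (?I \<otimes>\<^sub>m mat_adjoint ?u) = 1\<^sub>m ?d"
    by (subst kron_mult[OF one_carrier_mat cu one_carrier_mat cu'])
      (simp add: u1_H_unitary kron_one_one mult.commute)
  then have one: "(?I \<otimes>\<^sub>m ?u) * ((?I \<otimes>\<^sub>m mat_adjoint ?u) * (mat_adjoint ?U \<otimes>\<^sub>m 1\<^sub>m 2)) = mat_adjoint ?U \<otimes>\<^sub>m 1\<^sub>m 2"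
    using assoc_mult_mat[OF k4[OF cu] k4[OF cu'] k2[OF cU']] left_mult_one_mat[OF k2[OF cU']] by simp
  have "u_odd 2 (H_mat \<alpha>) (Suc k) * mat_adjoint (u_odd 2 (H_mat \<alpha>) (Suc k)) =
    (?U \<otimes>\<^sub>m 1\<^sub>m 2) * (?I \<otimes>\<^sub>m ?u) * ((?I \<otimes>\<^sub>m mat_adjoint ?u) * (mat_adjoint ?U \<otimes>\<^sub>m 1\<^sub>m 2))"
    unfolding u_odd_Suc[OF H_mat_carrier]
    by (simp add: mat_adjoint_mult[OF k2[OF cU] k4[OF cu]] mat_adjoint_kron)
  also have "\<dots> = (?U \<otimes>\<^sub>m 1\<^sub>m 2) * (mat_adjoint ?U \<otimes>\<^sub>m 1\<^sub>m 2)"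
    by (subst assoc_mult_mat[OF k2[OF cU] k4[OF cu] mult_carrier_mat[OF k4[OF cu'] k2[OF cU']]])
      (simp only: one)
  also have "\<dots> = (?U * mat_adjoint ?U) \<otimes>\<^sub>m (1\<^sub>m 2 * 1\<^sub>m 2)"
    by (rule kron_mult[OF cU one_carrier_mat cU' one_carrier_mat])
  also have "\<dots> = 1\<^sub>m (2 ^ Suc (Suc k))"
    unfolding Suc by (simp add: kron_one_one mult.commute)
  finally show ?case .
qed

text \<open>
  A diagonal projection and \<open>X\<^sub>\<alpha>\<close> generate the \<open>2 \<times> 2\<close> matrices: commuting with the projection
  kills the off-diagonal blocks, commuting with \<open>X\<^sub>\<alpha>\<close> identifies the two diagonal blocks.
\<close>

lemma commutant_last_site:
  assumes C: "C \<in> carrier_mat (N * 2) (N * 2)"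
    and x: "(1\<^sub>m N \<otimes>\<^sub>m xy_pauli \<alpha>) * C = C * (1\<^sub>m N \<otimes>\<^sub>m xy_pauli \<alpha>)"
    and e: "(1\<^sub>m N \<otimes>\<^sub>m matrix_unit 2 0 0) * C = C * (1\<^sub>m N \<otimes>\<^sub>m matrix_unit 2 0 0)"
  shows "\<exists>A\<in>carrier_mat N N. C = A \<otimes>\<^sub>m 1\<^sub>m 2"
proof -
  have left: "((1\<^sub>m N \<otimes>\<^sub>m M) * C) $$ (i * 2 + a, c) = M $$ (a, 0) * C $$ (i * 2, c) + M $$ (a, Suc 0) * C $$ (i * 2 + 1, c)"
    if M: "M \<in> carrier_mat 2 2" and i: "i < N" "a < 2" "c < N * 2" for M i a c
  proof -
    have "((1\<^sub>m N \<otimes>\<^sub>m M) * C) $$ (i * 2 + a, c) = (\<Sum>p<N * 2. (1\<^sub>m N \<otimes>\<^sub>m M) $$ (i * 2 + a, p) * C $$ (p, c))"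
      using M C i digit_less[OF i(1,2)] by (simp add: scalar_prod_def lessThan_atLeast0)
    also have "\<dots> = (\<Sum>p<N. if i = p then (\<Sum>q<2. M $$ (a, q) * C $$ (p * 2 + q, c)) else 0)"
      unfolding sum_lessThan_mult using M C i digit_less[OF i(1,2)] digit_less[of _ N _ 2]
      by (intro sum.cong refl) (auto simp: kron_index intro!: sum.cong)
    also have "\<dots> = (\<Sum>q<2. M $$ (a, q) * C $$ (i * 2 + q, c))" using i by simp
    finally show ?thesis by (simp add: sum_lessThan_2)
  qed
  have right: "(C * (1\<^sub>m N \<otimes>\<^sub>m M)) $$ (r, j * 2 + b) = C $$ (r, j * 2) * M $$ (0, b) + C $$ (r, j * 2 + 1) * M $$ (Suc 0, b)"
    if M: "M \<in> carrier_mat 2 2" and j: "j < N" "b < 2" "r < N * 2" for M j b r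
  proof -
    have "(C * (1\<^sub>m N \<otimes>\<^sub>m M)) $$ (r, j * 2 + b) = (\<Sum>p<N * 2. C $$ (r, p) * (1\<^sub>m N \<otimes>\<^sub>m M) $$ (p, j * 2 + b))"
      using M C j digit_less[OF j(1,2)] by (simp add: scalar_prod_def lessThan_atLeast0)
    also have "\<dots> = (\<Sum>p<N. if p = j then (\<Sum>q<2. C $$ (r, p * 2 + q) * M $$ (q, b)) else 0)"
      unfolding sum_lessThan_mult using M C j digit_less[OF j(1,2)] digit_less[of _ N _ 2]
      by (intro sum.cong refl) (auto simp: kron_index intro!: sum.cong)
    also have "\<dots> = (\<Sum>q<2. C $$ (r, j * 2 + q) * M $$ (q, b))" using j by simp
    finally show ?thesis by (simp add: sum_lessThan_2)
  qed
  have entries: "C $$ (i * 2, j * 2 + 1) = 0" "C $$ (i * 2 + 1, j * 2) = 0"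
    "C $$ (i * 2 + 1, j * 2 + 1) = C $$ (i * 2, j * 2)" if ij: "i < N" "j < N" for i j
  proof -
    have l: "i * 2 < N * 2" "i * 2 + 1 < N * 2" "j * 2 < N * 2" "j * 2 + 1 < N * 2" using ij by auto
    show "C $$ (i * 2, j * 2 + 1) = 0"
      using left[OF matrix_unit_carrier ij(1) _ l(4), of 0 0 0] right[OF matrix_unit_carrier ij(2) _ l(1), of 1 0 0] e
      by (simp add: matrix_unit_index)
    show "C $$ (i * 2 + 1, j * 2) = 0"
      using left[OF matrix_unit_carrier ij(1) _ l(3), of 1 0 0] right[OF matrix_unit_carrier ij(2) _ l(2), of 0 0 0] e
      by (simp add: matrix_unit_index)
    show "C $$ (i * 2 + 1, j * 2 + 1) = C $$ (i * 2, j * 2)"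
      using left[OF xy_pauli_carrier ij(1) _ l(4), of 0 \<alpha>] right[OF xy_pauli_carrier ij(2) _ l(1), of 1 \<alpha>] x
      by (simp add: xy_pauli_index)
  qed
  have "C = mat N N (\<lambda>(i, j). C $$ (i * 2, j * 2)) \<otimes>\<^sub>m 1\<^sub>m 2"
  proof (rule eq_matI)
    fix r c assume "r < dim_row (mat N N (\<lambda>(i, j). C $$ (i * 2, j * 2)) \<otimes>\<^sub>m 1\<^sub>m 2)"
      "c < dim_col (mat N N (\<lambda>(i, j). C $$ (i * 2, j * 2)) \<otimes>\<^sub>m 1\<^sub>m 2)"
    then have rc: "r < N * 2" "c < N * 2" by auto
    note l = div_mod_less[OF rc(1)] div_mod_less[OF rc(2)]
    have "C $$ (r div 2 * 2 + r mod 2, c div 2 * 2 + c mod 2) =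
        (if r mod 2 = c mod 2 then C $$ (r div 2 * 2, c div 2 * 2) else 0)"
      using entries[OF l(1,3)] by (cases "even r"; cases "even c"; simp add: odd_iff_mod_2_eq_one)
    then show "C $$ (r, c) = (mat N N (\<lambda>(i, j). C $$ (i * 2, j * 2)) \<otimes>\<^sub>m 1\<^sub>m 2) $$ (r, c)"
      using rc l by (simp add: kron_index div_mult_mod_eq)
  qed (use C in auto)
  then show ?thesis by (intro bexI[of _ "mat N N (\<lambda>(i, j). C $$ (i * 2, j * 2))"]) auto
qed

lemma conj_commute:
  fixes S T B U V :: "complex mat"
  assumes c: "S \<in> carrier_mat m m" "T \<in> carrier_mat m m" "B \<in> carrier_mat m m"
    "U \<in> carrier_mat m m" "V \<in> carrier_mat m m"
    and U: "S * U = U * T" and V: "T * V = V * S" and B: "T * B = B * T"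
  shows "S * (U * B * V) = U * B * V * S"
proof -
  have "S * (U * B * V) = S * U * B * V" using c by (simp add: assoc_mult_mat[of _ m m _ m _ m])
  also have "\<dots> = U * (T * B) * V" unfolding U using c by (simp add: assoc_mult_mat[of _ m m _ m _ m])
  also have "\<dots> = U * B * (T * V)" unfolding B using c by (simp add: assoc_mult_mat[of _ m m _ m _ m])
  also have "\<dots> = U * B * V * S" unfolding V using c by (simp add: assoc_mult_mat[of _ m m _ m _ m])
  finally show ?thesis .
qed

lemma conj_twice:
  fixes B U V :: "complex mat"
  assumes "B \<in> carrier_mat m m" "U \<in> carrier_mat m m" "V \<in> carrier_mat m m"
  shows "U * (V * B * U) * V = (U * V) * B * (U * V)"
  using assms by (simp add: assoc_mult_mat[of _ m m _ m _ m])

lemma adjoint_intertwines: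
  fixes S T U :: "complex mat"
  assumes c: "S \<in> carrier_mat m m" "T \<in> carrier_mat m m" "U \<in> carrier_mat m m"
    and S: "mat_adjoint S = S" and T: "mat_adjoint T = T" and U: "S * U = U * T"
  shows "T * mat_adjoint U = mat_adjoint U * S"
proof -
  have "mat_adjoint (S * U) = mat_adjoint (U * T)" by (simp only: U)
  then show ?thesis
    unfolding mat_adjoint_mult[OF c(1,3)] mat_adjoint_mult[OF c(3,2)] S T by (rule sym)
qed

lemma site_xy_pauli_adjoint: "mat_adjoint (1\<^sub>m (2 ^ k) \<otimes>\<^sub>m xy_pauli \<alpha>) = 1\<^sub>m (2 ^ k) \<otimes>\<^sub>m xy_pauli \<alpha>"
  by (simp add: mat_adjoint_kron xy_pauli_adjoint)

lemma matrix_unit_adjoint: "mat_adjoint (matrix_unit n i i) = matrix_unit n i i"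
  by (rule eq_matI) (auto simp: mat_adjoint_entry matrix_unit_index)

lemma kron_one_commute:
  assumes "A \<in> carrier_mat m m" "M \<in> carrier_mat n n"
  shows "(1\<^sub>m m \<otimes>\<^sub>m M) * (A \<otimes>\<^sub>m 1\<^sub>m n) = (A \<otimes>\<^sub>m 1\<^sub>m n) * (1\<^sub>m m \<otimes>\<^sub>m M)"
  using kron_mult[OF one_carrier_mat assms(2,1) one_carrier_mat]
    kron_mult[OF assms(1) one_carrier_mat one_carrier_mat assms(2)] assms
  by simp

definition flip_commutant :: "real \<Rightarrow> nat \<Rightarrow> complex mat set" where
  "flip_commutant \<alpha> k = {B \<in> carrier_mat (2 ^ Suc k) (2 ^ Suc k). flip \<alpha> k * B = B * flip \<alpha> k}"

text \<open>
  The \<open>k\<close>-th unitary turns the flip into an operator on the last site, and \<open>A \<otimes> 1\<close> commutes with it.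
\<close>

lemma spin_model_algebra_subset_flip_commutant:
  "spin_model_algebra 2 (H_mat \<alpha>) k \<subseteq> flip_commutant \<alpha> k"
proof
  fix B assume "B \<in> spin_model_algebra 2 (H_mat \<alpha>) k"
  then obtain A where A: "A \<in> carrier_mat (2 ^ k) (2 ^ k)"
    and B: "B = u_odd 2 (H_mat \<alpha>) k * (A \<otimes>\<^sub>m 1\<^sub>m 2) * mat_adjoint (u_odd 2 (H_mat \<alpha>) k)"
    by (auto simp: spin_model_algebra_def)
  note U = u_odd_H_carrier[of \<alpha> k]
  have A1: "A \<otimes>\<^sub>m 1\<^sub>m 2 \<in> carrier_mat (2 ^ Suc k) (2 ^ Suc k)"
    unfolding pow2_Suc by (intro kron_carrier A one_carrier_mat)
  note X = site_carrier[OF xy_pauli_carrier[of \<alpha>], of k]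
  have "flip \<alpha> k * B = B * flip \<alpha> k" unfolding B
    by (rule conj_commute[OF flip_carrier X A1 U mat_adjoint_carrier[OF U] flip_u_odd
          adjoint_intertwines[OF flip_carrier X U flip_adjoint site_xy_pauli_adjoint flip_u_odd]
          kron_one_commute[OF A xy_pauli_carrier]])
  moreover have "B \<in> carrier_mat (2 ^ Suc k) (2 ^ Suc k)"
    unfolding B by (rule mult_carrier_mat[OF mult_carrier_mat[OF U A1] mat_adjoint_carrier[OF U]])
  ultimately show "B \<in> flip_commutant \<alpha> k" by (simp add: flip_commutant_def)
qed

text \<open>
  The inclusion in the other direction needs one more tensor factor: the commutant of the flip at a
  level has twice the dimension of the spin model algebra at that level. After conjugation,
  \<open>B \<otimes> 1\<close> commutes with \<open>X\<^sub>\<alpha>\<close> and with a diagonal projection on the new site.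
\<close>

lemma flip_commutant_kron_one:
  assumes "B \<in> flip_commutant \<alpha> k"
  shows "B \<otimes>\<^sub>m 1\<^sub>m 2 \<in> spin_model_algebra 2 (H_mat \<alpha>) (Suc k)"
proof -
  define m where "m = Suc k"
  let ?U = "u_odd 2 (H_mat \<alpha>) m"
  let ?d = "2 ^ Suc m :: nat"
  have B: "B \<in> carrier_mat (2 ^ m) (2 ^ m)" and comm: "flip \<alpha> k * B = B * flip \<alpha> k"
    using assms by (auto simp: flip_commutant_def m_def)
  note U = u_odd_H_carrier[of \<alpha> m]
  note U' = mat_adjoint_carrier[OF U]
  note X = site_carrier[OF xy_pauli_carrier[of \<alpha>], of m]
  note E = site_carrier[OF matrix_unit_carrier[of 2 0 0], of m]
  have B1: "B \<otimes>\<^sub>m 1\<^sub>m 2 \<in> carrier_mat ?d ?d"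
    unfolding pow2_Suc by (intro kron_carrier B one_carrier_mat)
  have fB: "flip \<alpha> m * (B \<otimes>\<^sub>m 1\<^sub>m 2) = (B \<otimes>\<^sub>m 1\<^sub>m 2) * flip \<alpha> m"
    using kron_mult[OF flip_carrier xy_pauli_carrier B[unfolded m_def] one_carrier_mat, of \<alpha> 0]
      kron_mult[OF B[unfolded m_def] one_carrier_mat flip_carrier xy_pauli_carrier, of \<alpha> 0] comm
    by (simp add: m_def right_mult_one_mat[OF xy_pauli_carrier] left_mult_one_mat[OF xy_pauli_carrier])
  have EB: "(1\<^sub>m (2 ^ m) \<otimes>\<^sub>m matrix_unit 2 0 0) * (B \<otimes>\<^sub>m 1\<^sub>m 2) = (B \<otimes>\<^sub>m 1\<^sub>m 2) * (1\<^sub>m (2 ^ m) \<otimes>\<^sub>m matrix_unit 2 0 0)"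
    by (rule kron_one_commute[OF B matrix_unit_carrier])
  \<comment> \<open>The candidate for \<open>A \<otimes> 1\<close> in the definition of the spin model algebra.\<close>
  define C where "C = mat_adjoint ?U * (B \<otimes>\<^sub>m 1\<^sub>m 2) * ?U"
  have C: "C \<in> carrier_mat (2 ^ m * 2) (2 ^ m * 2)"
    unfolding C_def pow2_Suc[symmetric] by (rule mult_carrier_mat[OF mult_carrier_mat[OF U' B1] U])
  have Ead: "mat_adjoint (1\<^sub>m (2 ^ m) \<otimes>\<^sub>m matrix_unit 2 0 0) = 1\<^sub>m (2 ^ m) \<otimes>\<^sub>m matrix_unit 2 0 0"
    by (simp add: mat_adjoint_kron matrix_unit_adjoint)
  have "(1\<^sub>m (2 ^ m) \<otimes>\<^sub>m xy_pauli \<alpha>) * C = C * (1\<^sub>m (2 ^ m) \<otimes>\<^sub>m xy_pauli \<alpha>)"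
    unfolding C_def
    by (rule conj_commute[OF X flip_carrier B1 U' U
          adjoint_intertwines[OF flip_carrier X U flip_adjoint site_xy_pauli_adjoint flip_u_odd] flip_u_odd fB])
  moreover have "(1\<^sub>m (2 ^ m) \<otimes>\<^sub>m matrix_unit 2 0 0) * C = C * (1\<^sub>m (2 ^ m) \<otimes>\<^sub>m matrix_unit 2 0 0)"
    unfolding C_def
    by (rule conj_commute[OF E E B1 U' U adjoint_intertwines[OF E E U Ead Ead diagonal_u_odd] diagonal_u_odd EB])
  ultimately obtain A where A: "A \<in> carrier_mat (2 ^ m) (2 ^ m)" and CA: "C = A \<otimes>\<^sub>m 1\<^sub>m 2"
    using commutant_last_site[OF C] by blast
  have "?U * C * mat_adjoint ?U = (?U * mat_adjoint ?U) * (B \<otimes>\<^sub>m 1\<^sub>m 2) * (?U * mat_adjoint ?U)"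
    unfolding C_def by (rule conj_twice[OF B1 U U'])
  also have "\<dots> = B \<otimes>\<^sub>m 1\<^sub>m 2"
    unfolding u_odd_unitary left_mult_one_mat[OF B1] by (rule right_mult_one_mat[OF B1])
  finally show ?thesis using A unfolding CA spin_model_algebra_def m_def
    by (intro image_eqI[of _ _ A]) auto
qed

text \<open>
  The trace-preserving conditional expectation onto the commutant of the flip.
\<close>

definition flip_average :: "real \<Rightarrow> nat \<Rightarrow> complex mat \<Rightarrow> complex mat" where
  "flip_average \<beta> k A = (1 / 2) \<cdot>\<^sub>m (A + flip \<beta> k * A * flip \<beta> k)"

lemma flip_average_mem:
  assumes A: "A \<in> carrier_mat (2 ^ Suc k) (2 ^ Suc k)"
  shows "flip_average \<beta> k A \<in> flip_commutant \<beta> k"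
proof -
  let ?d = "2 ^ Suc k :: nat" and ?F = "flip \<beta> k"
  note F = flip_carrier[of \<beta> k]
  note FA = mult_carrier_mat[OF F A] and AF = mult_carrier_mat[OF A F]
  note FAF = mult_carrier_mat[OF FA F]
  \<comment> \<open>Multiplying by the flip on either side interchanges the two summands.\<close>
  have l: "?F * (?F * A * ?F) = A * ?F"
    using assoc_mult_mat[OF F FA F] assoc_mult_mat[OF F F A] left_mult_one_mat[OF A] by (simp add: flip_square)
  have r: "?F * A * ?F * ?F = ?F * A"
    using assoc_mult_mat[OF FA F F] right_mult_one_mat[OF FA] by (simp add: flip_square)
  have "?F * (A + ?F * A * ?F) = ?F * A + A * ?F"
    unfolding mult_add_distrib_mat[OF F A FAF] l ..
  also have "\<dots> = (A + ?F * A * ?F) * ?F"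
    unfolding add_mult_distrib_mat[OF A FAF F] r by (rule comm_add_mat[OF FA AF])
  finally have "?F * (A + ?F * A * ?F) = (A + ?F * A * ?F) * ?F" .
  then have "?F * flip_average \<beta> k A = flip_average \<beta> k A * ?F"
    unfolding flip_average_def mult_smult_distrib[OF F add_carrier_mat[OF FAF]]
      mult_smult_assoc_mat[OF add_carrier_mat[OF FAF] F] by simp
  moreover have "flip_average \<beta> k A \<in> carrier_mat ?d ?d"
    unfolding flip_average_def by (rule smult_carrier_mat[OF add_carrier_mat[OF FAF]])
  ultimately show ?thesis by (simp add: flip_commutant_def)
qed

section \<open>Hilbert space operators and the weak operator topology\<close>

lemma scaleC_one [simp]: "1 *\<^sub>C x = x"
  using scaleR_eq_scaleC[of 1 x] by simp

lemma scaleC_zero_right [simp]: "c *\<^sub>C (0 :: 'h::complex_hilbert_space) = 0"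
  using scaleC_add_right[of c "0 :: 'h" 0] by simp

lemma scaleC_diff_left: "(c - d) *\<^sub>C x = c *\<^sub>C x - d *\<^sub>C x"
  using scaleC_add_left[of "c - d" d x] by (simp add: algebra_simps)

lemma cinner_scaleC_left: "cinner (c *\<^sub>C x) y = cnj c * cinner x y"
  by (metis cinner_commute cinner_scaleC_right complex_cnj_mult)

lemma cinner_zero_right [simp]: "cinner x 0 = 0"
  using cinner_scaleC_right[of x 0 0] by simp

lemma cinner_diff_right: "cinner x (y - z) = cinner x y - cinner x z"
  using cinner_add_right[of x "y - z" z] by (simp add: algebra_simps)

lemma cinner_scaleR_right: "cinner x (r *\<^sub>R y) = of_real r * cinner x y"
  by (simp add: scaleR_eq_scaleC cinner_scaleC_right)

lemma norm_scaleC: "norm (c *\<^sub>C x) = cmod c * norm x"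
proof (rule power2_eq_imp_eq)
  have "c * cnj c = of_real ((cmod c)\<^sup>2)" by (metis complex_norm_square)
  then have "cinner (c *\<^sub>C x) (c *\<^sub>C x) = of_real ((cmod c)\<^sup>2) * cinner x x"
    by (simp add: cinner_scaleC_left cinner_scaleC_right mult.assoc mult.left_commute)
  then show "(norm (c *\<^sub>C x))\<^sup>2 = (cmod c * norm x)\<^sup>2"
    by (simp add: power2_norm_eq_inner inner_eq_Re_cinner power_mult_distrib del: dot_square_norm)
qed auto

text \<open>
  The real Cauchy--Schwarz inequality, applied after rotating one vector by a phase that makes the
  inner product real and nonnegative.
\<close>

lemma cmod_cinner_le: "cmod (cinner x y) \<le> norm x * norm y"
proof (cases "cinner x y = 0")
  case False
  define c where "c = cnj (cinner x y) / of_real (cmod (cinner x y))"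
  have "cmod c = 1" using False by (simp add: c_def norm_divide)
  have "cinner x (c *\<^sub>C y) = of_real (cmod (cinner x y))"
    using False complex_norm_square[of "cinner x y"]
    by (simp add: c_def cinner_scaleC_right power2_eq_square mult.commute nonzero_divide_eq_eq)
  then have "cmod (cinner x y) = inner x (c *\<^sub>C y)" by (simp add: inner_eq_Re_cinner)
  also have "\<dots> \<le> norm x * norm (c *\<^sub>C y)" by (rule norm_cauchy_schwarz)
  finally show ?thesis by (simp add: norm_scaleC \<open>cmod c = 1\<close>)
qed simp

lemma bounded_operatorsD: "T \<in> bounded_operators \<Longrightarrow> T (c *\<^sub>C \<xi>) = c *\<^sub>C T \<xi>"
  by (simp add: bounded_operators_def)

lemma bounded_operators_add: "S \<in> bounded_operators \<Longrightarrow> T \<in> bounded_operators \<Longrightarrow> S + T \<in> bounded_operators"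
  by (simp add: bounded_operators_def blinfun.add_left scaleC_add_right)

lemma bounded_operators_scaleR: "T \<in> bounded_operators \<Longrightarrow> r *\<^sub>R T \<in> bounded_operators"
  by (simp add: bounded_operators_def blinfun.scaleR_left scaleR_eq_scaleC scaleC_scaleC mult.commute)

lemma bounded_operators_diff:
  assumes "S \<in> bounded_operators" "T \<in> bounded_operators" shows "S - T \<in> bounded_operators"
  using bounded_operators_add[OF assms(1) bounded_operators_scaleR[OF assms(2), of "- 1"]] by simp

lemma bounded_operators_compose: "S \<in> bounded_operators \<Longrightarrow> T \<in> bounded_operators \<Longrightarrow> S o\<^sub>L T \<in> bounded_operators"
  by (simp add: bounded_operators_def)

lemma tau_norm_vector_state:
  assumes "T \<in> bounded_operators"
  shows "tau_norm (vector_state \<Omega>) T = norm (T \<Omega>)"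
proof -
  have "cinner \<Omega> (cadjoint T (T \<Omega>)) = cnj (cinner (T \<Omega>) (T \<Omega>))"
    by (metis cinner_cadjoint[OF assms] cinner_commute)
  then have "Re (cinner \<Omega> (cadjoint T (T \<Omega>))) = inner (T \<Omega>) (T \<Omega>)"
    by (simp add: inner_eq_Re_cinner)
  then show ?thesis by (simp add: tau_norm_def vector_state_def norm_eq_sqrt_inner)
qed

lemma topspace_weak_operator_topology: "topspace weak_operator_topology = bounded_operators"
  by (auto simp: weak_operator_topology_def topspace_pullback_topology)

lemma continuous_map_coefficient:
  fixes \<xi> \<eta> :: "'h::complex_hilbert_space"
  shows "continuous_map weak_operator_topology euclidean (\<lambda>T. cinner \<xi> (T \<eta>))"
proof -
  have "continuous_map (euclidean :: ('h \<times> 'h \<Rightarrow> complex) topology) euclidean (\<lambda>f. f (\<xi>, \<eta>))"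
    unfolding continuous_map_iff_continuous2
    by (rule continuous_on_subset[OF continuous_on_product_coordinates]) simp
  from continuous_map_pullback[OF this, of bounded_operators "\<lambda>T p. cinner (fst p) (T (snd p))"]
  show ?thesis by (simp add: weak_operator_topology_def o_def)
qed

lemma continuous_map_into_weak_operator_topology:
  fixes \<Phi> :: "'a \<Rightarrow> ('h::complex_hilbert_space \<Rightarrow>\<^sub>L 'h)"
  assumes "\<And>\<xi> \<eta>. continuous_map X euclidean (\<lambda>x. cinner \<xi> (\<Phi> x \<eta>))"
    and "\<And>x. x \<in> topspace X \<Longrightarrow> \<Phi> x \<in> bounded_operators"
  shows "continuous_map X weak_operator_topology \<Phi>"
  unfolding weak_operator_topology_def
proof (rule continuous_map_pullback')
  show "continuous_map X euclidean ((\<lambda>T p. cinner (fst p) (blinfun_apply T (snd p))) \<circ> \<Phi>)"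
    unfolding euclidean_product_topology[symmetric] continuous_map_componentwise_UNIV o_def
    using assms(1) by simp
qed (use assms(2) in auto)

text \<open>
  Matrix coefficients are weakly continuous, so their zero sets are weakly closed.
\<close>

lemma weak_closure_orthogonal:
  assumes T: "T \<in> weak_operator_topology closure_of S"
    and S: "\<And>A. A \<in> S \<Longrightarrow> cinner \<xi> (A \<eta>) = 0"
  shows "cinner \<xi> (T \<eta>) = 0"
proof -
  let ?f = "\<lambda>T. cinner \<xi> (blinfun_apply T \<eta>)"
  have "?f ` (weak_operator_topology closure_of S) \<subseteq> euclidean closure_of (?f ` S)"
    by (rule continuous_map_image_closure_subset[OF continuous_map_coefficient])
  also have "\<dots> \<subseteq> closure {0}"
    unfolding euclidean_closure_of by (rule closure_mono) (use S in auto)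
  finally show ?thesis using T by auto
qed

text \<open>
  Multiplication by fixed operators on both sides moves over to the two vectors of a matrix
  coefficient; this carries the finite-dimensional averaging to the weak closures.
\<close>

lemma continuous_map_average:
  assumes a: "a \<in> bounded_operators" and b: "b \<in> bounded_operators"
  shows "continuous_map weak_operator_topology weak_operator_topology (\<lambda>T. (1 / 2) *\<^sub>R (T + (a o\<^sub>L T o\<^sub>L b)))"
proof (rule continuous_map_into_weak_operator_topology)
  fix \<xi> \<eta> :: 'a
  have eq: "cinner \<xi> (((1 / 2) *\<^sub>R (T + (a o\<^sub>L T o\<^sub>L b))) \<eta>)
      = (1 / 2) * (cinner \<xi> (T \<eta>) + cinner (cadjoint a \<xi>) (T (b \<eta>)))" for T
    by (simp add: blinfun.scaleR_left blinfun.add_left cinner_scaleR_right cinner_add_right cinner_cadjoint[OF a])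
  have sum: "continuous_map weak_operator_topology euclidean
      (\<lambda>T. cinner \<xi> (T \<eta>) + cinner (cadjoint a \<xi>) (T (b \<eta>)))"
    by (intro continuous_map_add continuous_map_coefficient)
  have half: "continuous_map euclidean euclidean (\<lambda>z::complex. (1 / 2) * z)"
    by (simp add: continuous_map_iff_continuous2 continuous_intros)
  from continuous_map_compose[OF sum half]
  show "continuous_map weak_operator_topology euclidean
      (\<lambda>T. cinner \<xi> (((1 / 2) *\<^sub>R (T + (a o\<^sub>L T o\<^sub>L b))) \<eta>))"
    by (simp add: eq o_def)
next
  fix T :: "'a \<Rightarrow>\<^sub>L 'a" assume "T \<in> topspace weak_operator_topology"
  then show "(1 / 2) *\<^sub>R (T + (a o\<^sub>L T o\<^sub>L b)) \<in> bounded_operators"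
    using a b by (simp add: topspace_weak_operator_topology bounded_operators_scaleR
        bounded_operators_add bounded_operators_compose)
qed

text \<open>
  With \<open>t = c p + c\<^sup>* q\<close> and \<open>t' = t\<^sup>*\<close> the diagonal blocks of \<open>x - t x t\<^sup>*\<close> vanish and the
  off-diagonal ones are \<open>p x q\<close> and \<open>q x p\<close>, up to factors of modulus \<open>\<bar>1 - c\<^sup>2\<bar> = 2 \<bar>Im c\<bar>\<close>. As
  the ranges of \<open>p\<close> and \<open>q\<close> are orthogonal, the two blocks are controlled by
  \<open>q \<omega>\<close> and \<open>p \<omega>\<close> separately.
\<close>

lemma twisted_commutator_bound:
  fixes p q x :: "'h::complex_hilbert_space \<Rightarrow>\<^sub>L 'h"
  assumes lin: "p \<in> bounded_operators" "q \<in> bounded_operators" "x \<in> bounded_operators"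
    and sa: "\<And>\<xi> \<eta>. cinner (p \<xi>) \<eta> = cinner \<xi> (p \<eta>)"
    and pp: "\<And>\<xi>. p (p \<xi>) = p \<xi>" and qq: "\<And>\<xi>. q (q \<xi>) = q \<xi>"
    and pq: "\<And>\<xi>. p (q \<xi>) = 0" and qp: "\<And>\<xi>. q (p \<xi>) = 0"
    and sum: "\<And>\<xi>. p \<xi> + q \<xi> = \<xi>"
    and t: "\<And>\<xi>. t \<xi> = c *\<^sub>C p \<xi> + cnj c *\<^sub>C q \<xi>"
    and t': "\<And>\<xi>. t' \<xi> = cnj c *\<^sub>C p \<xi> + c *\<^sub>C q \<xi>"
    and c: "cmod c = 1" and x: "norm x \<le> 1"
  shows "norm (x \<omega> - t (x (t' \<omega>))) \<le> 2 * \<bar>Im c\<bar> * norm \<omega>"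
proof -
  note lin_simps = lin[THEN bounded_operatorsD] blinfun.add_right blinfun.diff_right
    scaleC_add_right scaleC_scaleC
  have pyth: "(norm \<xi>)\<^sup>2 = (norm (p \<xi>))\<^sup>2 + (norm (q \<xi>))\<^sup>2" for \<xi>
  proof -
    have "inner (p \<xi>) (q \<xi>) = 0" by (simp add: inner_eq_Re_cinner sa pq)
    then have "(norm (p \<xi> + q \<xi>))\<^sup>2 = (norm (p \<xi>))\<^sup>2 + (norm (q \<xi>))\<^sup>2"
      by (simp add: power2_norm_eq_inner inner_add inner_commute del: dot_square_norm)
    then show ?thesis by (simp add: sum)
  qed
  have contr: "norm (p (x \<xi>)) \<le> norm \<xi>" "norm (q (x \<xi>)) \<le> norm \<xi>" for \<xi>
  proof -
    have "norm (x \<xi>) \<le> norm \<xi>"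
      using norm_blinfun[of x \<xi>] x by (meson mult_left_le_one_le norm_ge_zero order_trans)
    moreover have "(norm (p (x \<xi>)))\<^sup>2 \<le> (norm (x \<xi>))\<^sup>2" "(norm (q (x \<xi>)))\<^sup>2 \<le> (norm (x \<xi>))\<^sup>2"
      by (simp_all add: pyth[of "x \<xi>"])
    ultimately show "norm (p (x \<xi>)) \<le> norm \<xi>" "norm (q (x \<xi>)) \<le> norm \<xi>"
      using power2_le_imp_le[OF _ norm_ge_zero] by (meson order_trans)+
  qed
  have cc: "c * cnj c = 1" "cnj c * c = 1"
    using c by (simp_all add: complex_norm_square[symmetric] mult.commute)
  have "1 - c * c = c * (cnj c - c)" "1 - cnj c * cnj c = cnj c * (c - cnj c)"
    by (simp_all add: cc algebra_simps)
  moreover have "cmod (cnj c - c) = 2 * \<bar>Im c\<bar>" "cmod (c - cnj c) = 2 * \<bar>Im c\<bar>"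
    by (simp_all add: cmod_def real_sqrt_mult flip: power2_eq_square)
  ultimately have cm: "cmod (1 - c * c) = 2 * \<bar>Im c\<bar>" "cmod (1 - cnj c * cnj c) = 2 * \<bar>Im c\<bar>"
    by (simp_all add: norm_mult c)
  let ?\<xi> = "x \<omega> - t (x (t' \<omega>))"
  have xsplit: "x \<omega> = x (p \<omega>) + x (q \<omega>)" by (simp add: sum flip: blinfun.add_right)
  have "p ?\<xi> = (1 - c * c) *\<^sub>C p (x (q \<omega>))"
    unfolding xsplit t t' by (simp add: lin_simps pp pq qq qp cc scaleC_diff_left)
  then have 1: "norm (p ?\<xi>) \<le> 2 * \<bar>Im c\<bar> * norm (q \<omega>)"
    using contr(1)[of "q \<omega>"] by (simp add: norm_scaleC cm mult_left_mono)
  have "q ?\<xi> = (1 - cnj c * cnj c) *\<^sub>C q (x (p \<omega>))"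
    unfolding xsplit t t' by (simp add: lin_simps pp pq qq qp cc scaleC_diff_left)
  then have 2: "norm (q ?\<xi>) \<le> 2 * \<bar>Im c\<bar> * norm (p \<omega>)"
    using contr(2)[of "p \<omega>"] by (simp add: norm_scaleC cm mult_left_mono)
  \<comment> \<open>The roles of \<open>p\<close> and \<open>q\<close> are exchanged on the right, and the two squares add up again.\<close>
  have "(norm ?\<xi>)\<^sup>2 \<le> (2 * \<bar>Im c\<bar> * norm (q \<omega>))\<^sup>2 + (2 * \<bar>Im c\<bar> * norm (p \<omega>))\<^sup>2"
    unfolding pyth[of ?\<xi>] by (intro add_mono power_mono 1 2) auto
  also have "\<dots> = (2 * \<bar>Im c\<bar> * norm \<omega>)\<^sup>2"
    unfolding power_mult_distrib[of _ "norm _"] pyth[of \<omega>] by (simp add: algebra_simps)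
  finally show ?thesis by (rule power2_le_imp_le) auto
qed

text \<open>
  A one-sided Hausdorff distance is computed by an upper bound valid for all points and a point at
  which it is attained.
\<close>

lemma SUP_INF_eqI:
  fixes d :: "'a \<Rightarrow> 'b \<Rightarrow> real"
  assumes nonneg: "\<And>x y. x \<in> P \<Longrightarrow> y \<in> Q \<Longrightarrow> 0 \<le> d x y"
    and le: "\<And>x. x \<in> P \<Longrightarrow> \<exists>y\<in>Q. d x y \<le> s"
    and ge: "\<exists>x\<in>P. \<forall>y\<in>Q. s \<le> d x y"
  shows "(SUP x\<in>P. INF y\<in>Q. d x y) = s"
proof (rule antisym)
  have inf_le: "(INF y\<in>Q. d x y) \<le> s" if x: "x \<in> P" for x
  proof -
    obtain y where y: "y \<in> Q" "d x y \<le> s" using le[OF x] by blast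
    have "bdd_below (d x ` Q)" using nonneg[OF x] by (intro bdd_belowI2[of _ 0])
    from cINF_lower[OF this y(1)] y(2) show ?thesis by linarith
  qed
  from ge obtain x0 where x0: "x0 \<in> P" "\<forall>y\<in>Q. s \<le> d x0 y" by blast
  show "(SUP x\<in>P. INF y\<in>Q. d x y) \<le> s" by (rule cSUP_least) (use x0 inf_le in auto)
  have "s \<le> (INF y\<in>Q. d x0 y)" by (rule cINF_greatest) (use x0 le in auto)
  also have "\<dots> \<le> (SUP x\<in>P. INF y\<in>Q. d x y)"
    using inf_le by (intro cSUP_upper x0(1) bdd_aboveI2[of _ _ s])
  finally show "s \<le> (SUP x\<in>P. INF y\<in>Q. d x y)" .
qed

section \<open>Two flips compared\<close>

lemma matrix_unit_mult:
  "matrix_unit 2 i i * matrix_unit 2 j j = (if i = j then matrix_unit 2 i i else 0\<^sub>m 2 2)"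
  if "i < 2" "j < 2"
  using that by (intro eq_matI) (auto simp: scalar_prod_def matrix_unit_index less_2_cases_iff numeral_2_eq_2)

lemma matrix_unit_sum: "matrix_unit 2 0 0 + matrix_unit 2 1 1 = 1\<^sub>m 2"
  by (rule eq_matI) (auto simp: matrix_unit_index less_2_cases_iff)

lemma xy_pauli_mult:
  "xy_pauli \<beta> * xy_pauli \<alpha> = cis (\<alpha> - \<beta>) \<cdot>\<^sub>m matrix_unit 2 0 0 + cis (\<beta> - \<alpha>) \<cdot>\<^sub>m matrix_unit 2 1 1"
  by (rule eq_matI)
    (auto simp: scalar_prod_def xy_pauli_index matrix_unit_index cis_mult less_2_cases_iff numeral_2_eq_2)

lemma xy_pauli_anticommute:
  "xy_pauli \<beta> * xy_pauli (\<beta> + pi / 2) = - (xy_pauli (\<beta> + pi / 2) * xy_pauli \<beta>)"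
  by (rule eq_matI)
    (auto simp: scalar_prod_def xy_pauli_index cis_mult less_2_cases_iff numeral_2_eq_2
        cis_pi_half cis_minus_pi_half)

text \<open>
  The image of a matrix of the first tensor factor at level \<open>k + 1\<close>.
\<close>

primrec lift_tensor :: "complex mat \<Rightarrow> nat \<Rightarrow> complex mat" where
  "lift_tensor A 0 = A"
| "lift_tensor A (Suc k) = lift_tensor A k \<otimes>\<^sub>m 1\<^sub>m 2"

lemma lift_tensor_carrier: "A \<in> carrier_mat 2 2 \<Longrightarrow> lift_tensor A k \<in> carrier_mat (2 ^ Suc k) (2 ^ Suc k)"
proof (induction k)
  case (Suc k)
  from kron_carrier[OF Suc.IH[OF Suc.prems] one_carrier_mat[of 2]] show ?case by (simp add: mult.commute)
qed simp

text \<open>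
  Two flips agree after the first site, so all other factors of their product cancel.
\<close>

lemma flip_mult_flip: "flip \<beta> k * flip \<alpha> k = lift_tensor (xy_pauli \<beta> * xy_pauli \<alpha>) k"
proof (induction k)
  case (Suc k)
  show ?case
    using kron_mult[OF flip_carrier xy_pauli_carrier flip_carrier xy_pauli_carrier, of \<beta> k 0 \<alpha> 0]
    by (simp add: Suc xy_pauli_square)
qed simp

lemma kron_uminus_left: "(- A) \<otimes>\<^sub>m B = - (A \<otimes>\<^sub>m B)"
  by (rule eq_matI) (auto simp: kron_index div_mod_less)

lemma flip_anticommute:
  "flip \<beta> k * lift_tensor (xy_pauli (\<beta> + pi / 2)) k = - (lift_tensor (xy_pauli (\<beta> + pi / 2)) k * flip \<beta> k)"
proof (induction k)
  case (Suc k)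
  let ?Y = "lift_tensor (xy_pauli (\<beta> + pi / 2))"
  note Y = lift_tensor_carrier[OF xy_pauli_carrier[of "\<beta> + pi / 2"], of k]
  have "flip \<beta> (Suc k) * ?Y (Suc k) = (flip \<beta> k * ?Y k) \<otimes>\<^sub>m (xy_pauli 0 * 1\<^sub>m 2)"
    unfolding flip.simps lift_tensor.simps by (rule kron_mult[OF flip_carrier xy_pauli_carrier Y one_carrier_mat])
  also have "\<dots> = - ((?Y k * flip \<beta> k) \<otimes>\<^sub>m (1\<^sub>m 2 * xy_pauli 0))"
    unfolding Suc kron_uminus_left
    by (simp only: right_mult_one_mat[OF xy_pauli_carrier] left_mult_one_mat[OF xy_pauli_carrier])
  also have "(?Y k * flip \<beta> k) \<otimes>\<^sub>m (1\<^sub>m 2 * xy_pauli 0) = ?Y (Suc k) * flip \<beta> (Suc k)"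
    unfolding flip.simps lift_tensor.simps by (rule kron_mult[OF Y one_carrier_mat flip_carrier xy_pauli_carrier, symmetric])
  finally show ?case .
qed (simp add: xy_pauli_anticommute)

lemma normalized_trace_uminus: "A \<in> carrier_mat m m \<Longrightarrow> normalized_trace (- A) = - normalized_trace A"
  by (simp add: normalized_trace_def sum_negf)

text \<open>
  \<open>X\<close> at the angle \<open>\<beta> + \<pi>/2\<close> anticommutes with \<open>X\<^sub>\<beta>\<close>; conjugating by the flip, which preserves the
  trace and fixes \<open>B\<close>, therefore changes the sign of the trace in question.
\<close>

lemma flip_commutant_trace_zero:
  assumes "B \<in> flip_commutant \<beta> k"
  shows "normalized_trace (lift_tensor (xy_pauli (\<beta> + pi / 2)) k * B) = 0"
proof -
  let ?Y = "lift_tensor (xy_pauli (\<beta> + pi / 2)) k" and ?F = "flip \<beta> k" and ?d = "2 ^ Suc k :: nat"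
  have B: "B \<in> carrier_mat ?d ?d" and FB: "?F * B = B * ?F" using assms by (auto simp: flip_commutant_def)
  note Y = lift_tensor_carrier[OF xy_pauli_carrier[of "\<beta> + pi / 2"], of k]
  note F = flip_carrier[of \<beta> k]
  note YB = mult_carrier_mat[OF Y B] and YF = mult_carrier_mat[OF Y F]
  have "?F * (?Y * B) = ?F * ?Y * B" by (rule assoc_mult_mat[OF F Y B, symmetric])
  also have "\<dots> = - (?Y * ?F * B)"
    unfolding flip_anticommute by (rule uminus_mult_left_mat) (use B YF in auto)
  also have "?Y * ?F * B = ?Y * B * ?F"
    unfolding assoc_mult_mat[OF Y F B] assoc_mult_mat[OF Y B F] FB ..
  finally have anti: "?F * (?Y * B) = - (?Y * B * ?F)" .
  have "normalized_trace (?Y * B) = normalized_trace (?F * ?F * (?Y * B))"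
    unfolding flip_square left_mult_one_mat[OF YB] ..
  also have "\<dots> = normalized_trace (?F * (?Y * B) * ?F)"
    unfolding assoc_mult_mat[OF F F YB] by (rule normalized_trace_commute[OF F mult_carrier_mat[OF F YB]])
  also have "?F * (?Y * B) * ?F = - (?Y * B * ?F * ?F)"
    unfolding anti by (rule uminus_mult_left_mat) (use F YB in auto)
  also have "?Y * B * ?F * ?F = ?Y * B"
    unfolding assoc_mult_mat[OF YB F F] flip_square by (rule right_mult_one_mat[OF YB])
  finally show ?thesis by (simp add: normalized_trace_uminus[OF YB])
qed

lemma normalized_trace_xy_pauli:
  "normalized_trace (xy_pauli (\<beta> + pi / 2) * xy_pauli \<alpha>) = complex_of_real (sin (\<alpha> - \<beta>))"
  by (simp add: normalized_trace_def scalar_prod_def xy_pauli_index numeral_2_eq_2 cis_mult complex_eq_iff)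
    (simp add: cos_add sin_add cos_diff sin_diff algebra_simps)

section \<open>The distance in the GNS representation\<close>

context gns_representation
begin

lemma tensor_powersI: "A \<in> carrier_mat (n ^ k) (n ^ k) \<Longrightarrow> A \<in> tensor_powers n"
  by (auto simp: tensor_powers_def)

lemma cinner_rep_adjoint:
  assumes "A \<in> tensor_powers n"
  shows "cinner (\<pi> (mat_adjoint A) \<xi>) \<eta> = cinner \<xi> (\<pi> A \<eta>)"
  using cinner_cadjoint[OF rep_bounded[OF assms]] rep_adjoint[OF assms] by simp

lemma norm_rep_unitary:
  assumes A: "A \<in> carrier_mat (n ^ k) (n ^ k)" and "mat_adjoint A * A = 1\<^sub>m (n ^ k)"
  shows "norm (\<pi> A \<xi>) = norm \<xi>"
proof -
  have "cinner (\<pi> A \<xi>) (\<pi> A \<xi>) = cinner (\<pi> (mat_adjoint A) (\<pi> A \<xi>)) \<xi>"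
    by (rule cinner_rep_adjoint[OF tensor_powersI[OF A], symmetric])
  also have "\<pi> (mat_adjoint A) (\<pi> A \<xi>) = \<xi>"
    using rep_mult[OF mat_adjoint_carrier[OF A] A] rep_one[of k] assms(2)
    by (metis blinfun_apply_blinfun_compose id_blinfun.rep_eq id_apply)
  finally show ?thesis by (simp add: norm_eq_sqrt_inner inner_eq_Re_cinner)
qed

lemma norm_cyclic_vector: "norm \<Omega> = 1"
proof -
  have "cinner \<Omega> (\<pi> (1\<^sub>m (n ^ 0)) \<Omega>) = normalized_trace (1\<^sub>m (n ^ 0))"
    by (rule rep_trace, rule tensor_powersI[of _ 0]) simp
  then have "cinner \<Omega> \<Omega> = 1" by (simp add: rep_one[of 0, simplified] normalized_trace_def)
  then show ?thesis by (simp add: norm_eq_sqrt_inner inner_eq_Re_cinner)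
qed

lemma spin_model_subfactor_bounded: "spin_model_subfactor n \<pi> u \<subseteq> bounded_operators"
  unfolding spin_model_subfactor_def topspace_weak_operator_topology[symmetric]
  by (rule closure_of_subset_topspace)

lemma rep_mem_spin_model_subfactor:
  assumes u: "u \<in> carrier_mat n n" and A: "A \<in> spin_model_algebra n u k" and k: "k \<ge> 1"
  shows "\<pi> A \<in> spin_model_subfactor n \<pi> u"
proof -
  let ?S = "\<pi> ` (\<Union>k\<in>{1..}. spin_model_algebra n u k)"
  have "?S \<subseteq> topspace weak_operator_topology"
    unfolding topspace_weak_operator_topology
    using spin_model_algebra_subset[OF u] rep_bounded by blast
  moreover have "\<pi> A \<in> ?S" using A k by auto
  ultimately show ?thesis unfolding spin_model_subfactor_def using closure_of_subset by blast
qed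

end

context
  fixes \<pi> :: "complex mat \<Rightarrow> ('h::complex_hilbert_space \<Rightarrow>\<^sub>L 'h)" and \<Omega> :: 'h
  assumes gns: "gns_representation 2 \<pi> \<Omega>"
begin

interpretation gns_representation 2 \<pi> \<Omega> by (rule gns)

lemma rep_carrier: "A \<in> carrier_mat (2 ^ Suc k) (2 ^ Suc k) \<Longrightarrow> A \<in> tensor_powers 2"
  by (rule tensor_powersI)

lemma rep_2: "A \<in> carrier_mat 2 2 \<Longrightarrow> A \<in> tensor_powers 2"
  by (rule tensor_powersI[of _ 1]) simp

lemma rep_mult_2:
  "A \<in> carrier_mat 2 2 \<Longrightarrow> B \<in> carrier_mat 2 2 \<Longrightarrow> \<pi> (A * B) = \<pi> A o\<^sub>L \<pi> B"
  using rep_mult[of A 1 B] by simp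

lemma rep_add_2:
  "A \<in> carrier_mat 2 2 \<Longrightarrow> B \<in> carrier_mat 2 2 \<Longrightarrow> \<pi> (A + B) = \<pi> A + \<pi> B"
  using rep_add[of A 1 B] by simp

lemma rep_zero_2: "\<pi> (0\<^sub>m 2 2) = 0"
proof -
  have "0\<^sub>m 2 2 + 0\<^sub>m 2 2 = (0\<^sub>m 2 2 :: complex mat)" by simp
  then show ?thesis using rep_add_2[of "0\<^sub>m 2 2" "0\<^sub>m 2 2"] by simp
qed

lemma rep_lift_tensor: "A \<in> carrier_mat 2 2 \<Longrightarrow> \<pi> (lift_tensor A k) = \<pi> A"
  by (induction k) (simp_all add: rep_incl[OF rep_carrier[OF lift_tensor_carrier]])

text \<open>
  For \<open>A\<close> fixed by the flip of angle \<open>\<alpha>\<close>, conjugation by the other flip equals conjugation by the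
  product of the two flips, which sits in the first tensor factor. As a formula in \<open>\<pi> A\<close>
  the right-hand side does not depend on the level \<open>k\<close>, and so extends to the weak closure.
\<close>

lemma rep_flip_average:
  assumes A: "A \<in> flip_commutant \<alpha> k"
  shows "\<pi> (flip_average \<beta> k A)
    = (1 / 2) *\<^sub>R (\<pi> A + (\<pi> (xy_pauli \<beta> * xy_pauli \<alpha>) o\<^sub>L \<pi> A o\<^sub>L \<pi> (xy_pauli \<alpha> * xy_pauli \<beta>)))"
proof -
  let ?d = "2 ^ Suc k :: nat" and ?F = "flip \<beta> k" and ?G = "flip \<alpha> k"
  have cA: "A \<in> carrier_mat ?d ?d" and GA: "?G * A = A * ?G" using A by (auto simp: flip_commutant_def)
  note F = flip_carrier[of \<beta> k] and G = flip_carrier[of \<alpha> k]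
  note FA = mult_carrier_mat[OF F cA] and FG = mult_carrier_mat[OF F G] and GF = mult_carrier_mat[OF G F]
  have "?F * A = ?F * (?G * (?G * A))"
    using assoc_mult_mat[OF G G cA] left_mult_one_mat[OF cA] by (simp add: flip_square)
  also have "\<dots> = ?F * ?G * A * ?G"
    unfolding GA using assoc_mult_mat[OF F G mult_carrier_mat[OF cA G]] assoc_mult_mat[OF FG cA G] by simp
  finally have "?F * A * ?F = (?F * ?G) * A * (?G * ?F)"
    using assoc_mult_mat[OF mult_carrier_mat[OF FG cA] G F] by simp
  then have eq: "\<pi> (?F * A * ?F) = \<pi> (xy_pauli \<beta> * xy_pauli \<alpha>) o\<^sub>L \<pi> A o\<^sub>L \<pi> (xy_pauli \<alpha> * xy_pauli \<beta>)"
    using rep_mult[OF mult_carrier_mat[OF FG cA] GF] rep_mult[OF FG cA]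
    by (simp add: flip_mult_flip rep_lift_tensor mult_carrier_mat[OF xy_pauli_carrier xy_pauli_carrier])
  have sum: "A + ?F * A * ?F \<in> tensor_powers 2"
    by (rule rep_carrier[OF add_carrier_mat[OF mult_carrier_mat[OF FA F]]])
  show ?thesis
    unfolding flip_average_def
    by (rule blinfun_eqI)
      (simp add: rep_smult[OF sum] rep_add[OF cA mult_carrier_mat[OF FA F]] eq blinfun.scaleR_left scaleR_eq_scaleC)
qed

lemma norm_rep_xy_pauli_mult:
  "norm (\<pi> (xy_pauli \<beta> * xy_pauli \<alpha>)) \<le> 1"
proof (rule norm_blinfun_bound)
  have n: "norm (\<pi> (xy_pauli \<gamma>) \<xi>) = norm \<xi>" for \<gamma> \<xi>
    by (rule norm_rep_unitary[of _ 1]) (simp_all add: xy_pauli_adjoint xy_pauli_square)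
  show "norm (\<pi> (xy_pauli \<beta> * xy_pauli \<alpha>) \<xi>) \<le> 1 * norm \<xi>" for \<xi>
    by (simp add: rep_mult_2 n)
qed simp

lemma norm_rep_xy_pauli: "norm (\<pi> (xy_pauli \<alpha>)) \<le> 1"
proof (rule norm_blinfun_bound)
  show "norm (\<pi> (xy_pauli \<alpha>) \<xi>) \<le> 1 * norm \<xi>" for \<xi>
    using norm_rep_unitary[of "xy_pauli \<alpha>" 1 \<xi>] by (simp add: xy_pauli_adjoint xy_pauli_square)
qed simp

text \<open>
  The approximant is the average of \<open>x\<close> and \<open>t x t\<^sup>*\<close>, the image of \<open>x\<close> under the conditional
  expectation onto the second subfactor. It is a contraction since \<open>t\<close> is unitary.
\<close>

lemma spin_model_subfactor_close:
  assumes x: "x \<in> op_unit_ball (spin_model_subfactor 2 \<pi> (H_mat \<alpha>))"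
  shows "\<exists>y\<in>op_unit_ball (spin_model_subfactor 2 \<pi> (H_mat \<beta>)). norm (blinfun_apply (x - y) \<Omega>) \<le> \<bar>sin (\<alpha> - \<beta>)\<bar>"
proof -
  let ?t = "\<pi> (xy_pauli \<beta> * xy_pauli \<alpha>)" and ?t' = "\<pi> (xy_pauli \<alpha> * xy_pauli \<beta>)"
  let ?\<Phi> = "\<lambda>T. (1 / 2) *\<^sub>R (T + (?t o\<^sub>L T o\<^sub>L ?t'))"
  let ?p = "\<pi> (matrix_unit 2 0 0)" and ?q = "\<pi> (matrix_unit 2 1 1)"
  note cXX = mult_carrier_mat[OF xy_pauli_carrier xy_pauli_carrier]
  have xN: "x \<in> spin_model_subfactor 2 \<pi> (H_mat \<alpha>)" and x1: "norm x \<le> 1"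
    using x by (auto simp: op_unit_ball_def)
  have xb: "x \<in> bounded_operators" using xN spin_model_subfactor_bounded by blast
  have "?\<Phi> ` (\<pi> ` (\<Union>k\<in>{1..}. spin_model_algebra 2 (H_mat \<alpha>) k))
      \<subseteq> \<pi> ` (\<Union>k\<in>{1..}. spin_model_algebra 2 (H_mat \<beta>) k)"
  proof (intro image_subsetI)
    fix T assume "T \<in> \<pi> ` (\<Union>k\<in>{1..}. spin_model_algebra 2 (H_mat \<alpha>) k)"
    then obtain k A where T: "T = \<pi> A" and "A \<in> spin_model_algebra 2 (H_mat \<alpha>) k" by blast
    then have A: "A \<in> flip_commutant \<alpha> k" using spin_model_algebra_subset_flip_commutant by blast
    then have mem: "flip_average \<beta> k A \<in> flip_commutant \<beta> k"
      by (intro flip_average_mem) (simp add: flip_commutant_def)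
    then have "flip_average \<beta> k A \<in> tensor_powers 2"
      by (intro rep_carrier[of _ k]) (simp add: flip_commutant_def)
    then have "?\<Phi> T = \<pi> (flip_average \<beta> k A \<otimes>\<^sub>m 1\<^sub>m 2)"
      unfolding T rep_flip_average[OF A, symmetric] by (rule rep_incl[symmetric])
    moreover have "flip_average \<beta> k A \<otimes>\<^sub>m 1\<^sub>m 2 \<in> (\<Union>k\<in>{1..}. spin_model_algebra 2 (H_mat \<beta>) k)"
      using flip_commutant_kron_one[OF mem] by (intro UN_I[of "Suc k"]) simp_all
    ultimately show "?\<Phi> T \<in> \<pi> ` (\<Union>k\<in>{1..}. spin_model_algebra 2 (H_mat \<beta>) k)"
      by (metis imageI)
  qed
  from order_trans[OF continuous_map_image_closure_subset[OF continuous_map_average] closure_of_mono[OF this]]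
  have "?\<Phi> ` spin_model_subfactor 2 \<pi> (H_mat \<alpha>) \<subseteq> spin_model_subfactor 2 \<pi> (H_mat \<beta>)"
    unfolding spin_model_subfactor_def using rep_bounded[OF rep_2[OF cXX]] by simp
  then have "?\<Phi> x \<in> spin_model_subfactor 2 \<pi> (H_mat \<beta>)" using xN by blast
  moreover have "norm (?\<Phi> x) \<le> 1"
  proof -
    have "norm (?t o\<^sub>L x o\<^sub>L ?t') \<le> norm ?t * norm x * norm ?t'"
      by (meson norm_blinfun_compose order_trans mult_right_mono norm_ge_zero)
    also have "\<dots> \<le> 1 * 1 * 1"
      by (intro mult_mono x1 norm_rep_xy_pauli_mult) auto
    finally show ?thesis using norm_triangle_ineq[of x "?t o\<^sub>L x o\<^sub>L ?t'"] x1 by simp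
  qed
  moreover have "norm ((x - ?\<Phi> x) \<Omega>) \<le> \<bar>sin (\<alpha> - \<beta>)\<bar>"
  proof -
    have mu: "matrix_unit 2 i i \<in> tensor_powers 2" for i by (rule rep_2) simp
    have comp: "\<pi> (matrix_unit 2 i i) (\<pi> (matrix_unit 2 j j) \<xi>)
        = (if i = j then \<pi> (matrix_unit 2 i i) \<xi> else 0)" if "i < 2" "j < 2" for i j \<xi>
      using rep_mult_2[of "matrix_unit 2 i i" "matrix_unit 2 j j"] matrix_unit_mult[OF that] rep_zero_2
      by (metis blinfun_apply_blinfun_compose matrix_unit_carrier zero_blinfun.rep_eq)
    have sum: "?p \<xi> + ?q \<xi> = \<xi>" for \<xi>
      using rep_add_2[of "matrix_unit 2 0 0" "matrix_unit 2 1 1"] rep_one[of 1]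
      by (simp only: matrix_unit_carrier matrix_unit_sum power_one_right flip: blinfun.add_left)
        (simp add: id_blinfun.rep_eq)
    have t: "\<pi> (xy_pauli \<beta> * xy_pauli \<alpha>) \<xi> = cis (\<alpha> - \<beta>) *\<^sub>C ?p \<xi> + cis (\<beta> - \<alpha>) *\<^sub>C ?q \<xi>" for \<alpha> \<beta> \<xi>
      by (simp add: xy_pauli_mult rep_add_2 blinfun.add_left rep_smult[OF mu])
    have cnj: "cis (\<beta> - \<alpha>) = cnj (cis (\<alpha> - \<beta>))" by (simp add: cis_cnj)
    have sa: "cinner (?p \<xi>) \<eta> = cinner \<xi> (?p \<eta>)" for \<xi> \<eta>
      using cinner_rep_adjoint[OF mu, of 0] by (simp add: matrix_unit_adjoint)
    have "norm (x \<Omega> - ?t (x (?t' \<Omega>))) \<le> 2 * \<bar>Im (cis (\<alpha> - \<beta>))\<bar> * norm \<Omega>"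
      by (rule twisted_commutator_bound[OF rep_bounded[OF mu] rep_bounded[OF mu] xb sa _ _ _ _ sum
            t[of \<beta> \<alpha>, unfolded cnj] t[of \<alpha> \<beta>, unfolded cnj] _ x1])
        (simp_all add: comp)
    moreover have "(x - ?\<Phi> x) \<Omega> = (1 / 2) *\<^sub>R (x \<Omega> - ?t (x (?t' \<Omega>)))"
    proof -
      have "\<xi> - (1 / 2) *\<^sub>R (\<xi> + \<eta>) = (1 / 2) *\<^sub>R (\<xi> - \<eta>)" for \<xi> \<eta> :: 'h
        by (simp add: algebra_simps flip: scaleR_add_left)
      then show ?thesis by (simp add: blinfun.diff_left blinfun.scaleR_left blinfun.add_left)
    qed
    ultimately show ?thesis by (simp add: norm_cyclic_vector)
  qed
  ultimately show ?thesis unfolding op_unit_ball_def by blast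
qed

text \<open>
  The witness \<open>X\<^sub>\<alpha>\<close> has vanishing diagonal, so the upper bound is sharp for it. The lower bound is
  tested against the unit vector coming from the angle \<open>\<beta> + \<pi>/2\<close>.
\<close>

lemma spin_model_subfactor_far:
  "\<exists>x\<in>op_unit_ball (spin_model_subfactor 2 \<pi> (H_mat \<alpha>)).
     \<forall>y\<in>op_unit_ball (spin_model_subfactor 2 \<pi> (H_mat \<beta>)). \<bar>sin (\<alpha> - \<beta>)\<bar> \<le> norm (blinfun_apply (x - y) \<Omega>)"
proof -
  let ?x = "\<pi> (xy_pauli \<alpha>)" and ?Y = "xy_pauli (\<beta> + pi / 2)"
  have "xy_pauli \<alpha> \<in> flip_commutant \<alpha> 0" by (simp add: flip_commutant_def)
  then have "\<pi> (xy_pauli \<alpha> \<otimes>\<^sub>m 1\<^sub>m 2) \<in> spin_model_subfactor 2 \<pi> (H_mat \<alpha>)"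
    by (intro rep_mem_spin_model_subfactor[OF H_mat_carrier flip_commutant_kron_one]) auto
  then have x: "?x \<in> op_unit_ball (spin_model_subfactor 2 \<pi> (H_mat \<alpha>))"
    using norm_rep_xy_pauli rep_incl[OF rep_2[OF xy_pauli_carrier]] by (simp add: op_unit_ball_def)
  have coeff: "cinner (\<pi> ?Y \<Omega>) (\<pi> A \<Omega>) = cinner \<Omega> (\<pi> ?Y (\<pi> A \<Omega>))" for A
    using cinner_rep_adjoint[OF rep_2[OF xy_pauli_carrier]] by (metis xy_pauli_adjoint)
  have ortho: "cinner (\<pi> ?Y \<Omega>) (y \<Omega>) = 0" if "y \<in> spin_model_subfactor 2 \<pi> (H_mat \<beta>)" for y
  proof (rule weak_closure_orthogonal[OF that[unfolded spin_model_subfactor_def]])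
    fix T assume "T \<in> \<pi> ` (\<Union>k\<in>{1..}. spin_model_algebra 2 (H_mat \<beta>) k)"
    then obtain k B where T: "T = \<pi> B" and "B \<in> spin_model_algebra 2 (H_mat \<beta>) k" by auto
    then have B: "B \<in> flip_commutant \<beta> k" using spin_model_algebra_subset_flip_commutant by blast
    then have cB: "B \<in> carrier_mat (2 ^ Suc k) (2 ^ Suc k)" by (simp add: flip_commutant_def)
    note Y = lift_tensor_carrier[OF xy_pauli_carrier[of "\<beta> + pi / 2"], of k]
    have "cinner (\<pi> ?Y \<Omega>) (T \<Omega>) = cinner \<Omega> (\<pi> (lift_tensor ?Y k * B) \<Omega>)"
      unfolding T coeff rep_mult[OF Y cB] by (simp add: rep_lift_tensor)
    also have "\<dots> = 0"
      by (simp add: rep_trace[OF rep_carrier[OF mult_carrier_mat[OF Y cB]]] flip_commutant_trace_zero[OF B])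
    finally show "cinner (\<pi> ?Y \<Omega>) (T \<Omega>) = 0" .
  qed
  have inner: "cinner (\<pi> ?Y \<Omega>) (?x \<Omega>) = complex_of_real (sin (\<alpha> - \<beta>))"
    unfolding coeff using rep_trace[OF rep_2[OF mult_carrier_mat[OF xy_pauli_carrier xy_pauli_carrier]]]
    by (simp add: rep_mult_2 flip: normalized_trace_xy_pauli)
  have "\<bar>sin (\<alpha> - \<beta>)\<bar> \<le> norm ((?x - y) \<Omega>)"
    if y: "y \<in> op_unit_ball (spin_model_subfactor 2 \<pi> (H_mat \<beta>))" for y
  proof -
    have "cinner (\<pi> ?Y \<Omega>) ((?x - y) \<Omega>) = complex_of_real (sin (\<alpha> - \<beta>))"
      using ortho y by (simp add: blinfun.diff_left cinner_diff_right inner op_unit_ball_def)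
    then have "\<bar>sin (\<alpha> - \<beta>)\<bar> = cmod (cinner (\<pi> ?Y \<Omega>) ((?x - y) \<Omega>))" by simp
    also have "\<dots> \<le> norm (\<pi> ?Y \<Omega>) * norm ((?x - y) \<Omega>)" by (rule cmod_cinner_le)
    also have "norm (\<pi> ?Y \<Omega>) = 1"
      using norm_rep_unitary[of ?Y 1 \<Omega>] norm_cyclic_vector by (simp add: xy_pauli_adjoint xy_pauli_square)
    finally show ?thesis by simp
  qed
  with x show ?thesis by blast
qed

lemma spin_model_subfactor_excess:
  "(SUP x\<in>op_unit_ball (spin_model_subfactor 2 \<pi> (H_mat \<alpha>)).
    INF y\<in>op_unit_ball (spin_model_subfactor 2 \<pi> (H_mat \<beta>)). norm (blinfun_apply (x - y) \<Omega>)) = \<bar>sin (\<alpha> - \<beta>)\<bar>"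
  by (rule SUP_INF_eqI) (rule norm_ge_zero spin_model_subfactor_close spin_model_subfactor_far, assumption?)+

end

theorem theoremA:
  fixes \<pi> :: "complex mat \<Rightarrow> ('h::complex_hilbert_space \<Rightarrow>\<^sub>L 'h)"
    and \<Omega> :: 'h
    and \<alpha> \<beta> :: real
  assumes "gns_representation 2 \<pi> \<Omega>"
    and "\<alpha> \<in> {0..<pi}"
    and "\<beta> \<in> {0..<pi}"
    and "\<alpha> \<noteq> \<beta>"
  shows "MT_dist (vector_state \<Omega>)
           (spin_model_subfactor 2 \<pi> (H_mat \<alpha>)) (spin_model_subfactor 2 \<pi> (H_mat \<beta>))
         = \<bar>sin (\<alpha> - \<beta>)\<bar>"
proof -
  interpret gns_representation 2 \<pi> \<Omega> by (rule assms(1))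
  let ?B = "\<lambda>\<gamma>. op_unit_ball (spin_model_subfactor 2 \<pi> (H_mat \<gamma>))"
  have tau: "tau_norm (vector_state \<Omega>) (x - y) = norm (blinfun_apply (x - y) \<Omega>)" if "x \<in> ?B \<gamma>" "y \<in> ?B \<delta>" for x y \<gamma> \<delta>
    using that spin_model_subfactor_bounded
    by (intro tau_norm_vector_state bounded_operators_diff) (auto simp: op_unit_ball_def)
  have "(SUP x\<in>?B \<alpha>. INF y\<in>?B \<beta>. tau_norm (vector_state \<Omega>) (x - y)) = \<bar>sin (\<alpha> - \<beta>)\<bar>"
    unfolding spin_model_subfactor_excess[OF assms(1), symmetric]
    by (intro SUP_cong INF_cong refl tau)
  moreover have "(SUP y\<in>?B \<beta>. INF x\<in>?B \<alpha>. tau_norm (vector_state \<Omega>) (x - y)) = \<bar>sin (\<beta> - \<alpha>)\<bar>"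
    unfolding spin_model_subfactor_excess[OF assms(1), symmetric]
    by (intro SUP_cong INF_cong refl) (simp add: tau blinfun.diff_left norm_minus_commute)
  moreover have "\<bar>sin (\<beta> - \<alpha>)\<bar> = \<bar>sin (\<alpha> - \<beta>)\<bar>"
    by (metis abs_minus_cancel minus_diff_eq sin_minus)
  ultimately show ?thesis by (simp add: MT_dist_def)
qed

end
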